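(* Let $\mathscr{P}$ be a $C^*$-planar algebra and let $x\in\mathscr{P}_{2,\pm}$ be $\mathfrak{F}$-positive with spectral radius $r$. Let $\mathcal{E}$, $p_{\max}$, the maximal-support PF eigenvector $\zeta$, and the $C^*$-algebra $\mathcal{C}\subseteq\mathscr{P}_{1,\pm}$ be associated with $x$ as defined in the context. Then: (1) $[p_{\max},y]=0$ for any $y\in\mathcal{C}$. Furthermore, $[\zeta,y]=0$ for any $y\in\mathcal{C}$. (2) $\zeta\mathcal{C}\subseteq\mathcal{E}$. (3) For any direct summand $\mathcal{D}$ of $\mathcal{C}$ such that $\mathcal{D}\cong M_n(\mathbb{C})$ for some $n$, we have $$\{\zeta\}''\mathcal{D}=\{p_{\mathcal{D}}\zeta\}''\mathcal{D}\cong\{p_{\mathcal{D}}\zeta\}''\otimes\mathcal{D},$$ where $p_{\mathcal{D}}$ is the union (supremum) of the projections in $\mathcal{D}$.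
   Context: $C^*$-planar algebra: a (shaded) planar algebra in the sense of Jones is a family $\mathscr{P}=\{\mathscr{P}_{n,\pm}\}_{n\ge 0}$ of complex vector spaces on which shaded planar tangles act multilinearly, compatibly with isotopy and composition of tangles. Elements of $\mathscr{P}_{n,\pm}$ are boxes with $n$ strings attached on top and $n$ on the bottom; the region at the left (marked) side is unshaded for $+$ and shaded for $-$. It is a $C^*$-planar algebra if each $\mathscr{P}_{n,\pm}$ is a finite-dimensional unital $C^*$-algebra (unit $I$ or $1$) for the vertical stacking product ($xy$ is drawn with $y$ above $x$), the involution $*$ is compatible with reflection of tangles in a horizontal line, and there are positive faithful traces $tr_{n,\pm}$ with $tr_{n,\pm}(x)=tr_{0,\pm}$(closure of $x$), the closure joining each top string to the corresponding bottom string. Fourier transform: $\mathfrak{F}:\mathscr{P}_{2,\pm}\to\mathscr{P}_{2,\mp}$, $\widehat{x}=\mathfrak{F}(x)$, is the $90^\circ$ rotation: the top-left, top-right, bottom-left, bottom-right boundary points of $\widehat{x}$ are connected respectively to the bottom-left, top-left, bottom-right, top-right points of $x$. $x\in\mathscr{P}_{2,\pm}$ is $\mathfrak{F}$-positive if $\widehat{x}$ is positive in $\mathscr{P}_{2,\mp}$. Convolution: for $u,v\in\mathscr{P}_{2,\mp}$, $u*v$ is obtained by placing $u$ to the left of $v$ and joining the top-right (bottom-right) point of $u$ to the top-left (bottom-left) point of $v$. For $y\in\mathscr{P}_{1,\pm}$, $u\in\mathscr{P}_{2,\mp}$, $y*u\in\mathscr{P}_{1,\pm}$ is obtained by placing $y$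 to the left of $u$ and joining the top (bottom) end of $y$ to the top-left (bottom-left) point of $u$. $u^{( *j)}$ is the $j$-fold convolution power, and $y*u^{( *0)}=y$. $\overline{y}\in\mathscr{P}_{1,\mp}$ is the $180^\circ$ rotation of $y\in\mathscr{P}_{1,\pm}$; $a\otimes b$ is horizontal juxtaposition; $\mathcal{R}(a)$ is the range projection of $a$. PF data of $x$: $\mathcal{E}=\{y\in\mathscr{P}_{1,\pm}:y*\widehat{x}=ry\}$; $\mathcal{E}^+$ is its set of positive elements; $p_{\max}$ is the largest element of $\mathscr{Q}=\{\mathcal{R}(y):y\in\mathcal{E}^+\}$. The maximal-support PF eigenvector is $\zeta=\lim_{\mathbb{R}\ni z\to r^+}(z-r)\sum_{j=0}^\infty \frac{p_{\max}*\widehat{x}^{( *j)}}{z^{j+1}}$ (the limit exists, $\zeta\in\mathcal{E}^+$, $\mathcal{R}(\zeta)=p_{\max}$). The $C^*$-algebra $\mathcal{C}$ is $\mathcal{C}=\{y\in\mathscr{P}_{1,\pm}: x(1\otimes\overline{y})=(1\otimes\overline{y})x,\ x(y\otimes 1)=(y\otimes 1)x\}$; equivalently $(\overline{y}\otimes 1)\widehat{x}=(1\otimes y)\widehat{x}$ and $\widehat{x}(1\otimes y)=\widehat{x}(\overline{y}\otimes 1)$. $\{a\}''$ denotes the bicommutant (generated von Neumann algebra); $\{\zeta\}''$ is taken in $\mathscr{P}_{1,\pm}$ and $\{p_{\mathcal{D}}\zeta\}''$ is taken in $p_{\mathcal{D}}\mathscr{P}_{1,\pm}p_{\mathcal{D}}$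 (unit $p_{\mathcal{D}}$). For algebras $\mathcal{A}_1,\mathcal{A}_2$, $\mathcal{A}_1\mathcal{A}_2$ is the linear span of products. *)

theory Defs
  imports Complex_Main "Jordan_Normal_Form.Matrix"
begin

section \<open>Shaded planar tangles\<close>

text \<open>
  Every shaded planar tangle is isotopic to one in general position with respect to the height
  function, whose discs are rectangles with their marked side on the left and half of their
  strings on top and half at the bottom.  Such a diagram is cut by horizontal lines into slices
  that contain a single local minimum of a string, a single local maximum, or a single input
  disc; it is written down as the list of its slices, from bottom to top.  The slice \<open>(p, a)\<close>
  has \<open>p\<close> vertical strings to the left of \<open>a\<close> and any number of vertical strings to its right.

  Two such diagrams are planar isotopic iff they are related by exchanging the heights
  of two horizontally disjoint pieces, by straightening a zigzag in a string, and by undoing the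
  rotation of an input disc by 360 degrees; this is the relation \<open>isotopic\<close> below.
\<close>

text \<open>The constructors tell whether the region at the marked (left) side is
  unshaded (the sign \<open>+\<close>) or shaded (the sign \<open>-\<close>).\<close>

datatype shading = Unshaded | Shaded

fun flip :: "shading \<Rightarrow> shading" where
  "flip Unshaded = Shaded"
| "flip Shaded = Unshaded"

text \<open>\<open>Box n l\<close> is an input disc with \<open>n\<close> strings on top and \<open>n\<close> at the bottom; \<open>l\<close> is its name.\<close>

datatype piece = Cup | Cap | Box nat nat

type_synonym slice = "nat \<times> piece"

fun ins :: "piece \<Rightarrow> nat" where
  "ins Cup = 0"
| "ins Cap = 2"
| "ins (Box n l) = n"

fun outs :: "piece \<Rightarrow> nat" where
  "outs Cup = 2"
| "outs Cap = 0"
| "outs (Box n l) = n"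

text \<open>\<open>fits m w k\<close>: stacking the slices \<open>w\<close> on \<open>m\<close> strings is possible and leaves \<open>k\<close> strings.\<close>

fun fits :: "nat \<Rightarrow> slice list \<Rightarrow> nat \<Rightarrow> bool" where
  "fits m [] k \<longleftrightarrow> m = k"
| "fits m ((p, a) # w) k \<longleftrightarrow> p + ins a \<le> m \<and> fits (m - ins a + outs a) w k"

text \<open>\<open>Tangle s n w\<close> has output disc of type \<open>(n, s)\<close>.\<close>

datatype tangle = Tangle (shade: shading) (width: nat) (slices: "slice list")

fun names :: "slice list \<Rightarrow> nat list" where
  "names [] = []"
| "names ((p, Box n l) # w) = l # names w"
| "names ((p, Cup) # w) = names w"
| "names ((p, Cap) # w) = names w"

definition valid :: "tangle \<Rightarrow> bool" where
  "valid T \<longleftrightarrow> fits (width T) (slices T) (width T) \<and> distinct (names (slices T))"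

text \<open>The names of the input discs with their types: the shading changes across each string, so
  the region to the left of a disc with \<open>p\<close> strings on its left is flipped \<open>p\<close> times.\<close>

definition inputs :: "tangle \<Rightarrow> (nat \<times> nat \<times> shading) set" where
  "inputs T = {(l, n, (flip ^^ p) (shade T)) |l n p. (p, Box n l) \<in> set (slices T)}"

inductive move :: "slice list \<Rightarrow> slice list \<Rightarrow> bool" where
  exchange: "move [(p, a), (p + outs a + d, b)] [(p + ins a + d, b), (p, a)]"
| zigzag_right: "move [(p, Cup), (p + 1, Cap)] []"
| zigzag_left: "move [(p + 1, Cup), (p, Cap)] []"
| full_turn:
    "move (map (\<lambda>j. (p + j, Cup)) [0..<2 * n] @ [(p + 2 * n, Box n l)]
             @ map (\<lambda>j. (p + n + j, Cap)) (rev [0..<2 * n]))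
          [(p, Box n l)]"

inductive isotopic :: "tangle \<Rightarrow> tangle \<Rightarrow> bool" where
  local: "\<lbrakk>move w w'; valid (Tangle s n (u @ w @ v)); valid (Tangle s n (u @ w' @ v))\<rbrakk>
            \<Longrightarrow> isotopic (Tangle s n (u @ w @ v)) (Tangle s n (u @ w' @ v))"
| refl: "valid T \<Longrightarrow> isotopic T T"
| sym: "isotopic T T' \<Longrightarrow> isotopic T' T"
| trans: "\<lbrakk>isotopic T T'; isotopic T' T''\<rbrakk> \<Longrightarrow> isotopic T T''"

text \<open>Composition: \<open>compose T l S\<close> glues \<open>S\<close> into the input disc \<open>l\<close> of \<open>T\<close>.\<close>

fun plug :: "nat \<Rightarrow> slice list \<Rightarrow> slice \<Rightarrow> slice list" where
  "plug l w (p, Box n k) = (if k = l then map (\<lambda>(q, a). (p + q, a)) w else [(p, Box n k)])"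
| "plug l w (p, Cup) = [(p, Cup)]"
| "plug l w (p, Cap) = [(p, Cap)]"

definition compose :: "tangle \<Rightarrow> nat \<Rightarrow> tangle \<Rightarrow> tangle" where
  "compose T l S = Tangle (shade T) (width T) (concat (map (plug l (slices S)) (slices T)))"

text \<open>Reflection in a horizontal line.\<close>

fun reflect_piece :: "piece \<Rightarrow> piece" where
  "reflect_piece Cup = Cap"
| "reflect_piece Cap = Cup"
| "reflect_piece (Box n l) = Box n l"

definition reflect :: "tangle \<Rightarrow> tangle" where
  "reflect T = Tangle (shade T) (width T) (map (map_prod id reflect_piece) (rev (slices T)))"


section \<open>Planar algebras\<close>

text \<open>The spaces \<open>boxes PA n s\<close> are subspaces of one ambient vector space, whose only role
  is to give the family a common type (any family embeds into its direct sum); the sums of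
  elements of different box spaces have no meaning.  In \<open>act PA T f\<close>, \<open>f\<close> assigns to each
  input disc, by name, the element put into it.\<close>

record 'a planar_data =
  scl :: "complex \<Rightarrow> 'a \<Rightarrow> 'a"
  boxes :: "nat \<Rightarrow> shading \<Rightarrow> 'a set"
  act :: "tangle \<Rightarrow> (nat \<Rightarrow> 'a) \<Rightarrow> 'a"
  adj :: "nat \<Rightarrow> shading \<Rightarrow> 'a \<Rightarrow> 'a"
  nrm :: "nat \<Rightarrow> shading \<Rightarrow> 'a \<Rightarrow> real"

definition admissible :: "'a planar_data \<Rightarrow> tangle \<Rightarrow> (nat \<Rightarrow> 'a) \<Rightarrow> bool" where
  "admissible PA T f \<longleftrightarrow> (\<forall>(l, n, s) \<in> inputs T. f l \<in> boxes PA n s)"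

definition planar_algebra :: "('a::ab_group_add) planar_data \<Rightarrow> bool" where
  "planar_algebra PA \<longleftrightarrow>
     vector_space (scl PA) \<and>
     (\<forall>n s. module.subspace (scl PA) (boxes PA n s)) \<and>
     (\<forall>T f. valid T \<and> admissible PA T f \<longrightarrow> act PA T f \<in> boxes PA (width T) (shade T)) \<and>
     (\<forall>T f g. valid T \<and> admissible PA T f \<and> (\<forall>(l, n, s) \<in> inputs T. f l = g l)
        \<longrightarrow> act PA T f = act PA T g) \<and>
     \<comment> \<open>multilinearity\<close>
     (\<forall>T f l n s a b. valid T \<and> admissible PA T f \<and> (l, n, s) \<in> inputs T
          \<and> a \<in> boxes PA n s \<and> b \<in> boxes PA n s
        \<longrightarrow> act PA T (f(l := a + b)) = act PA T (f(l := a)) + act PA T (f(l := b))) \<and>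
     (\<forall>T f l n s a c. valid T \<and> admissible PA T f \<and> (l, n, s) \<in> inputs T \<and> a \<in> boxes PA n s
        \<longrightarrow> act PA T (f(l := scl PA c a)) = scl PA c (act PA T (f(l := a)))) \<and>
     \<comment> \<open>isotopy invariance\<close>
     (\<forall>T T' f. isotopic T T' \<and> admissible PA T f \<longrightarrow> act PA T f = act PA T' f) \<and>
     \<comment> \<open>identity tangles and composition of tangles\<close>
     (\<forall>n s l f. f l \<in> boxes PA n s \<longrightarrow> act PA (Tangle s n [(0, Box n l)]) f = f l) \<and>
     (\<forall>T S l f. valid T \<and> valid S \<and> (l, width S, shade S) \<in> inputs T
          \<and> set (names (slices S)) \<inter> (set (names (slices T)) - {l}) = {}
          \<and> admissible PA (compose T l S) f
        \<longrightarrow> act PA (compose T l S) f = act PA T (f(l := act PA S f)))"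

text \<open>Vertical stacking \<open>x y\<close>, with \<open>y\<close> above \<open>x\<close>, and its unit.\<close>

definition mul :: "'a planar_data \<Rightarrow> nat \<Rightarrow> shading \<Rightarrow> 'a \<Rightarrow> 'a \<Rightarrow> 'a" where
  "mul PA n s x y =
     act PA (Tangle s n [(0, Box n 0), (0, Box n 1)]) (\<lambda>l. if l = 0 then x else y)"

definition unit :: "('a::ab_group_add) planar_data \<Rightarrow> nat \<Rightarrow> shading \<Rightarrow> 'a" where
  "unit PA n s = act PA (Tangle s n []) (\<lambda>_. 0)"

text \<open>Each top string is joined to the corresponding bottom string around the right side.\<close>

definition close_up :: "'a planar_data \<Rightarrow> nat \<Rightarrow> shading \<Rightarrow> 'a \<Rightarrow> 'a" where
  "close_up PA n s x =
     act PA (Tangle s 0 (map (\<lambda>j. (j, Cup)) [0..<n] @ [(0, Box n 0)]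
                           @ map (\<lambda>j. (j, Cap)) (rev [0..<n]))) (\<lambda>_. x)"

text \<open>Completeness of the norm is automatic in finite dimension.\<close>

definition fd_cstar_algebra :: "('a::ab_group_add) planar_data \<Rightarrow> nat \<Rightarrow> shading \<Rightarrow> bool" where
  "fd_cstar_algebra PA n s \<longleftrightarrow>
     (let A = boxes PA n s; m = mul PA n s; st = adj PA n s; N = nrm PA n s in
       (\<exists>B. finite B \<and> A = module.span (scl PA) B) \<and>
       unit PA n s \<in> A \<and> (\<forall>a\<in>A. m (unit PA n s) a = a \<and> m a (unit PA n s) = a) \<and>
       (\<forall>a\<in>A. \<forall>b\<in>A. m a b \<in> A) \<and>
       (\<forall>a\<in>A. \<forall>b\<in>A. \<forall>c\<in>A. m (m a b) c = m a (m b c)) \<and>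
       (\<forall>a\<in>A. \<forall>b\<in>A. \<forall>c\<in>A. m (a + b) c = m a c + m b c \<and> m a (b + c) = m a b + m a c) \<and>
       (\<forall>a\<in>A. \<forall>b\<in>A. \<forall>z. m (scl PA z a) b = scl PA z (m a b) \<and> m a (scl PA z b) = scl PA z (m a b)) \<and>
       (\<forall>a\<in>A. st a \<in> A \<and> st (st a) = a) \<and>
       (\<forall>a\<in>A. \<forall>b\<in>A. st (a + b) = st a + st b \<and> st (m a b) = m (st b) (st a)) \<and>
       (\<forall>a\<in>A. \<forall>z. st (scl PA z a) = scl PA (cnj z) (st a)) \<and>
       (\<forall>a\<in>A. 0 \<le> N a \<and> (N a = 0 \<longleftrightarrow> a = 0)) \<and>
       (\<forall>a\<in>A. \<forall>z. N (scl PA z a) = cmod z * N a) \<and>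
       (\<forall>a\<in>A. \<forall>b\<in>A. N (a + b) \<le> N a + N b \<and> N (m a b) \<le> N a * N b) \<and>
       (\<forall>a\<in>A. N (m (st a) a) = (N a)\<^sup>2))"

definition cstar_planar_algebra :: "('a::ab_group_add) planar_data \<Rightarrow> bool" where
  "cstar_planar_algebra PA \<longleftrightarrow>
     planar_algebra PA \<and>
     (\<forall>n s. fd_cstar_algebra PA n s) \<and>
     (\<forall>T f g. valid T \<and> admissible PA T f \<and> (\<forall>(l, n, s) \<in> inputs T. g l = adj PA n s (f l))
        \<longrightarrow> act PA (reflect T) g = adj PA (width T) (shade T) (act PA T f)) \<and>
     (\<exists>tr :: nat \<Rightarrow> shading \<Rightarrow> 'a \<Rightarrow> complex. \<forall>n s.
        (\<forall>a\<in>boxes PA n s. \<forall>b\<in>boxes PA n s. tr n s (a + b) = tr n s a + tr n s b) \<and>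
        (\<forall>a\<in>boxes PA n s. \<forall>z. tr n s (scl PA z a) = z * tr n s a) \<and>
        (\<forall>a\<in>boxes PA n s. \<forall>b\<in>boxes PA n s. tr n s (mul PA n s a b) = tr n s (mul PA n s b a)) \<and>
        (\<forall>a\<in>boxes PA n s. tr n s (mul PA n s (adj PA n s a) a) \<in> \<real>
            \<and> 0 \<le> Re (tr n s (mul PA n s (adj PA n s a) a))) \<and>
        (\<forall>a\<in>boxes PA n s. tr n s (mul PA n s (adj PA n s a) a) = 0 \<longrightarrow> a = 0) \<and>
        (\<forall>a\<in>boxes PA n s. tr n s a = tr 0 s (close_up PA n s a)))"


section \<open>Positivity, projections, spectral radius, convergence\<close>

definition positive :: "'a planar_data \<Rightarrow> nat \<Rightarrow> shading \<Rightarrow> 'a \<Rightarrow> bool" where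
  "positive PA n s a \<longleftrightarrow> (\<exists>b \<in> boxes PA n s. a = mul PA n s (adj PA n s b) b)"

definition below :: "('a::ab_group_add) planar_data \<Rightarrow> nat \<Rightarrow> shading \<Rightarrow> 'a \<Rightarrow> 'a \<Rightarrow> bool" where
  "below PA n s a b \<longleftrightarrow> positive PA n s (b - a)"

definition projections :: "'a planar_data \<Rightarrow> nat \<Rightarrow> shading \<Rightarrow> 'a set" where
  "projections PA n s = {q \<in> boxes PA n s. mul PA n s q q = q \<and> adj PA n s q = q}"

text \<open>\<open>q = \<R>(a)\<close>: the smallest projection with \<open>q a = a\<close>.\<close>

definition is_range_projection ::
    "('a::ab_group_add) planar_data \<Rightarrow> nat \<Rightarrow> shading \<Rightarrow> 'a \<Rightarrow> 'a \<Rightarrow> bool" where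
  "is_range_projection PA n s a q \<longleftrightarrow>
     q \<in> projections PA n s \<and> mul PA n s q a = a \<and>
     (\<forall>q' \<in> projections PA n s. mul PA n s q' a = a \<longrightarrow> below PA n s q q')"

text \<open>The supremum in the lattice of projections of the whole box algebra.\<close>

definition projection_sup ::
    "('a::ab_group_add) planar_data \<Rightarrow> nat \<Rightarrow> shading \<Rightarrow> 'a set \<Rightarrow> 'a" where
  "projection_sup PA n s D =
     (THE p. p \<in> projections PA n s
        \<and> (\<forall>q \<in> projections PA n s \<inter> D. below PA n s q p)
        \<and> (\<forall>p' \<in> projections PA n s.
             (\<forall>q \<in> projections PA n s \<inter> D. below PA n s q p') \<longrightarrow> below PA n s p p'))"

definition spectrum :: "('a::ab_group_add) planar_data \<Rightarrow> nat \<Rightarrow> shading \<Rightarrow> 'a \<Rightarrow> complex set" where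
  "spectrum PA n s a =
     {z. \<not> (\<exists>b \<in> boxes PA n s.
              mul PA n s (a - scl PA z (unit PA n s)) b = unit PA n s \<and>
              mul PA n s b (a - scl PA z (unit PA n s)) = unit PA n s)}"

definition spectral_radius :: "('a::ab_group_add) planar_data \<Rightarrow> nat \<Rightarrow> shading \<Rightarrow> 'a \<Rightarrow> real" where
  "spectral_radius PA n s a = Sup (cmod ` spectrum PA n s a)"

definition series_sum ::
    "('a::ab_group_add) planar_data \<Rightarrow> nat \<Rightarrow> shading \<Rightarrow> (nat \<Rightarrow> 'a) \<Rightarrow> 'a \<Rightarrow> bool" where
  "series_sum PA n s f t \<longleftrightarrow>
     t \<in> boxes PA n s \<and> (\<lambda>N. nrm PA n s ((\<Sum>j<N. f j) - t)) \<longlonglongrightarrow> 0"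


section \<open>Operations on 1-boxes and 2-boxes\<close>

text \<open>In each of these the shading argument is that of the first argument \<open>x\<close>, \<open>y\<close>, \<open>u\<close> or \<open>a\<close>.\<close>

definition fourier :: "'a planar_data \<Rightarrow> shading \<Rightarrow> 'a \<Rightarrow> 'a" where
  "fourier PA s x = act PA (Tangle (flip s) 2 [(0, Cup), (1, Box 2 0), (2, Cap)]) (\<lambda>_. x)"

definition f_positive :: "'a planar_data \<Rightarrow> shading \<Rightarrow> 'a \<Rightarrow> bool" where
  "f_positive PA s x \<longleftrightarrow> positive PA 2 (flip s) (fourier PA s x)"

definition convolve :: "'a planar_data \<Rightarrow> shading \<Rightarrow> 'a \<Rightarrow> 'a \<Rightarrow> 'a" where
  "convolve PA s u v =
     act PA (Tangle s 2 [(1, Cup), (0, Box 2 0), (2, Box 2 1), (1, Cap)])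
       (\<lambda>l. if l = 0 then u else v)"

definition convolve1 :: "'a planar_data \<Rightarrow> shading \<Rightarrow> 'a \<Rightarrow> 'a \<Rightarrow> 'a" where
  "convolve1 PA s y u =
     act PA (Tangle s 1 [(0, Cup), (0, Box 1 0), (1, Box 2 1), (0, Cap)])
       (\<lambda>l. if l = 0 then y else u)"

text \<open>\<open>conv_power PA s u j\<close> is the convolution product of \<open>j + 1\<close> copies of \<open>u\<close>.\<close>

primrec conv_power :: "'a planar_data \<Rightarrow> shading \<Rightarrow> 'a \<Rightarrow> nat \<Rightarrow> 'a" where
  "conv_power PA s u 0 = u"
| "conv_power PA s u (Suc j) = convolve PA s (conv_power PA s u j) u"

text \<open>\<open>y * u^(*j)\<close>\<close>

fun convolve1_power :: "'a planar_data \<Rightarrow> shading \<Rightarrow> 'a \<Rightarrow> 'a \<Rightarrow> nat \<Rightarrow> 'a" where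
  "convolve1_power PA s y u 0 = y"
| "convolve1_power PA s y u (Suc j) = convolve1 PA s y (conv_power PA (flip s) u j)"

text \<open>The rotation by 180 degrees of a 1-box.\<close>

definition turn :: "'a planar_data \<Rightarrow> shading \<Rightarrow> 'a \<Rightarrow> 'a" where
  "turn PA s y = act PA (Tangle (flip s) 1 [(0, Cup), (1, Box 1 0), (1, Cap)]) (\<lambda>_. y)"

definition juxtapose :: "'a planar_data \<Rightarrow> shading \<Rightarrow> 'a \<Rightarrow> 'a \<Rightarrow> 'a" where
  "juxtapose PA s a b =
     act PA (Tangle s 2 [(0, Box 1 0), (1, Box 1 1)]) (\<lambda>l. if l = 0 then a else b)"


section \<open>Perron--Frobenius data of a 2-box\<close>

definition PF_space :: "'a planar_data \<Rightarrow> shading \<Rightarrow> 'a \<Rightarrow> real \<Rightarrow> 'a set" where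
  "PF_space PA s x r =
     {y \<in> boxes PA 1 s. convolve1 PA s y (fourier PA s x) = scl PA (complex_of_real r) y}"

definition PF_supports :: "('a::ab_group_add) planar_data \<Rightarrow> shading \<Rightarrow> 'a \<Rightarrow> real \<Rightarrow> 'a set" where
  "PF_supports PA s x r =
     {q. \<exists>y \<in> PF_space PA s x r. positive PA 1 s y \<and> is_range_projection PA 1 s y q}"

definition is_max_support ::
    "('a::ab_group_add) planar_data \<Rightarrow> shading \<Rightarrow> 'a \<Rightarrow> real \<Rightarrow> 'a \<Rightarrow> bool" where
  "is_max_support PA s x r p \<longleftrightarrow>
     p \<in> PF_supports PA s x r \<and> (\<forall>q \<in> PF_supports PA s x r. below PA 1 s q p)"

text \<open>\<open>\<zeta>\<close> is the limit, as the real number \<open>z\<close> decreases to \<open>r\<close>, of \<open>(z - r) S z\<close> with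
  \<open>S z = (\<Sum>j. (p * x^^(*j)) / z^(j+1))\<close>, \<open>x^\<close> being the Fourier transform of \<open>x\<close>.\<close>

definition is_PF_eigenvector ::
    "('a::ab_group_add) planar_data \<Rightarrow> shading \<Rightarrow> 'a \<Rightarrow> real \<Rightarrow> 'a \<Rightarrow> 'a \<Rightarrow> bool" where
  "is_PF_eigenvector PA s x r p \<zeta> \<longleftrightarrow>
     \<zeta> \<in> boxes PA 1 s \<and>
     (\<exists>S :: real \<Rightarrow> 'a.
        (\<forall>z>r. series_sum PA 1 s
           (\<lambda>j. scl PA (complex_of_real (1 / z ^ (j + 1)))
                  (convolve1_power PA s p (fourier PA s x) j)) (S z)) \<and>
        ((\<lambda>z. nrm PA 1 s (scl PA (complex_of_real (z - r)) (S z) - \<zeta>)) \<longlongrightarrow> 0) (at_right r))"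

definition C_algebra :: "('a::ab_group_add) planar_data \<Rightarrow> shading \<Rightarrow> 'a \<Rightarrow> 'a set" where
  "C_algebra PA s x =
     {y \<in> boxes PA 1 s.
        mul PA 2 s x (juxtapose PA s (unit PA 1 s) (turn PA s y)) =
          mul PA 2 s (juxtapose PA s (unit PA 1 s) (turn PA s y)) x \<and>
        mul PA 2 s x (juxtapose PA s y (unit PA 1 (flip s))) =
          mul PA 2 s (juxtapose PA s y (unit PA 1 (flip s))) x}"


section \<open>Star algebras, isomorphism, matrix algebras and tensor products\<close>

record 'b star_algebra =
  sa_carrier :: "'b set"
  sa_add :: "'b \<Rightarrow> 'b \<Rightarrow> 'b"
  sa_scale :: "complex \<Rightarrow> 'b \<Rightarrow> 'b"
  sa_mult :: "'b \<Rightarrow> 'b \<Rightarrow> 'b"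
  sa_star :: "'b \<Rightarrow> 'b"

definition star_isomorphic :: "'b star_algebra \<Rightarrow> 'c star_algebra \<Rightarrow> bool" where
  "star_isomorphic A B \<longleftrightarrow>
     (\<exists>h. bij_betw h (sa_carrier A) (sa_carrier B) \<and>
        (\<forall>a\<in>sa_carrier A. \<forall>b\<in>sa_carrier A.
            h (sa_add A a b) = sa_add B (h a) (h b) \<and> h (sa_mult A a b) = sa_mult B (h a) (h b)) \<and>
        (\<forall>a\<in>sa_carrier A. \<forall>z. h (sa_scale A z a) = sa_scale B z (h a)) \<and>
        (\<forall>a\<in>sa_carrier A. h (sa_star A a) = sa_star B (h a)))"

definition matrix_star_algebra :: "nat \<Rightarrow> complex mat star_algebra" where
  "matrix_star_algebra n =
     \<lparr>sa_carrier = carrier_mat n n, sa_add = (+), sa_scale = (\<cdot>\<^sub>m), sa_mult = (*),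
      sa_star = (\<lambda>M. map_mat cnj (transpose_mat M))\<rparr>"

text \<open>The subset \<open>D\<close> of the 1-boxes as a star algebra under the inherited operations.\<close>

definition box_subalgebra :: "('a::ab_group_add) planar_data \<Rightarrow> shading \<Rightarrow> 'a set \<Rightarrow> 'a star_algebra" where
  "box_subalgebra PA s D =
     \<lparr>sa_carrier = D, sa_add = (+), sa_scale = scl PA, sa_mult = mul PA 1 s, sa_star = adj PA 1 s\<rparr>"

text \<open>The algebraic tensor product: a list of pairs \<open>(a, b)\<close> stands for the formal sum of the
  \<open>a \<otimes> b\<close>, and formal sums are identified by the congruence generated by the bilinearity of
  \<open>\<otimes>\<close>.  For finite-dimensional algebras no completion is needed.\<close>

inductive tensor_eq :: "'b star_algebra \<Rightarrow> 'c star_algebra \<Rightarrow> ('b \<times> 'c) list \<Rightarrow> ('b \<times> 'c) list \<Rightarrow> bool"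
  for A :: "'b star_algebra" and B :: "'c star_algebra" where
  refl: "t \<in> lists (sa_carrier A \<times> sa_carrier B) \<Longrightarrow> tensor_eq A B t t"
| sym: "tensor_eq A B t t' \<Longrightarrow> tensor_eq A B t' t"
| trans: "\<lbrakk>tensor_eq A B t t'; tensor_eq A B t' t''\<rbrakk> \<Longrightarrow> tensor_eq A B t t''"
| cong: "\<lbrakk>tensor_eq A B t t'; tensor_eq A B u u'\<rbrakk> \<Longrightarrow> tensor_eq A B (t @ u) (t' @ u')"
| comm: "\<lbrakk>t \<in> lists (sa_carrier A \<times> sa_carrier B); u \<in> lists (sa_carrier A \<times> sa_carrier B)\<rbrakk>
           \<Longrightarrow> tensor_eq A B (t @ u) (u @ t)"
| add_left: "\<lbrakk>a \<in> sa_carrier A; a' \<in> sa_carrier A; b \<in> sa_carrier B\<rbrakk>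
           \<Longrightarrow> tensor_eq A B [(sa_add A a a', b)] [(a, b), (a', b)]"
| add_right: "\<lbrakk>a \<in> sa_carrier A; b \<in> sa_carrier B; b' \<in> sa_carrier B\<rbrakk>
           \<Longrightarrow> tensor_eq A B [(a, sa_add B b b')] [(a, b), (a, b')]"
| scale: "\<lbrakk>a \<in> sa_carrier A; b \<in> sa_carrier B\<rbrakk>
           \<Longrightarrow> tensor_eq A B [(sa_scale A z a, b)] [(a, sa_scale B z b)]"
| zero: "\<lbrakk>a \<in> sa_carrier A; b \<in> sa_carrier B\<rbrakk> \<Longrightarrow> tensor_eq A B [(sa_scale A 0 a, b)] []"

definition tensor_class ::
    "'b star_algebra \<Rightarrow> 'c star_algebra \<Rightarrow> ('b \<times> 'c) list \<Rightarrow> ('b \<times> 'c) list set" where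
  "tensor_class A B t = {u. tensor_eq A B t u}"

definition tensor_product ::
    "'b star_algebra \<Rightarrow> 'c star_algebra \<Rightarrow> ('b \<times> 'c) list set star_algebra" where
  "tensor_product A B =
     \<lparr>sa_carrier = tensor_class A B ` lists (sa_carrier A \<times> sa_carrier B),
      sa_add = (\<lambda>X Y. \<Union>t\<in>X. \<Union>u\<in>Y. tensor_class A B (t @ u)),
      sa_scale = (\<lambda>z X. \<Union>t\<in>X. tensor_class A B (map (\<lambda>(a, b). (sa_scale A z a, b)) t)),
      sa_mult = (\<lambda>X Y. \<Union>t\<in>X. \<Union>u\<in>Y. tensor_class A B
         (concat (map (\<lambda>(a, b). map (\<lambda>(a', b'). (sa_mult A a a', sa_mult B b b')) u) t))),
      sa_star = (\<lambda>X. \<Union>t\<in>X. tensor_class A B (map (\<lambda>(a, b). (sa_star A a, sa_star B b)) t))\<rparr>"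


section \<open>Direct summands, generated von Neumann algebras, products of algebras\<close>

definition star_ideal :: "('a::ab_group_add) planar_data \<Rightarrow> shading \<Rightarrow> 'a set \<Rightarrow> 'a set \<Rightarrow> bool" where
  "star_ideal PA s C D \<longleftrightarrow>
     module.subspace (scl PA) D \<and> D \<subseteq> C \<and>
     (\<forall>d\<in>D. adj PA 1 s d \<in> D) \<and>
     (\<forall>c\<in>C. \<forall>d\<in>D. mul PA 1 s c d \<in> D \<and> mul PA 1 s d c \<in> D)"

definition direct_summand :: "('a::ab_group_add) planar_data \<Rightarrow> shading \<Rightarrow> 'a set \<Rightarrow> 'a set \<Rightarrow> bool" where
  "direct_summand PA s C D \<longleftrightarrow>
     (\<exists>D'. star_ideal PA s C D \<and> star_ideal PA s C D' \<and> D \<inter> D' = {0} \<and>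
           C = {d + d' |d d'. d \<in> D \<and> d' \<in> D'})"

text \<open>The corner \<open>p A p\<close> of the algebra of 1-boxes.\<close>

definition corner :: "'a planar_data \<Rightarrow> shading \<Rightarrow> 'a \<Rightarrow> 'a set" where
  "corner PA s p = {mul PA 1 s p (mul PA 1 s a p) |a. a \<in> boxes PA 1 s}"

definition commutant_in :: "'a planar_data \<Rightarrow> shading \<Rightarrow> 'a set \<Rightarrow> 'a set \<Rightarrow> 'a set" where
  "commutant_in PA s A X = {b \<in> A. \<forall>a\<in>X. mul PA 1 s a b = mul PA 1 s b a}"

text \<open>\<open>{a}''\<close> for self-adjoint \<open>a\<close>, as the double commutant relative to \<open>A\<close> and as the von
  Neumann subalgebra of \<open>A\<close>, with the unit of \<open>A\<close>, generated by \<open>a\<close>.  The former also contains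
  the centre of \<open>A\<close>, so the two differ in general when \<open>A\<close> is not a factor.\<close>

definition bicommutant_in :: "'a planar_data \<Rightarrow> shading \<Rightarrow> 'a set \<Rightarrow> 'a \<Rightarrow> 'a set" where
  "bicommutant_in PA s A a = commutant_in PA s A (commutant_in PA s A {a})"

definition generated_vN :: "('a::ab_group_add) planar_data \<Rightarrow> shading \<Rightarrow> 'a set \<Rightarrow> 'a \<Rightarrow> 'a set" where
  "generated_vN PA s A a =
     \<Inter>{B. B \<subseteq> A \<and> module.subspace (scl PA) B \<and>
          (\<forall>b\<in>B. \<forall>c\<in>B. mul PA 1 s b c \<in> B) \<and> (\<forall>b\<in>B. adj PA 1 s b \<in> B) \<and>
          (\<exists>u\<in>B. \<forall>c\<in>A. mul PA 1 s u c = c \<and> mul PA 1 s c u = c) \<and> a \<in> B}"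

text \<open>The linear span of the products.\<close>

definition algebra_product ::
    "('a::ab_group_add) planar_data \<Rightarrow> shading \<Rightarrow> 'a set \<Rightarrow> 'a set \<Rightarrow> 'a set" where
  "algebra_product PA s A B = module.span (scl PA) {mul PA 1 s a b |a b. a \<in> A \<and> b \<in> B}"

end

theory Submission
  imports Defs
begin

text \<open>
  Write \<open>\<phi> y = y * x^\<close>.  Bending the top right string of \<open>x\<close> down turns \<open>\<phi> y\<close> into a picture
  of \<open>(y \<otimes> 1) x\<close>, in which an element \<open>c\<close> of \<open>\<C>\<close> can be multiplied to \<open>\<phi> y\<close> from either side,
  moved through \<open>x\<close> and absorbed by \<open>y\<close>; for left multiplication it travels around
  a minimum and a maximum, as \<open>c\<close> rotated by 180 degrees.  So \<open>\<phi>\<close> is a \<open>\<C>\<close>-bimodule map,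
  and \<open>c\<^sup>* y c\<close> is a positive eigenvector whenever \<open>y\<close> is one.  Maximality of \<open>p_max\<close> then gives
  \<open>p_max c = p_max c p_max\<close> for \<open>c\<close> and \<open>c\<^sup>*\<close>, hence commutation, and this passes to \<open>\<zeta>\<close> through the
  resolvent series.  For a summand \<open>D\<close> with unit \<open>p\<close> the algebra \<open>{p \<zeta>}''\<close> is \<open>p {\<zeta>}''\<close> and
  commutes with \<open>D\<close>; the matrix units of \<open>D\<close> recover the coefficients of a sum of products
  \<open>a d\<close>, so multiplication is injective on the tensor product.
\<close>

section \<open>Finite-dimensional C*-algebras with a faithful trace\<close>

text \<open>Spectral theory is replaced by the inner product \<open>tr (star a \<odot> b)\<close>:
  the orthogonal projection of the unit onto a right ideal is a projection, which yields range
  projections, and onto a star-closed ideal it yields the unit of the ideal. The norm serves the two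
  limits that define \<open>\<zeta>\<close>; finite-dimensional subspaces are closed and linear maps
  are bounded, so relations between the iterates of \<open>p_max\<close> survive. Commutation from
  corners needs the adjoint of \<open>c\<close> as well. It is taken not in the algebra itself but
  in the set of all elements over which \<open>\<phi>\<close> is a bimodule map; this set is
  star-closed because x^ is self-adjoint and so \<open>\<phi>\<close> commutes with
  \<open>star\<close>. Two readings of the generated von Neumann algebra are treated together. For
  the generated algebra the passage to a corner is formal; for the relative bicommutant an element
  of the corner must be extended to \<open>A\<close>, which is done inside the ideal that
  \<open>p\<close> generates in the commutant of \<open>\<zeta>\<close>. Tensors are congruence
  classes of lists, so injectivity of multiplication is proved through a normal form whose
  coefficients depend only on the value of the list.\<close>

locale tracial_cstar_algebra = vector_space scale
  for scale :: "complex \<Rightarrow> 'a::ab_group_add \<Rightarrow> 'a" (infixr "*s" 75) +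
  fixes A :: "'a set"
    and mult :: "'a \<Rightarrow> 'a \<Rightarrow> 'a" (infixl "\<odot>" 70)
    and star :: "'a \<Rightarrow> 'a"
    and e :: 'a
    and tr :: "'a \<Rightarrow> complex"
    and N :: "'a \<Rightarrow> real"
  assumes subspace_carrier: "subspace A"
    and finite_dimensional: "\<exists>B. finite B \<and> A = span B"
    and one_closed [simp]: "e \<in> A"
    and one_left [simp]: "a \<in> A \<Longrightarrow> e \<odot> a = a"
    and one_right [simp]: "a \<in> A \<Longrightarrow> a \<odot> e = a"
    and mult_closed [simp]: "a \<in> A \<Longrightarrow> b \<in> A \<Longrightarrow> a \<odot> b \<in> A"
    and mult_assoc: "a \<in> A \<Longrightarrow> b \<in> A \<Longrightarrow> c \<in> A \<Longrightarrow> (a \<odot> b) \<odot> c = a \<odot> (b \<odot> c)"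
    and mult_add_left: "a \<in> A \<Longrightarrow> b \<in> A \<Longrightarrow> c \<in> A \<Longrightarrow> (a + b) \<odot> c = a \<odot> c + b \<odot> c"
    and mult_add_right: "a \<in> A \<Longrightarrow> b \<in> A \<Longrightarrow> c \<in> A \<Longrightarrow> a \<odot> (b + c) = a \<odot> b + a \<odot> c"
    and mult_scale_left [simp]: "a \<in> A \<Longrightarrow> b \<in> A \<Longrightarrow> (z *s a) \<odot> b = z *s (a \<odot> b)"
    and mult_scale_right [simp]: "a \<in> A \<Longrightarrow> b \<in> A \<Longrightarrow> a \<odot> (z *s b) = z *s (a \<odot> b)"
    and star_closed [simp]: "a \<in> A \<Longrightarrow> star a \<in> A"
    and star_star [simp]: "a \<in> A \<Longrightarrow> star (star a) = a"
    and star_add: "a \<in> A \<Longrightarrow> b \<in> A \<Longrightarrow> star (a + b) = star a + star b"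
    and star_mult: "a \<in> A \<Longrightarrow> b \<in> A \<Longrightarrow> star (a \<odot> b) = star b \<odot> star a"
    and star_scale: "a \<in> A \<Longrightarrow> star (z *s a) = cnj z *s star a"
    and tr_add: "a \<in> A \<Longrightarrow> b \<in> A \<Longrightarrow> tr (a + b) = tr a + tr b"
    and tr_scale: "a \<in> A \<Longrightarrow> tr (z *s a) = z * tr a"
    and tr_nonneg: "a \<in> A \<Longrightarrow> 0 \<le> Re (tr (star a \<odot> a))"
    and tr_real: "a \<in> A \<Longrightarrow> tr (star a \<odot> a) \<in> \<real>"
    and tr_faithful: "a \<in> A \<Longrightarrow> tr (star a \<odot> a) = 0 \<Longrightarrow> a = 0"
    and norm_nonneg: "a \<in> A \<Longrightarrow> 0 \<le> N a"
    and norm_eq_0_iff: "a \<in> A \<Longrightarrow> N a = 0 \<longleftrightarrow> a = 0"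
    and norm_scale: "a \<in> A \<Longrightarrow> N (z *s a) = cmod z * N a"
    and norm_triangle: "a \<in> A \<Longrightarrow> b \<in> A \<Longrightarrow> N (a + b) \<le> N a + N b"
    and norm_mult: "a \<in> A \<Longrightarrow> b \<in> A \<Longrightarrow> N (a \<odot> b) \<le> N a * N b"
    and norm_star_mult: "a \<in> A \<Longrightarrow> N (star a \<odot> a) = (N a)\<^sup>2"
begin

lemma zero_closed [simp]: "0 \<in> A"
  and add_closed [simp]: "a \<in> A \<Longrightarrow> b \<in> A \<Longrightarrow> a + b \<in> A"
  and scale_closed [simp]: "a \<in> A \<Longrightarrow> z *s a \<in> A"
  and minus_closed [simp]: "a \<in> A \<Longrightarrow> - a \<in> A"
  and diff_closed [simp]: "a \<in> A \<Longrightarrow> b \<in> A \<Longrightarrow> a - b \<in> A"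
  and sum_closed: "(\<And>i. i \<in> I \<Longrightarrow> f i \<in> A) \<Longrightarrow> sum f I \<in> A"
  using subspace_carrier
  by (auto intro: subspace_0 subspace_add subspace_scale subspace_neg subspace_diff subspace_sum)

lemma mult_zero [simp]: "a \<in> A \<Longrightarrow> 0 \<odot> a = 0" "a \<in> A \<Longrightarrow> a \<odot> 0 = 0"
  using mult_scale_left[of 0 a 0] mult_scale_right[of a 0 0] by auto

lemma mult_minus [simp]: "a \<in> A \<Longrightarrow> b \<in> A \<Longrightarrow> (- a) \<odot> b = - (a \<odot> b)"
    "a \<in> A \<Longrightarrow> b \<in> A \<Longrightarrow> a \<odot> (- b) = - (a \<odot> b)"
  using mult_scale_left[of a b "-1"] mult_scale_right[of a b "-1"] by auto

lemma mult_diff: "a \<in> A \<Longrightarrow> b \<in> A \<Longrightarrow> c \<in> A \<Longrightarrow> (a - b) \<odot> c = a \<odot> c - b \<odot> c"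
    "a \<in> A \<Longrightarrow> b \<in> A \<Longrightarrow> c \<in> A \<Longrightarrow> a \<odot> (b - c) = a \<odot> b - a \<odot> c"
  using mult_add_left[of a "- b" c] mult_add_right[of a b "- c"] by auto

lemma star_zero [simp]: "star 0 = 0"
  using star_scale[of 0 0] by simp

lemma star_minus [simp]: "a \<in> A \<Longrightarrow> star (- a) = - star a"
  using star_scale[of a "-1"] by simp

lemma star_diff: "a \<in> A \<Longrightarrow> b \<in> A \<Longrightarrow> star (a - b) = star a - star b"
  using star_add[of a "- b"] by simp

lemma star_one [simp]: "star e = e"
  using star_mult[of "star e" e] by simp

lemma mult_sum_left: "finite I \<Longrightarrow> (\<And>i. i \<in> I \<Longrightarrow> f i \<in> A) \<Longrightarrow> c \<in> A \<Longrightarrow> sum f I \<odot> c = (\<Sum>i\<in>I. f i \<odot> c)"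
  by (induction I rule: finite_induct) (auto simp: mult_add_left sum_closed)

lemma mult_sum_right: "finite I \<Longrightarrow> (\<And>i. i \<in> I \<Longrightarrow> f i \<in> A) \<Longrightarrow> c \<in> A \<Longrightarrow> c \<odot> sum f I = (\<Sum>i\<in>I. c \<odot> f i)"
  by (induction I rule: finite_induct) (auto simp: mult_add_right sum_closed)

lemma star_mult_eq_0: "a \<in> A \<Longrightarrow> star a \<odot> a = 0 \<Longrightarrow> a = 0"
  using norm_star_mult[of a] norm_eq_0_iff[of a] norm_eq_0_iff[of 0] by auto

text \<open>The C*-identity and submultiplicativity give
  \<open>N b * N b \<le> N (star b) * N b\<close>; cancelling \<open>N b\<close> and exchanging
  \<open>b\<close> with \<open>star b\<close> gives both inequalities.\<close>

lemma norm_star: assumes "a \<in> A" shows "N (star a) = N a"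
proof -
  have le: "N b \<le> N (star b)" if "b \<in> A" for b
  proof (cases "N b = 0")
    case False
    have "N b * N b \<le> N (star b) * N b"
      using norm_star_mult[of b] norm_mult[of "star b" b] that by (simp add: power2_eq_square)
    then show ?thesis using False norm_nonneg[of b] that by simp
  qed (use norm_nonneg[of "star b"] that in simp)
  show ?thesis using le[of a] le[of "star a"] assms by simp
qed

section \<open>Orthogonal projection, unit projections and the order of projections\<close>

lemma orthogonal_projection:
  assumes "finite B" "span B \<subseteq> A" "v \<in> A"
  shows "\<exists>w \<in> span B. \<forall>k \<in> span B. tr (star (v - w) \<odot> k) = 0"
  using assms
proof (induction B arbitrary: v rule: finite_induct)
  case empty
  then show ?case using tr_scale[of 0 0] by simp
next
  case (insert b B)
  have sub: "span B \<subseteq> A" and bA: "b \<in> A"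
    using insert.prems span_mono[of B "insert b B"] span_base[of b "insert b B"] by auto
  obtain q where q: "q \<in> span B" "\<forall>k \<in> span B. tr (star (b - q) \<odot> k) = 0"
    using insert.IH[OF sub bA] by auto
  obtain w where w: "w \<in> span B" "\<forall>k \<in> span B. tr (star (v - w) \<odot> k) = 0"
    using insert.IH[OF sub \<open>v \<in> A\<close>] by auto
  have A: "q \<in> A" "w \<in> A" "v \<in> A" using q w sub insert.prems by auto
  define b' where "b' = b - q"
  \<comment> \<open>\<open>b'\<close> is the part of \<open>b\<close> orthogonal to
    \<open>span B\<close>, and this is its Gram-Schmidt coefficient, conjugated because the form is
    conjugate linear in its first argument. If \<open>b' = 0\<close>, division by zero makes
    \<open>z\<close> vanish, and the new orthogonality relation is trivial.\<close>
  define z where "z = cnj (tr (star (v - w) \<odot> b') / tr (star b' \<odot> b'))"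
  have b'A: "b' \<in> A" using A bA by (simp add: b'_def)
  have dec: "tr (star (v - (w + z *s b')) \<odot> k) = tr (star (v - w) \<odot> k) - cnj z * tr (star b' \<odot> k)"
    if "k \<in> A" for k
  proof -
    have "star (v - (w + z *s b')) \<odot> k = star (v - w) \<odot> k + (- cnj z) *s (star b' \<odot> k)"
      using A b'A that by (simp add: star_diff star_add star_scale mult_diff mult_add_left diff_diff_eq)
    then show ?thesis using A b'A that
      by (simp only: tr_add tr_scale mult_closed star_closed diff_closed scale_closed) simp
  qed
  have 1: "tr (star (v - (w + z *s b')) \<odot> k) = 0" if "k \<in> span B" for k
    using dec[of k] w(2) q(2) that sub by (auto simp: b'_def)
  have 2: "tr (star (v - (w + z *s b')) \<odot> b') = 0"
  proof (cases "b' = 0")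
    case True
    then show ?thesis using dec[of 0] A tr_scale[of 0 0] by simp
  next
    case False
    then show ?thesis using dec[OF b'A] tr_faithful[OF b'A] by (auto simp: z_def)
  qed
  show ?case
  proof (rule bexI, rule ballI)
    have "b' \<in> span (insert b B)"
      unfolding b'_def using q span_mono[of B "insert b B"] span_base[of b "insert b B"]
      by (intro span_diff) auto
    then show "w + z *s b' \<in> span (insert b B)"
      using w span_mono[of B "insert b B"] by (intro span_add span_scale) auto
  next
    fix k assume "k \<in> span (insert b B)"
    then obtain c where c: "k - c *s b \<in> span B" by (auto simp: span_insert)
    have kd: "k = (k - c *s b + c *s q) + c *s b'" by (simp add: b'_def scale_right_diff_distrib)
    have k0: "k - c *s b + c *s q \<in> span B" using c q by (intro span_add span_scale) auto
    let ?g = "star (v - (w + z *s b'))"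
    have "?g \<odot> k = ?g \<odot> (k - c *s b + c *s q) + c *s (?g \<odot> b')"
      using k0 sub A b'A by (subst kd) (simp add: mult_add_right subsetD)
    moreover have "?g \<odot> (k - c *s b + c *s q) \<in> A" "?g \<odot> b' \<in> A"
      using k0 sub A b'A by (auto simp: subsetD)
    ultimately show "tr (?g \<odot> k) = 0"
      using 1[OF k0] 2 by (simp add: tr_add tr_scale)
  qed
qed

lemma subspace_finite_span:
  assumes "subspace J" "J \<subseteq> A" obtains B where "finite B" "J = span B"
proof -
  obtain C where C: "finite C" "A = span C" using finite_dimensional by auto
  obtain B where B: "B \<subseteq> J" "independent B" "J \<subseteq> span B"
    using maximal_independent_subset by blast
  have "finite B" using independent_span_bound[OF C(1) B(2)] B(1) C(2) assms(2) by auto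
  moreover have "J = span B" using B(1,3) assms(1) span_minimal[OF B(1) assms(1)] by auto
  ultimately show ?thesis using that by blast
qed

definition is_proj :: "'a \<Rightarrow> bool" where
  "is_proj q \<longleftrightarrow> q \<in> A \<and> q \<odot> q = q \<and> star q = q"

lemma is_projD: "is_proj q \<Longrightarrow> q \<in> A" "is_proj q \<Longrightarrow> q \<odot> q = q" "is_proj q \<Longrightarrow> star q = q"
  by (auto simp: is_proj_def)

lemma is_proj_complement: "is_proj q \<Longrightarrow> is_proj (e - q)"
  by (auto simp: is_proj_def mult_diff star_diff)

text \<open>The hypotheses hold for right ideals as well as for star subalgebras without unit.\<close>

lemma unit_projection:
  assumes J: "subspace J" "J \<subseteq> A"
    and "\<And>k. k \<in> J \<Longrightarrow> k \<odot> star k \<in> J" "\<And>k j. k \<in> J \<Longrightarrow> j \<in> J \<Longrightarrow> k \<odot> (star k \<odot> j) \<in> J"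
  shows "\<exists>z. z \<in> J \<and> is_proj z \<and> (\<forall>k\<in>J. z \<odot> k = k)"
proof -
  obtain B where B: "finite B" "J = span B" using subspace_finite_span J by metis
  \<comment> \<open>\<open>z\<close> is the orthogonal projection of the unit onto \<open>J\<close>,
    the natural candidate for a left unit.\<close>
  obtain z where z: "z \<in> J" "\<forall>k\<in>J. tr (star (e - z) \<odot> k) = 0"
    using orthogonal_projection[of B e] B J(2) by auto
  have zA: "z \<in> A" using z J by auto
  have unit: "star z \<odot> k = k" if k: "k \<in> J" for k
  proof -
    have kA: "k \<in> A" using k J by auto
    let ?g = "star (e - z) \<odot> k"
    \<comment> \<open>The test element \<open>k \<odot> star k \<odot> (e - z)\<close> lies in
      \<open>J\<close>. Orthogonality of \<open>e - z\<close> to it says that \<open>star ?g\<close>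
      has length zero for the trace form, so \<open>?g = 0\<close>.\<close>
    have "k \<odot> star k - k \<odot> (star k \<odot> z) \<in> J"
      using assms(3,4) k z(1) J(1) by (intro subspace_diff)
    moreover have "k \<odot> star k - k \<odot> (star k \<odot> z) = k \<odot> star ?g"
      using kA zA by (simp add: star_mult mult_diff)
    ultimately have "tr (star (e - z) \<odot> (k \<odot> star ?g)) = 0" using z(2) by simp
    then have "tr (star (star ?g) \<odot> star ?g) = 0" using kA zA by (simp add: mult_assoc)
    then have "star ?g = 0" using tr_faithful[of "star ?g"] kA zA by simp
    then have "?g = 0" using kA zA star_star[of ?g] by simp
    then show ?thesis using kA zA by (simp add: star_diff mult_diff)
  qed
  \<comment> \<open>Applied to \<open>z\<close> itself, the unit law exhibits \<open>z\<close> as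
    self-adjoint, so the left unit \<open>star z\<close> is \<open>z\<close>.\<close>
  have "star z \<odot> z = z" using unit z by auto
  then have "star z = z" using star_mult[of "star z" z] zA by simp
  then show ?thesis using unit z zA by (intro exI[of _ z]) (auto simp: is_proj_def)
qed

text \<open>The projection is the left unit of the right ideal \<open>a \<odot> A\<close>. The
  factor \<open>b\<close> is recorded because \<open>q = a \<odot> b\<close> lets any relation
  \<open>c \<odot> a = 0\<close> pass to \<open>c \<odot> q = 0\<close>.\<close>

lemma range_projection:
  assumes a: "a \<in> A"
  obtains q b where "is_proj q" "b \<in> A" "q = a \<odot> b" "q \<odot> a = a"
proof -
  let ?J = "(\<lambda>b. a \<odot> b) ` A"
  have "subspace ?J"
  proof (rule subspaceI)
    show "0 \<in> ?J" using a by (auto intro!: image_eqI[of _ _ 0])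
    show "x + y \<in> ?J" if "x \<in> ?J" "y \<in> ?J" for x y
      using that a by (auto simp: mult_add_right[symmetric])
    show "c *s x \<in> ?J" if "x \<in> ?J" for c x
      using that a by (auto simp: mult_scale_right[symmetric] simp del: mult_scale_right)
  qed
  then obtain z where "z \<in> ?J" "is_proj z" "\<forall>k\<in>?J. z \<odot> k = k"
    using unit_projection[of ?J] a by (fastforce simp: mult_assoc)
  moreover have "a \<in> ?J" using a by (auto intro!: image_eqI[of _ _ e])
  ultimately show ?thesis using that by blast
qed

definition pos :: "'a \<Rightarrow> bool" where
  "pos a \<longleftrightarrow> (\<exists>b\<in>A. a = star b \<odot> b)"

lemma pos_selfadjoint: "pos a \<Longrightarrow> a \<in> A \<and> star a = a"
  by (auto simp: pos_def star_mult)

text \<open>Compressing \<open>p - q = star b \<odot> b\<close> by \<open>e - p\<close> gives minus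
  the square of \<open>q \<odot> (e - p)\<close>. One side has nonnegative trace and the other
  nonpositive trace, so faithfulness forces \<open>q \<odot> (e - p) = 0\<close>. Conversely,
  \<open>p - q\<close> is then itself a projection.\<close>

lemma proj_le_iff:
  assumes p: "is_proj p" and q: "is_proj q"
  shows "pos (p - q) \<longleftrightarrow> q \<odot> p = q"
proof
  note [simp] = is_projD[OF p] is_projD[OF q]
  assume "pos (p - q)"
  then obtain b where b: "b \<in> A" "p - q = star b \<odot> b" by (auto simp: pos_def)
  let ?d = "e - p"
  have dA: "?d \<in> A" and ds: "star ?d = ?d" by (auto simp: star_diff)
  have "star (b \<odot> ?d) \<odot> (b \<odot> ?d) = ?d \<odot> ((p - q) \<odot> ?d)"
    using b(1) dA ds by (simp add: b(2) star_mult mult_assoc)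
  also have "\<dots> = - (?d \<odot> (q \<odot> ?d))"
    by (simp add: mult_diff)
  also have "?d \<odot> (q \<odot> ?d) = star (q \<odot> ?d) \<odot> (q \<odot> ?d)"
    using dA ds by (simp add: star_mult mult_assoc) (simp add: mult_assoc[symmetric])
  finally have "star (b \<odot> ?d) \<odot> (b \<odot> ?d) = (-1) *s (star (q \<odot> ?d) \<odot> (q \<odot> ?d))" by simp
  then have "tr (star (b \<odot> ?d) \<odot> (b \<odot> ?d)) = - tr (star (q \<odot> ?d) \<odot> (q \<odot> ?d))"
    using tr_scale[of "star (q \<odot> ?d) \<odot> (q \<odot> ?d)" "-1"] dA by simp
  moreover have "0 \<le> Re (tr (star (b \<odot> ?d) \<odot> (b \<odot> ?d)))" "0 \<le> Re (tr (star (q \<odot> ?d) \<odot> (q \<odot> ?d)))"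
    "tr (star (q \<odot> ?d) \<odot> (q \<odot> ?d)) \<in> \<real>"
    using b(1) dA by (auto intro!: tr_nonneg tr_real)
  ultimately have "tr (star (q \<odot> ?d) \<odot> (q \<odot> ?d)) = 0"
    by (auto simp: complex_eq_iff complex_is_Real_iff)
  then have "q \<odot> ?d = 0" using tr_faithful[of "q \<odot> ?d"] dA by simp
  then show "q \<odot> p = q" by (simp add: mult_diff)
next
  note [simp] = is_projD[OF p] is_projD[OF q]
  assume qp: "q \<odot> p = q"
  then have "p \<odot> q = q" using star_mult[of q p] by simp
  then have "star (p - q) \<odot> (p - q) = p - q" using qp by (simp add: star_diff mult_diff)
  then show "pos (p - q)" by (auto simp: pos_def intro!: bexI[of _ "p - q"])
qed

section \<open>Norm limits, closed subspaces and bounded linear maps\<close>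

definition norm_lim :: "('b \<Rightarrow> 'a) \<Rightarrow> 'a \<Rightarrow> 'b filter \<Rightarrow> bool" where
  "norm_lim f v F \<longleftrightarrow> v \<in> A \<and> (\<forall>x. f x \<in> A) \<and> ((\<lambda>x. N (f x - v)) \<longlongrightarrow> 0) F"

lemma norm_limD: "norm_lim f v F \<Longrightarrow> v \<in> A" "norm_lim f v F \<Longrightarrow> f x \<in> A"
    "norm_lim f v F \<Longrightarrow> ((\<lambda>x. N (f x - v)) \<longlongrightarrow> 0) F"
  by (auto simp: norm_lim_def)

lemma norm_minus: "a \<in> A \<Longrightarrow> N (- a) = N a"
  using norm_scale[of a "-1"] by simp

lemma norm_zero [simp]: "N 0 = 0"
  using norm_eq_0_iff[of 0] by simp

lemma norm_lim_bound:
  assumes "\<And>x. f x \<in> A" "v \<in> A" "\<forall>\<^sub>F x in F. N (f x - v) \<le> g x" "(g \<longlongrightarrow> 0) F"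
  shows "norm_lim f v F"
proof -
  have "((\<lambda>x. N (f x - v)) \<longlongrightarrow> 0) F"
    by (rule tendsto_sandwich[OF _ assms(3) tendsto_const assms(4)])
      (auto simp: assms intro!: always_eventually norm_nonneg)
  then show ?thesis using assms by (auto simp: norm_lim_def)
qed

lemma norm_lim_add:
  assumes f: "norm_lim f v F" and g: "norm_lim g w F"
  shows "norm_lim (\<lambda>x. f x + g x) (v + w) F"
proof (rule norm_lim_bound)
  note [simp] = norm_limD(1,2)[OF f] norm_limD(1,2)[OF g]
  show "f x + g x \<in> A" "v + w \<in> A" for x by auto
  show "\<forall>\<^sub>F x in F. N (f x + g x - (v + w)) \<le> N (f x - v) + N (g x - w)"
  proof (rule always_eventually, rule allI)
    show "N (f x + g x - (v + w)) \<le> N (f x - v) + N (g x - w)" for x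
      using norm_triangle[of "f x - v" "g x - w"] by (simp add: algebra_simps)
  qed
  show "((\<lambda>x. N (f x - v) + N (g x - w)) \<longlongrightarrow> 0) F"
    using tendsto_add[OF norm_limD(3)[OF f] norm_limD(3)[OF g]] by simp
qed

lemma norm_lim_scale:
  assumes c: "(c \<longlongrightarrow> d) F" and f: "norm_lim f v F"
  shows "norm_lim (\<lambda>x. c x *s f x) (d *s v) F"
proof (rule norm_lim_bound)
  note [simp] = norm_limD(1,2)[OF f]
  show "c x *s f x \<in> A" "d *s v \<in> A" for x by auto
  show "\<forall>\<^sub>F x in F. N (c x *s f x - d *s v) \<le> cmod (c x) * N (f x - v) + cmod (c x - d) * N v"
  proof (rule always_eventually, rule allI)
    fix x
    have "c x *s f x - d *s v = c x *s (f x - v) + (c x - d) *s v"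
      by (simp add: scale_right_diff_distrib scale_left_diff_distrib)
    then show "N (c x *s f x - d *s v) \<le> cmod (c x) * N (f x - v) + cmod (c x - d) * N v"
      using norm_triangle[of "c x *s (f x - v)" "(c x - d) *s v"] by (simp add: norm_scale)
  qed
  have "((\<lambda>x. cmod (c x) * N (f x - v) + cmod (c x - d) * N v) \<longlongrightarrow> cmod d * 0 + cmod (d - d) * N v) F"
    by (intro tendsto_intros c norm_limD(3)[OF f])
  then show "((\<lambda>x. cmod (c x) * N (f x - v) + cmod (c x - d) * N v) \<longlongrightarrow> 0) F" by simp
qed

lemma norm_lim_const: "v \<in> A \<Longrightarrow> norm_lim (\<lambda>_. v) v F"
  by (simp add: norm_lim_def)

lemma norm_lim_unique:
  assumes f: "norm_lim f v F" "norm_lim f w F" and F: "F \<noteq> bot"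
  shows "v = w"
proof -
  note [simp] = norm_limD(1,2)[OF f(1)] norm_limD(1,2)[OF f(2)]
  have "norm_lim (\<lambda>x. f x + (-1) *s f x) (v + (-1) *s w) F"
    by (intro norm_lim_add norm_lim_scale tendsto_const f)
  then have "((\<lambda>_. N (w - v)) \<longlongrightarrow> 0) F"
    using norm_minus[of "w - v"] by (simp add: norm_lim_def)
  then have "N (w - v) = 0" using F by (simp add: tendsto_const_iff)
  then show ?thesis using norm_eq_0_iff[of "w - v"] by simp
qed

lemma norm_lim_cong:
  "norm_lim f v F \<Longrightarrow> (\<And>x. g x \<in> A) \<Longrightarrow> (\<forall>\<^sub>F x in F. g x = f x) \<Longrightarrow> norm_lim g v F"
  unfolding norm_lim_def
  by (auto elim!: Lim_transform_eventually elim: eventually_mono)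

lemma norm_lim_star:
  assumes "norm_lim f v F" shows "norm_lim (\<lambda>x. star (f x)) (star v) F"
proof -
  have "N (star (f x) - star v) = N (f x - v)" for x
    using assms by (simp add: norm_lim_def star_diff[symmetric] norm_star)
  then show ?thesis using assms by (simp add: norm_lim_def)
qed

definition norm_closed :: "'a set \<Rightarrow> bool" where
  "norm_closed W \<longleftrightarrow> (\<forall>f v. (\<forall>n::nat. f n \<in> W) \<and> norm_lim f v sequentially \<longrightarrow> v \<in> W)"

lemma norm_closedD:
  "norm_closed W \<Longrightarrow> (\<And>n::nat. f n \<in> W) \<Longrightarrow> norm_lim f v sequentially \<Longrightarrow> v \<in> W"
  by (auto simp: norm_closed_def)

text \<open>If no such \<open>d\<close> existed, elements \<open>w + c *s b\<close> of small norm
  relative to \<open>c\<close>, scaled by \<open>- (1 / c)\<close>, would give elements of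
  \<open>W\<close> converging to \<open>b\<close>. The bound controls the coefficient of a new
  generator by the norm, which drives the two inductions on spanning sets below.\<close>

lemma closed_subspace_distance:
  assumes W: "subspace W" "W \<subseteq> A" "norm_closed W" and b: "b \<in> A" "b \<notin> W"
  obtains d where "0 < d" "\<And>w c. w \<in> W \<Longrightarrow> d * cmod c \<le> N (w + c *s b)"
proof -
  have "\<exists>d>0. \<forall>w\<in>W. \<forall>c. d * cmod c \<le> N (w + c *s b)"
  proof (rule ccontr)
    assume neg: "\<not> ?thesis"
    have "\<exists>w\<in>W. N (w - b) \<le> d" if d: "d > 0" for d
    proof -
      obtain w c where wc: "w \<in> W" "N (w + c *s b) < d * cmod c" using neg d by (meson not_le)
      have wA: "w \<in> A" using wc W by auto
      have c: "c \<noteq> 0" using wc norm_nonneg[OF wA] by auto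
      have eq: "(- (1 / c)) *s w - b = (- (1 / c)) *s (w + c *s b)"
        using c by (simp add: scale_right_distrib)
      have "N ((- (1 / c)) *s w - b) \<le> d"
        unfolding eq using c wc(2) wA b(1)
        by (subst norm_scale) (auto simp: norm_divide norm_minus field_simps)
      then show ?thesis using wc(1) W(1) by (intro bexI[of _ "(- (1/c)) *s w"]) (auto intro!: subspace_scale simp del: scale_minus_left)
    qed
    then have "\<forall>n::nat. \<exists>w\<in>W. N (w - b) \<le> 1 / real (Suc n)" by simp
    then obtain f where f: "\<And>n. f n \<in> W" "\<And>n. N (f n - b) \<le> 1 / real (Suc n)" by metis
    have "norm_lim f b sequentially"
      by (rule norm_lim_bound[where g = "\<lambda>n. 1 / real (Suc n)"])
        (use f W b LIMSEQ_Suc[OF lim_1_over_n] in \<open>auto intro: always_eventually\<close>)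
    then show False using W(3) f(1) b(2) by (auto simp: norm_closed_def)
  qed
  then show ?thesis using that by auto
qed

text \<open>For a convergent sequence the coefficients of the new generator form a Cauchy sequence
  by the distance bound. Removing the generator with these coefficients leaves a convergent sequence
  in the smaller span.\<close>

lemma norm_closed_span:
  assumes "finite B" "span B \<subseteq> A" shows "norm_closed (span B)"
  using assms
proof (induction B rule: finite_induct)
  case empty
  show ?case unfolding norm_closed_def
  proof (intro allI impI)
    fix f v assume *: "(\<forall>n::nat. f n \<in> span {}) \<and> norm_lim f v sequentially"
    then have "f = (\<lambda>_. 0)" by auto
    with * show "v \<in> span {}" using norm_lim_unique[of f 0 sequentially v] norm_lim_const[of 0] by auto
  qed
next
  case (insert b B)
  have sub: "span B \<subseteq> A" and bA: "b \<in> A"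
    using insert.prems span_mono[of B "insert b B"] span_base[of b "insert b B"] by auto
  have cl: "norm_closed (span B)" using insert.IH sub by simp
  show ?case
  proof (cases "b \<in> span B")
    case True then show ?thesis using cl by (simp add: span_redundant)
  next
    case False
    obtain d where d: "0 < d" "\<And>w c. w \<in> span B \<Longrightarrow> d * cmod c \<le> N (w + c *s b)"
      using closed_subspace_distance[OF subspace_span sub cl bA False] by metis
    show ?thesis unfolding norm_closed_def
    proof (intro allI impI)
      fix f v assume *: "(\<forall>n::nat. f n \<in> span (insert b B)) \<and> norm_lim f v sequentially"
      then have lim: "norm_lim f v sequentially" by simp
      note [simp] = norm_limD(1,2)[OF lim]
      have "\<forall>n. \<exists>c. f n - c *s b \<in> span B" using * by (auto simp: span_insert)
      then obtain c where c: "\<And>n. f n - c n *s b \<in> span B" by metis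
      have "Cauchy c"
      proof (rule metric_CauchyI)
        fix \<epsilon> :: real assume "\<epsilon> > 0"
        then have "\<forall>\<^sub>F n in sequentially. N (f n - v) < d * \<epsilon> / 2"
          by (intro order_tendstoD(2)[OF norm_limD(3)[OF lim]]) (simp add: d(1))
        then obtain M where M: "\<And>n. n \<ge> M \<Longrightarrow> N (f n - v) < d * \<epsilon> / 2"
          by (auto simp: eventually_sequentially)
        have "dist (c m) (c n) < \<epsilon>" if "m \<ge> M" "n \<ge> M" for m n
        proof -
          have "(f m - c m *s b) - (f n - c n *s b) \<in> span B" by (rule span_diff[OF c c])
          from d(2)[OF this, of "c m - c n"]
          have "d * cmod (c m - c n) \<le> N (f m - f n)"
            by (simp add: scale_left_diff_distrib)
          also have "\<dots> \<le> N (f m - v) + N (- (f n - v))"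
            using norm_triangle[of "f m - v" "- (f n - v)"] by simp
          also have "\<dots> < d * \<epsilon>"
            using M[OF that(1)] M[OF that(2)] by (subst norm_minus) auto
          finally show ?thesis using d(1) by (simp add: dist_norm)
        qed
        then show "\<exists>M. \<forall>m\<ge>M. \<forall>n\<ge>M. dist (c m) (c n) < \<epsilon>" by blast
      qed
      then obtain c0 where c0: "c \<longlonglongrightarrow> c0" using Cauchy_convergent convergentD by blast
      have lim': "norm_lim (\<lambda>n. f n + (- c n) *s b) (v + (- c0) *s b) sequentially"
        by (intro norm_lim_add norm_lim_scale lim tendsto_minus c0 norm_lim_const bA)
      have "v + (- c0) *s b \<in> span B" by (rule norm_closedD[OF cl _ lim']) (use c in simp)
      then show "v \<in> span (insert b B)" by (auto simp: span_insert)
    qed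
  qed
qed

lemma linear_bounded:
  assumes "finite B" "span B \<subseteq> A"
    and "\<And>v. v \<in> A \<Longrightarrow> L v \<in> A"
    and "\<And>v w. v \<in> A \<Longrightarrow> w \<in> A \<Longrightarrow> L (v + w) = L v + L w"
    and "\<And>z v. v \<in> A \<Longrightarrow> L (z *s v) = z *s L v"
  shows "\<exists>K. \<forall>v\<in>span B. N (L v) \<le> K * N v"
  using assms(1,2)
proof (induction B rule: finite_induct)
  case empty
  show ?case using assms(5)[of 0 0] by auto
next
  case (insert b B)
  have sub: "span B \<subseteq> A" and bA: "b \<in> A"
    using insert.prems span_mono[of B "insert b B"] span_base[of b "insert b B"] by auto
  obtain K where K: "\<And>v. v \<in> span B \<Longrightarrow> N (L v) \<le> K * N v" using insert.IH sub by auto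
  show ?case
  proof (cases "b \<in> span B")
    case True then show ?thesis using K by (auto simp: span_redundant)
  next
    case False
    obtain d where d: "0 < d" "\<And>w c. w \<in> span B \<Longrightarrow> d * cmod c \<le> N (w + c *s b)"
      using closed_subspace_distance[OF subspace_span sub norm_closed_span[OF insert.hyps(1) sub] bA False]
      by metis
    \<comment> \<open>Since \<open>cmod c \<le> N v / d\<close>, the component of \<open>v\<close>
      in \<open>span B\<close> has norm at most \<open>(1 + N b / d) * N v\<close>, which accounts
      for the first summand; the second bounds \<open>c *s L b\<close>. The absolute value appears
      because \<open>K\<close> carries no sign.\<close>
    let ?K = "\<bar>K\<bar> * (1 + N b / d) + N (L b) / d"
    have "N (L v) \<le> ?K * N v" if v: "v \<in> span (insert b B)" for v
    proof -
      obtain c where c: "v - c *s b \<in> span B" using v by (auto simp: span_insert)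
      have vA: "v \<in> A" using v insert.prems by auto
      have cd: "cmod c \<le> N v / d" using d(2)[OF c, of c] d(1) by (simp add: field_simps)
      have "N (L v) = N (L (v - c *s b) + c *s L b)"
        using assms(4)[of "v - c *s b" "c *s b"] assms(5) vA bA by simp
      also have "\<dots> \<le> N (L (v - c *s b)) + cmod c * N (L b)"
        using norm_triangle[of "L (v - c *s b)" "c *s L b"] assms(3) vA bA by (simp add: norm_scale)
      finally have "N (L v) \<le> N (L (v - c *s b)) + cmod c * N (L b)" .
      moreover have "N (L (v - c *s b)) \<le> \<bar>K\<bar> * N (v - c *s b)"
        using order_trans[OF K[OF c] mult_right_mono[of K "\<bar>K\<bar>" "N (v - c *s b)"]]
          norm_nonneg[of "v - c *s b"] vA bA by simp
      moreover have "\<bar>K\<bar> * N (v - c *s b) \<le> \<bar>K\<bar> * (N v + cmod c * N b)"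
        using norm_triangle[of v "(- c) *s b"] vA bA
        by (intro mult_left_mono) (auto simp: norm_scale norm_minus)
      moreover have "\<bar>K\<bar> * (N v + cmod c * N b) \<le> \<bar>K\<bar> * (N v + N v / d * N b)"
        using cd norm_nonneg[OF bA] by (intro mult_left_mono add_left_mono mult_right_mono) auto
      moreover have "cmod c * N (L b) \<le> N v / d * N (L b)"
        using cd norm_nonneg[OF assms(3)[OF bA]] by (rule mult_right_mono)
      ultimately have "N (L v) \<le> \<bar>K\<bar> * (N v + N v / d * N b) + N v / d * N (L b)" by linarith
      also have "\<dots> = ?K * N v" by (simp add: algebra_simps)
      finally show ?thesis .
    qed
    then show ?thesis by blast
  qed
qed

lemma norm_lim_linear:
  assumes L: "\<And>v. v \<in> A \<Longrightarrow> L v \<in> A" "\<And>v w. v \<in> A \<Longrightarrow> w \<in> A \<Longrightarrow> L (v + w) = L v + L w"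
      "\<And>z v. v \<in> A \<Longrightarrow> L (z *s v) = z *s L v"
    and f: "norm_lim f v F"
  shows "norm_lim (\<lambda>x. L (f x)) (L v) F"
proof -
  note [simp] = norm_limD(1,2)[OF f]
  obtain B where B: "finite B" "A = span B" using finite_dimensional by auto
  obtain K where K: "\<And>v. v \<in> A \<Longrightarrow> N (L v) \<le> K * N v"
    using linear_bounded[OF B(1), of L] L unfolding B(2)[symmetric] by (metis order_refl)
  show ?thesis
  proof (rule norm_lim_bound)
    have "L (f x) - L v = L (f x - v)" for x
      using L(2)[of "f x - v" v] by simp
    then show "\<forall>\<^sub>F x in F. N (L (f x) - L v) \<le> K * N (f x - v)" using K by simp
    show "((\<lambda>x. K * N (f x - v)) \<longlongrightarrow> 0) F"
      using tendsto_mult_right_zero[OF norm_limD(3)[OF f]] by simp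
  qed (simp_all add: L)
qed

end

section \<open>Substitution into tangles\<close>

lemma flip_flip [simp]: "flip (flip s) = s"
  by (cases s) auto

lemma names_append: "names (u @ v) = names u @ names v"
  by (induction u rule: names.induct) auto

lemma fits_append: "fits m u j \<Longrightarrow> fits j v k \<Longrightarrow> fits m (u @ v) k"
  by (induction m u j rule: fits.induct) auto

abbreviation shift :: "nat \<Rightarrow> slice list \<Rightarrow> slice list" where
  "shift q \<equiv> map (\<lambda>(p, a). (q + p, a))"

lemma fits_shift: "fits m w k \<Longrightarrow> fits (q + m + d) (shift q w) (q + k + d)"
proof (induction m w k rule: fits.induct)
  case (2 m p a w k)
  then have "q + m + d - ins a + outs a = q + (m - ins a + outs a) + d" by auto
  with 2 show ?case by auto
qed auto

lemma names_shift [simp]: "names (shift q w) = names w"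
  by (induction w rule: names.induct) auto

lemma names_plug:
  "names (concat (map (plug l W) w)) = concat (map (\<lambda>k. if k = l then names W else [k]) (names w))"
  by (induction w rule: names.induct) (auto simp: names_append)

lemma plug_other: "l \<notin> set (names w) \<Longrightarrow> concat (map (plug l W) w) = w"
  by (induction w rule: names.induct) auto

lemma shift_0 [simp]: "shift 0 w = w"
  by (simp add: case_prod_unfold)

lemma inputs_simps [simp]:
  "inputs (Tangle s n []) = {}"
  "inputs (Tangle s n ((p, Cup) # w)) = inputs (Tangle s n w)"
  "inputs (Tangle s n ((p, Cap) # w)) = inputs (Tangle s n w)"
  "inputs (Tangle s n ((p, Box m l) # w)) = insert (l, m, (flip ^^ p) s) (inputs (Tangle s n w))"
  by (auto simp: inputs_def)

lemma set_names: "set (names (slices T)) = fst ` inputs T"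
proof -
  have "set (names w) = fst ` inputs (Tangle s n w)" for s n w
    by (induction w rule: names.induct) auto
  from this[of "slices T" "shade T" "width T"] show ?thesis by simp
qed

lemma inputs_append: "inputs (Tangle s n (u @ v)) = inputs (Tangle s n u) \<union> inputs (Tangle s n v)"
  by (auto simp: inputs_def)

lemma inputs_shift: "inputs (Tangle s n (shift p w)) = inputs (Tangle ((flip ^^ p) s) n w)"
proof (induction w rule: names.induct)
  case (2 q m l w)
  have "(flip ^^ (p + q)) s = (flip ^^ q) ((flip ^^ p) s)" by (metis add.commute comp_apply funpow_add)
  with 2 show ?case by simp
qed auto

text \<open>An \<open>n\<close>-box has \<open>n\<close> strings below and above, so the slices of a
  tangle of width \<open>n\<close>, shifted to its place, leave the strings on both sides alone. The
  name \<open>l\<close> itself may occur in \<open>S\<close>, since it disappears from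
  \<open>T\<close>.\<close>

lemma valid_compose:
  assumes T: "valid T" and S: "valid S"
    and l: "\<And>n t. (l, n, t) \<in> inputs T \<Longrightarrow> n = width S"
    and disj: "set (names (slices S)) \<inter> set (names (slices T)) \<subseteq> {l}"
  shows "valid (compose T l S)"
proof -
  let ?W = "slices S" and ?p = "plug l (slices S)"
  have "fits m w k \<Longrightarrow> (\<And>p n. (p, Box n l) \<in> set w \<Longrightarrow> n = width S)
    \<Longrightarrow> fits m (concat (map ?p w)) k" for m w k
  proof (induction m w k rule: fits.induct)
    case (2 m p a w k)
    show ?case
    proof (cases a)
      case (Box n j)
      show ?thesis
      proof (cases "j = l")
        case True
        then have n: "n = width S" using 2(3) Box by auto
        have pm: "p + n \<le> m" using 2 Box by auto
        have "fits m (shift p ?W) m"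
          using fits_shift[of n ?W n p "m - p - n"] S n pm by (simp add: valid_def)
        then show ?thesis using 2 Box True pm by (auto intro!: fits_append)
      next
        case False then show ?thesis using 2 Box by auto
      qed
    qed (use 2 in auto)
  qed auto
  moreover have "n = width S" if "(p, Box n l) \<in> set (slices T)" for p n
    using l that by (auto simp: inputs_def)
  moreover have "distinct (concat (map (\<lambda>k. if k = l then V else [k]) w))"
    if "distinct w" "distinct V" "set V \<inter> set w \<subseteq> {l}" for V w
    using that
  proof (induction w)
    case (Cons k w)
    then show ?case by (cases "k = l") (auto split: if_splits)
  qed auto
  ultimately show ?thesis using T S disj
    by (auto simp: valid_def compose_def names_plug)
qed

lemma inputs_compose:
  assumes "(l, width S, shade S) \<in> inputs T" "\<And>n t. (l, n, t) \<in> inputs T \<Longrightarrow> t = shade S"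
  shows "inputs (compose T l S) = {i \<in> inputs T. fst i \<noteq> l} \<union> inputs S"
proof -
  \<comment> \<open>Stated without distinct names: each occurrence of \<open>l\<close> contributes
    the inputs of the inserted slices, read with the shading of the region at that
    occurrence.\<close>
  have *: "inputs (Tangle s k (concat (map (plug l W) w))) =
      {i \<in> inputs (Tangle s k w). fst i \<noteq> l} \<union>
      (\<Union>(j, m, t) \<in> {i \<in> inputs (Tangle s k w). fst i = l}. inputs (Tangle t k W))" for s k W w
  proof (induction w rule: names.induct)
    case (2 p n j w)
    show ?case using 2 by (cases "j = l") (auto simp: inputs_append inputs_shift)
  qed auto
  let ?I = "{i \<in> inputs T. fst i = l}"
  have "inputs (Tangle t (width T) (slices S)) = inputs S" if "(j, m, t) \<in> ?I" for j m t
  proof -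
    have "t = shade S" using assms(2)[of m t] that by auto
    then show ?thesis by (simp add: inputs_def)
  qed
  then have "(\<Union>(j, m, t) \<in> ?I. inputs (Tangle t (width T) (slices S))) = (\<Union>i \<in> ?I. inputs S)"
    by (intro SUP_cong) auto
  also have "\<dots> = inputs S" using assms(1) by (subst SUP_constant) force
  finally show ?thesis
    unfolding compose_def *[of "shade T" "width T"] tangle.collapse by simp
qed

locale planar =
  fixes PA :: "('a::ab_group_add) planar_data"
  assumes planar_algebra: "planar_algebra PA"
begin

lemma act_closed: "valid T \<Longrightarrow> admissible PA T f \<Longrightarrow> act PA T f \<in> boxes PA (width T) (shade T)"
proof -
  have "\<forall>T f. valid T \<and> admissible PA T f \<longrightarrow> act PA T f \<in> boxes PA (width T) (shade T)"
    using planar_algebra unfolding planar_algebra_def by (elim conjE) assumption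
  then show "valid T \<Longrightarrow> admissible PA T f \<Longrightarrow> act PA T f \<in> boxes PA (width T) (shade T)" by blast
qed

lemma act_cong:
  assumes "valid T" "admissible PA T f" "\<And>l n s. (l, n, s) \<in> inputs T \<Longrightarrow> f l = g l"
  shows "act PA T f = act PA T g"
proof -
  have "\<forall>T f g. valid T \<and> admissible PA T f \<and> (\<forall>(l, n, s) \<in> inputs T. f l = g l)
      \<longrightarrow> act PA T f = act PA T g"
    using planar_algebra unfolding planar_algebra_def by (elim conjE) assumption
  moreover have "\<forall>(l, n, s) \<in> inputs T. f l = g l" using assms(3) by auto
  ultimately show ?thesis using assms(1,2) by blast
qed

lemma act_isotopic:
  assumes "isotopic T T'" "admissible PA T f"
  shows "act PA T f = act PA T' f"
proof -
  have "\<forall>T T' f. isotopic T T' \<and> admissible PA T f \<longrightarrow> act PA T f = act PA T' f"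
    using planar_algebra unfolding planar_algebra_def by (elim conjE) assumption
  then show ?thesis using assms by blast
qed

lemma act_box: "f l \<in> boxes PA n s \<Longrightarrow> act PA (Tangle s n [(0, Box n l)]) f = f l"
proof -
  have "\<forall>n s l f. f l \<in> boxes PA n s \<longrightarrow> act PA (Tangle s n [(0, Box n l)]) f = f l"
    using planar_algebra unfolding planar_algebra_def by (elim conjE) assumption
  then show "f l \<in> boxes PA n s \<Longrightarrow> act PA (Tangle s n [(0, Box n l)]) f = f l" by blast
qed

lemma act_compose:
  assumes "valid T" "valid S" "(l, width S, shade S) \<in> inputs T"
    "set (names (slices S)) \<inter> (set (names (slices T)) - {l}) = {}"
    "admissible PA (compose T l S) f"
  shows "act PA (compose T l S) f = act PA T (f(l := act PA S f))"
proof -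
  have "\<forall>T S l f. valid T \<and> valid S \<and> (l, width S, shade S) \<in> inputs T
          \<and> set (names (slices S)) \<inter> (set (names (slices T)) - {l}) = {}
          \<and> admissible PA (compose T l S) f
        \<longrightarrow> act PA (compose T l S) f = act PA T (f(l := act PA S f))"
    using planar_algebra unfolding planar_algebra_def by (elim conjE) assumption
  then show ?thesis using assms by blast
qed

lemma act_subst1:
  assumes T: "valid T" "inputs T = {(0, width S, shade S)}"
    and S: "valid S" "admissible PA S f"
  shows "act PA T (\<lambda>_. act PA S f) = act PA (compose T 0 S) f"
proof -
  have "set (names (slices T)) \<subseteq> {0}" using T(2) by (simp add: set_names)
  moreover have "admissible PA (compose T 0 S) f"
  proof -
    have "inputs (compose T 0 S) = {i \<in> inputs T. fst i \<noteq> 0} \<union> inputs S"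
      by (rule inputs_compose) (simp_all add: T(2))
    moreover have "{i \<in> inputs T. fst i \<noteq> 0} = {}" unfolding T(2) by auto
    ultimately have "inputs (compose T 0 S) = inputs S" by (simp only: Un_empty_left)
    then show ?thesis using S(2) by (simp only: admissible_def)
  qed
  ultimately have "act PA (compose T 0 S) f = act PA T (f(0 := act PA S f))"
    using T S by (intro act_compose) auto
  also have "\<dots> = act PA T (\<lambda>_. act PA S f)"
    using T S act_closed[OF S] by (intro act_cong) (auto simp: admissible_def)
  finally show ?thesis ..
qed

text \<open>The tangles that define the operations call their discs 0 and 1. The inserted tangles
  avoid both names, so that the second substitution meets only the disc of \<open>T\<close> and no
  value that \<open>S\<close> or \<open>R\<close> reads from \<open>f\<close> is overwritten; hence
  the names 2, 3 and 4 in the diagrams below.\<close>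

lemma act_subst2:
  assumes T: "valid T" "inputs T = {(0, width S, shade S), (1, width R, shade R)}"
    and S: "valid S" "admissible PA S f" and R: "valid R" "admissible PA R f"
    and disj: "set (names (slices S)) \<inter> set (names (slices R)) = {}"
      "{0, 1} \<inter> set (names (slices S)) = {}" "{0, 1} \<inter> set (names (slices R)) = {}"
  shows "act PA T (\<lambda>l. if l = 0 then act PA S f else act PA R f) =
    act PA (compose (compose T 0 S) 1 R) f"
proof -
  let ?T1 = "compose T 0 S"
  let ?f1 = "f(1 := act PA R f)"
  have nT: "set (names (slices T)) \<subseteq> {0, 1}" using T(2) by (simp add: set_names)
  have n1: "set (names (slices ?T1)) \<subseteq> {1} \<union> set (names (slices S))"
  proof
    fix k assume "k \<in> set (names (slices ?T1))"
    then obtain j where "j \<in> set (names (slices T))" "k \<in> set (if j = 0 then names (slices S) else [j])"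
      unfolding compose_def tangle.sel names_plug set_concat set_map by blast
    then show "k \<in> {1} \<union> set (names (slices S))" using nT by (cases "j = 0") auto
  qed
  have i1: "inputs ?T1 = {(1, width R, shade R)} \<union> inputs S"
  proof -
    have "{i \<in> inputs T. fst i \<noteq> 0} = {(1, width R, shade R)}" unfolding T(2) by auto
    moreover have "inputs ?T1 = {i \<in> inputs T. fst i \<noteq> 0} \<union> inputs S"
      by (rule inputs_compose) (simp_all add: T(2))
    ultimately show ?thesis by (simp only:)
  qed
  have l1: "l \<noteq> 0 \<and> l \<noteq> 1" if "(l, n, t) \<in> inputs S \<union> inputs R" for l n t
      proof -
    have "fst (l, n, t) \<in> fst ` (inputs S \<union> inputs R)" using that by (rule imageI)
    then have "l \<in> set (names (slices S)) \<union> set (names (slices R))"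
      by (simp only: set_names image_Un fst_conv)
    then show ?thesis using disj(2,3) by (intro conjI notI) auto
  qed
  then have l1': "(1, n, t) \<notin> inputs S" for n t by blast
  have v1: "valid ?T1" using T S nT disj by (intro valid_compose) auto
  have i2: "inputs (compose ?T1 1 R) = inputs S \<union> inputs R"
  proof -
    have "{i \<in> inputs ?T1. fst i \<noteq> 1} = inputs S" unfolding i1 using l1' by auto
    moreover have "inputs (compose ?T1 1 R) = {i \<in> inputs ?T1. fst i \<noteq> 1} \<union> inputs R"
      by (rule inputs_compose) (use l1' in \<open>auto simp: i1\<close>)
    ultimately show ?thesis by (simp only:)
  qed
  have "admissible PA (compose ?T1 1 R) f"
    using S R unfolding admissible_def i2 by auto
  then have "act PA (compose ?T1 1 R) f = act PA ?T1 ?f1"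
    using v1 R i1 n1 disj by (intro act_compose) auto
  also have a1: "admissible PA S ?f1"
    unfolding admissible_def
  proof clarify
    fix l n t assume l: "(l, n, t) \<in> inputs S"
    then have "f l \<in> boxes PA n t" using S(2) unfolding admissible_def by blast
    then show "?f1 l \<in> boxes PA n t" using l l1' by (cases "l = 1") auto
  qed
  have "admissible PA ?T1 ?f1"
    using a1 act_closed[OF R] by (auto simp: admissible_def i1)
  then have "act PA ?T1 ?f1 = act PA T (?f1(0 := act PA S ?f1))"
    using T S nT disj by (intro act_compose) auto
  also have "act PA S ?f1 = act PA S f"
    using S(1) a1 by (intro act_cong) (use l1 in auto)
  also have "act PA T (?f1(0 := act PA S f)) = act PA T (\<lambda>l. if l = 0 then act PA S f else act PA R f)"
    using T act_closed[OF S] act_closed[OF R] by (intro act_cong) (auto simp: admissible_def)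
  finally show ?thesis ..
qed

section \<open>Operations on boxes as operations on slice lists\<close>

lemma mul_act:
  assumes S: "valid (Tangle s n S)" "admissible PA (Tangle s n S) f"
    and R: "valid (Tangle s n R)" "admissible PA (Tangle s n R) f"
    and disj: "set (names S) \<inter> set (names R) = {}" "{0, 1} \<inter> set (names S) = {}" "{0, 1} \<inter> set (names R) = {}"
  shows "mul PA n s (act PA (Tangle s n S) f) (act PA (Tangle s n R) f) = act PA (Tangle s n (S @ R)) f"
  unfolding mul_def
  by (subst act_subst2)
    (use assms in \<open>auto simp: compose_def plug_other valid_def\<close>)

lemma juxtapose_act:
  assumes S: "valid (Tangle s 1 S)" "admissible PA (Tangle s 1 S) f"
    and R: "valid (Tangle (flip s) 1 R)" "admissible PA (Tangle (flip s) 1 R) f"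
    and disj: "set (names S) \<inter> set (names R) = {}" "{0, 1} \<inter> set (names S) = {}" "{0, 1} \<inter> set (names R) = {}"
  shows "juxtapose PA s (act PA (Tangle s 1 S) f) (act PA (Tangle (flip s) 1 R) f) =
    act PA (Tangle s 2 (S @ shift 1 R)) f"
  unfolding juxtapose_def
  by (subst act_subst2)
    (use assms in \<open>auto simp: compose_def plug_other valid_def\<close>)

lemma convolve1_act:
  assumes S: "valid (Tangle s 1 S)" "admissible PA (Tangle s 1 S) f"
    and R: "valid (Tangle (flip s) 2 R)" "admissible PA (Tangle (flip s) 2 R) f"
    and disj: "set (names S) \<inter> set (names R) = {}" "{0, 1} \<inter> set (names S) = {}" "{0, 1} \<inter> set (names R) = {}"
  shows "convolve1 PA s (act PA (Tangle s 1 S) f) (act PA (Tangle (flip s) 2 R) f) =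
    act PA (Tangle s 1 ([(0, Cup)] @ S @ shift 1 R @ [(0, Cap)])) f"
  unfolding convolve1_def
  by (subst act_subst2)
    (use assms in \<open>auto simp: compose_def plug_other valid_def\<close>)

lemma convolve_act:
  assumes S: "valid (Tangle s 2 S)" "admissible PA (Tangle s 2 S) f"
    and R: "valid (Tangle s 2 R)" "admissible PA (Tangle s 2 R) f"
    and disj: "set (names S) \<inter> set (names R) = {}" "{0, 1} \<inter> set (names S) = {}" "{0, 1} \<inter> set (names R) = {}"
  shows "convolve PA s (act PA (Tangle s 2 S) f) (act PA (Tangle s 2 R) f) =
    act PA (Tangle s 2 ([(1, Cup)] @ S @ shift 2 R @ [(1, Cap)])) f"
  unfolding convolve_def
  by (subst act_subst2)
    (use assms in \<open>auto simp: compose_def plug_other valid_def numeral_2_eq_2\<close>)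

lemma fourier_act:
  assumes S: "valid (Tangle s 2 S)" "admissible PA (Tangle s 2 S) f"
  shows "fourier PA s (act PA (Tangle s 2 S) f) =
    act PA (Tangle (flip s) 2 ([(0, Cup)] @ shift 1 S @ [(2, Cap)])) f"
  unfolding fourier_def
  by (subst act_subst1) (use assms in \<open>auto simp: compose_def valid_def\<close>)

lemma turn_act:
  assumes S: "valid (Tangle s 1 S)" "admissible PA (Tangle s 1 S) f"
  shows "turn PA s (act PA (Tangle s 1 S) f) =
    act PA (Tangle (flip s) 1 ([(0, Cup)] @ shift 1 S @ [(1, Cap)])) f"
  unfolding turn_def
  by (subst act_subst1) (use assms in \<open>auto simp: compose_def valid_def\<close>)

lemma unit_act: "unit PA n s = act PA (Tangle s n []) f"
  unfolding unit_def by (rule act_cong) (auto simp: valid_def admissible_def)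

text \<open>Products grow upwards, so the ends of the box play different roles. What is attached to
  the top left end, the output, multiplies from the right. The top right end is turned down and
  becomes the bottom, so what is attached there, rotated by 180 degrees, multiplies from the left.
  The two bottom ends are joined by a minimum, along which elements can slide. The lemmas
  \<open>bend_mul_right\<close>, \<open>bend_mul_left\<close> and \<open>bend_slide\<close> express
  these three facts.\<close>

definition bend :: "shading \<Rightarrow> 'a \<Rightarrow> 'a" where
  "bend s w = act PA (Tangle s 1 [(0, Cup), (0, Box 2 0), (1, Cap)]) (\<lambda>_. w)"

lemma bend_act:
  assumes S: "valid (Tangle s 2 S)" "admissible PA (Tangle s 2 S) f"
  shows "bend s (act PA (Tangle s 2 S) f) =
    act PA (Tangle s 1 ([(0, Cup)] @ S @ [(1, Cap)])) f"
  unfolding bend_def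
  by (subst act_subst1) (use assms in \<open>auto simp: compose_def valid_def\<close>)

section \<open>Bending and sliding\<close>

lemma act_move:
  assumes "move w w' \<or> move w' w"
    and W: "W = u @ w @ v" "W' = u @ w' @ v"
    and "valid (Tangle s n W)" "valid (Tangle s n W')" "admissible PA (Tangle s n W) f"
  shows "act PA (Tangle s n W) f = act PA (Tangle s n W') f"
  using assms isotopic.local isotopic.sym by (intro act_isotopic) blast+

text \<open>An isotopy move needs an explicit context, whereas in a concrete list of slices it is
  the index that the simplifier can evaluate; this converts one form into the other.\<close>

lemma split_two:
  assumes "Suc i < length W"
  shows "W = take i W @ [W ! i, W ! Suc i] @ drop (Suc (Suc i)) W"
    and "W[i := x, Suc i := y] = take i W @ [x, y] @ drop (Suc (Suc i)) W"
proof -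
  show *: "W = take i W @ [W ! i, W ! Suc i] @ drop (Suc (Suc i)) W"
    using assms by (simp add: Cons_nth_drop_Suc)
  show "W[i := x, Suc i := y] = take i W @ [x, y] @ drop (Suc (Suc i)) W"
    using assms by (subst *) (simp add: list_update_append)
qed

text \<open>The slice \<open>i + 1\<close> lies to the right of the slice \<open>i\<close> and is moved below it.\<close>

lemma exchange_right:
  assumes "Suc i < length W" "fst (W ! i) + outs (snd (W ! i)) \<le> fst (W ! Suc i)"
    "W' = W[i := (fst (W ! Suc i) - outs (snd (W ! i)) + ins (snd (W ! i)), snd (W ! Suc i)), Suc i := W ! i]"
    "valid (Tangle s n W)" "valid (Tangle s n W')" "admissible PA (Tangle s n W) f"
  shows "act PA (Tangle s n W) f = act PA (Tangle s n W') f"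
proof -
  obtain p a q b where pq: "W ! i = (p, a)" "W ! Suc i = (q, b)" by (metis surj_pair)
  define d where "d = q - (p + outs a)"
  have q: "q = p + outs a + d" "q - outs a + ins a = p + ins a + d" using assms(2) pq by (auto simp: d_def)
  show ?thesis
  proof (rule act_move)
    show "move [(p, a), (q, b)] [(q - outs a + ins a, b), (p, a)] \<or>
        move [(q - outs a + ins a, b), (p, a)] [(p, a), (q, b)]"
      unfolding q(2) unfolding q(1) by (auto intro: move.exchange)
  qed (use assms split_two[OF assms(1)] pq in auto)
qed

text \<open>The slice \<open>i + 1\<close> lies to the left of the slice \<open>i\<close> and is moved below it.\<close>

lemma exchange_left:
  assumes "Suc i < length W" "fst (W ! Suc i) + ins (snd (W ! Suc i)) \<le> fst (W ! i)"
    "W' = W[i := W ! Suc i, Suc i := (fst (W ! i) - ins (snd (W ! Suc i)) + outs (snd (W ! Suc i)), snd (W ! i))]"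
    "valid (Tangle s n W)" "valid (Tangle s n W')" "admissible PA (Tangle s n W) f"
  shows "act PA (Tangle s n W) f = act PA (Tangle s n W') f"
proof -
  obtain p a q b where pq: "W ! Suc i = (p, a)" "W ! i = (q, b)" by (metis surj_pair)
  define d where "d = q - (p + ins a)"
  have q: "q = p + ins a + d" "q - ins a + outs a = p + outs a + d" using assms(2) pq by (auto simp: d_def)
  show ?thesis
  proof (rule act_move)
    show "move [(q, b), (p, a)] [(p, a), (q - ins a + outs a, b)] \<or>
        move [(p, a), (q - ins a + outs a, b)] [(q, b), (p, a)]"
      unfolding q(2) unfolding q(1) by (auto intro: move.exchange)
  qed (use assms split_two[OF assms(1)] pq in auto)
qed

lemma straighten:
  assumes "Suc i < length W" "(W ! i, W ! Suc i) = ((p, Cup), (p + 1, Cap)) \<or> (W ! i, W ! Suc i) = ((p + 1, Cup), (p, Cap))"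
    "W' = take i W @ drop (Suc (Suc i)) W"
    "valid (Tangle s n W)" "valid (Tangle s n W')" "admissible PA (Tangle s n W) f"
  shows "act PA (Tangle s n W) f = act PA (Tangle s n W') f"
proof (rule act_move)
  show "move [W ! i, W ! Suc i] [] \<or> move [] [W ! i, W ! Suc i]"
    using assms(2) by (auto simp del: One_nat_def intro: move.zigzag_left move.zigzag_right)
qed (use assms split_two[OF assms(1)] in auto)

text \<open>The full turn is inserted rather than removed. Of its two half turns, one is later
  straightened against a bent string and the other remains as \<open>turn\<close>.\<close>

lemma unwind_1:
  assumes "i < length W" "W ! i = (p, Box 1 l)"
    "W' = take i W @ [(p, Cup), (p + 1, Cup), (p + 2, Box 1 l), (p + 2, Cap), (p + 1, Cap)] @ drop (Suc i) W"
    "valid (Tangle s n W)" "valid (Tangle s n W')" "admissible PA (Tangle s n W) f"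
  shows "act PA (Tangle s n W) f = act PA (Tangle s n W') f"
proof (rule act_move)
  have "[0..<2 * 1] = [0, 1]" by (simp add: upt_rec)
  then show "move [W ! i] [(p, Cup), (p + 1, Cup), (p + 2, Box 1 l), (p + 2, Cap), (p + 1, Cap)] \<or>
      move [(p, Cup), (p + 1, Cup), (p + 2, Box 1 l), (p + 2, Cap), (p + 1, Cap)] [W ! i]"
    using move.full_turn[of p 1 l] assms(2) by simp
  show "W = take i W @ [W ! i] @ drop (Suc i) W" using assms(1) by (simp add: Cons_nth_drop_Suc)
qed (use assms in auto)

lemma flip_funpow [simp]: "(flip ^^ 1) s = flip s" "(flip ^^ 2) s = s" "(flip ^^ 3) s = flip s"
  by (simp_all add: numeral_eq_Suc)

text \<open>The maximum that closes the convolution is lowered past \<open>x\<close>, where it forms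
  a zigzag with the minimum of the Fourier transform. Straightening it attaches \<open>y\<close>
  directly to the bottom left end of \<open>x\<close>.\<close>

lemma convolve1_fourier:
  assumes y: "y \<in> boxes PA 1 s" and x: "x \<in> boxes PA 2 s"
  shows "convolve1 PA s y (fourier PA s x) = bend s (mul PA 2 s (juxtapose PA s y (unit PA 1 (flip s))) x)"
proof -
  define f :: "nat \<Rightarrow> 'a" where "f = (\<lambda>l. if l = 2 then y else x)"
  have f: "f 2 \<in> boxes PA 1 s" "f 3 \<in> boxes PA 2 s" using x y by (auto simp: f_def)
  have y': "y = act PA (Tangle s 1 [(0, Box 1 2)]) f" and x': "x = act PA (Tangle s 2 [(0, Box 2 3)]) f"
    using f act_box[of f 2 1 s] act_box[of f 3 2 s] by (auto simp: f_def)
  note [simp] = valid_def admissible_def and [simp del] = One_nat_def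
  have "convolve1 PA s y (fourier PA s x) =
      act PA (Tangle s 1 [(0, Cup), (0, Box 1 2), (1, Cup), (2, Box 2 3), (3, Cap), (0, Cap)]) f"
    unfolding x' y' using f by (simp add: fourier_act convolve1_act)
  also have "\<dots> = act PA (Tangle s 1 [(0, Cup), (0, Box 1 2), (1, Cup), (2, Box 2 3), (0, Cap), (1, Cap)]) f"
    using f by (intro exchange_left[where i = 4]) (simp_all add: One_nat_def numeral_eq_Suc)
  also have "\<dots> = act PA (Tangle s 1 [(0, Cup), (0, Box 1 2), (1, Cup), (0, Cap), (0, Box 2 3), (1, Cap)]) f"
    using f by (intro exchange_left[where i = 3]) (simp_all add: One_nat_def numeral_eq_Suc)
  also have "\<dots> = act PA (Tangle s 1 [(0, Cup), (0, Box 1 2), (0, Box 2 3), (1, Cap)]) f"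
    using f by (intro straighten[where i = 2 and p = 0]) (simp_all add: One_nat_def numeral_eq_Suc)
  also have "\<dots> = bend s (mul PA 2 s (juxtapose PA s y (unit PA 1 (flip s))) x)"
    unfolding x' y' unit_act[of _ _ f] using f by (simp add: juxtapose_act mul_act bend_act)
  finally show ?thesis .
qed

lemma bend_mul_right:
  assumes c: "c \<in> boxes PA 1 s" and w: "w \<in> boxes PA 2 s"
  shows "mul PA 1 s (bend s w) c = bend s (mul PA 2 s w (juxtapose PA s c (unit PA 1 (flip s))))"
proof -
  define f :: "nat \<Rightarrow> 'a" where "f = (\<lambda>l. if l = 2 then c else w)"
  have f: "f 2 \<in> boxes PA 1 s" "f 3 \<in> boxes PA 2 s" using c w by (auto simp: f_def)
  have c': "c = act PA (Tangle s 1 [(0, Box 1 2)]) f" and w': "w = act PA (Tangle s 2 [(0, Box 2 3)]) f"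
    using f act_box[of f 2 1 s] act_box[of f 3 2 s] by (auto simp: f_def)
  note [simp] = valid_def admissible_def and [simp del] = One_nat_def
  have "mul PA 1 s (bend s w) c = act PA (Tangle s 1 [(0, Cup), (0, Box 2 3), (1, Cap), (0, Box 1 2)]) f"
    unfolding c' w' using f by (simp add: bend_act mul_act)
  also have "\<dots> = act PA (Tangle s 1 [(0, Cup), (0, Box 2 3), (0, Box 1 2), (1, Cap)]) f"
    using f by (intro exchange_left[where i = 2]) (simp_all add: One_nat_def numeral_eq_Suc)
  also have "\<dots> = bend s (mul PA 2 s w (juxtapose PA s c (unit PA 1 (flip s))))"
    unfolding c' w' unit_act[of _ _ f] using f by (simp add: juxtapose_act mul_act bend_act)
  finally show ?thesis .
qed

lemma bend_mul_left:
  assumes c: "c \<in> boxes PA 1 s" and w: "w \<in> boxes PA 2 s"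
  shows "mul PA 1 s c (bend s w) = bend s (mul PA 2 s w (juxtapose PA s (unit PA 1 s) (turn PA s c)))"
proof -
  define f :: "nat \<Rightarrow> 'a" where "f = (\<lambda>l. if l = 2 then c else w)"
  have f: "f 2 \<in> boxes PA 1 s" "f 3 \<in> boxes PA 2 s" using c w by (auto simp: f_def)
  have c': "c = act PA (Tangle s 1 [(0, Box 1 2)]) f" and w': "w = act PA (Tangle s 2 [(0, Box 2 3)]) f"
    using f act_box[of f 2 1 s] act_box[of f 3 2 s] by (auto simp: f_def)
  note [simp] = valid_def admissible_def and [simp del] = One_nat_def
  have "mul PA 1 s c (bend s w) = act PA (Tangle s 1 [(0, Box 1 2), (0, Cup), (0, Box 2 3), (1, Cap)]) f"
    unfolding c' w' using f by (simp add: bend_act mul_act)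
  also have "\<dots> = act PA (Tangle s 1 [(0, Cup), (2, Box 1 2), (0, Box 2 3), (1, Cap)]) f"
    using f by (intro exchange_left[where i = 0]) (simp_all add: One_nat_def numeral_eq_Suc)
  also have "\<dots> = act PA (Tangle s 1 [(0, Cup), (0, Box 2 3), (2, Box 1 2), (1, Cap)]) f"
    using f by (intro exchange_left[where i = 1]) (simp_all add: One_nat_def numeral_eq_Suc)
  \<comment> \<open>\<open>c\<close> now sits on the string turned down at the right. The closing
    maximum of \<open>bend\<close> is lowered until it cancels the first minimum of the inserted
    turn; the last maximum of the turn takes its place.\<close>
  also have "\<dots> = act PA (Tangle s 1 [(0, Cup), (0, Box 2 3), (2, Cup), (3, Cup), (4, Box 1 2), (4, Cap), (3, Cap), (1, Cap)]) f"
    using f by (intro unwind_1[where i = 2 and p = 2 and l = 2]) (simp_all add: One_nat_def numeral_eq_Suc)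
  also have "\<dots> = act PA (Tangle s 1 [(0, Cup), (0, Box 2 3), (2, Cup), (3, Cup), (4, Box 1 2), (4, Cap), (1, Cap), (1, Cap)]) f"
    using f by (intro exchange_left[where i = 6]) (simp_all add: One_nat_def numeral_eq_Suc)
  also have "\<dots> = act PA (Tangle s 1 [(0, Cup), (0, Box 2 3), (2, Cup), (3, Cup), (4, Box 1 2), (1, Cap), (2, Cap), (1, Cap)]) f"
    using f by (intro exchange_left[where i = 5]) (simp_all add: One_nat_def numeral_eq_Suc)
  also have "\<dots> = act PA (Tangle s 1 [(0, Cup), (0, Box 2 3), (2, Cup), (3, Cup), (1, Cap), (2, Box 1 2), (2, Cap), (1, Cap)]) f"
    using f by (intro exchange_left[where i = 4]) (simp_all add: One_nat_def numeral_eq_Suc)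
  also have "\<dots> = act PA (Tangle s 1 [(0, Cup), (0, Box 2 3), (2, Cup), (1, Cap), (1, Cup), (2, Box 1 2), (2, Cap), (1, Cap)]) f"
    using f by (intro exchange_left[where i = 3]) (simp_all add: One_nat_def numeral_eq_Suc)
  also have "\<dots> = act PA (Tangle s 1 [(0, Cup), (0, Box 2 3), (1, Cup), (2, Box 1 2), (2, Cap), (1, Cap)]) f"
    using f by (intro straighten[where i = 2 and p = 1]) (simp_all add: One_nat_def numeral_eq_Suc)
  also have "\<dots> = bend s (mul PA 2 s w (juxtapose PA s (unit PA 1 s) (turn PA s c)))"
    unfolding c' w' unit_act[of _ _ f] using f by (simp add: turn_act juxtapose_act mul_act bend_act)
  finally show ?thesis .
qed

lemma bend_slide:
  assumes c: "c \<in> boxes PA 1 s" and w: "w \<in> boxes PA 2 s"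
  shows "bend s (mul PA 2 s (juxtapose PA s (unit PA 1 s) (turn PA s c)) w) =
    bend s (mul PA 2 s (juxtapose PA s c (unit PA 1 (flip s))) w)"
proof -
  define f :: "nat \<Rightarrow> 'a" where "f = (\<lambda>l. if l = 2 then c else w)"
  have f: "f 2 \<in> boxes PA 1 s" "f 3 \<in> boxes PA 2 s" using c w by (auto simp: f_def)
  have c': "c = act PA (Tangle s 1 [(0, Box 1 2)]) f" and w': "w = act PA (Tangle s 2 [(0, Box 2 3)]) f"
    using f act_box[of f 2 1 s] act_box[of f 3 2 s] by (auto simp: f_def)
  note [simp] = valid_def admissible_def and [simp del] = One_nat_def
  have "bend s (mul PA 2 s (juxtapose PA s c (unit PA 1 (flip s))) w) =
      act PA (Tangle s 1 [(0, Cup), (0, Box 1 2), (0, Box 2 3), (1, Cap)]) f"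
    unfolding c' w' unit_act[of _ _ f] using f by (simp add: juxtapose_act mul_act bend_act)
  \<comment> \<open>The first minimum of the inserted turn takes over the role of the minimum of
    \<open>bend\<close>, which is raised until it is straightened against the last maximum of the
    turn.\<close>
  also have "\<dots> = act PA (Tangle s 1 [(0, Cup), (0, Cup), (1, Cup), (2, Box 1 2), (2, Cap), (1, Cap), (0, Box 2 3), (1, Cap)]) f"
    using f by (intro unwind_1[where i = 1 and p = 0 and l = 2]) (simp_all add: One_nat_def numeral_eq_Suc)
  also have "\<dots> = act PA (Tangle s 1 [(0, Cup), (2, Cup), (1, Cup), (2, Box 1 2), (2, Cap), (1, Cap), (0, Box 2 3), (1, Cap)]) f"
    using f by (intro exchange_left[where i = 0]) (simp_all add: One_nat_def numeral_eq_Suc)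
  also have "\<dots> = act PA (Tangle s 1 [(0, Cup), (1, Cup), (4, Cup), (2, Box 1 2), (2, Cap), (1, Cap), (0, Box 2 3), (1, Cap)]) f"
    using f by (intro exchange_left[where i = 1]) (simp_all add: One_nat_def numeral_eq_Suc)
  also have "\<dots> = act PA (Tangle s 1 [(0, Cup), (1, Cup), (2, Box 1 2), (4, Cup), (2, Cap), (1, Cap), (0, Box 2 3), (1, Cap)]) f"
    using f by (intro exchange_left[where i = 2]) (simp_all add: One_nat_def numeral_eq_Suc)
  also have "\<dots> = act PA (Tangle s 1 [(0, Cup), (1, Cup), (2, Box 1 2), (2, Cap), (2, Cup), (1, Cap), (0, Box 2 3), (1, Cap)]) f"
    using f by (intro exchange_left[where i = 3]) (simp_all add: One_nat_def numeral_eq_Suc)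
  also have "\<dots> = act PA (Tangle s 1 [(0, Cup), (1, Cup), (2, Box 1 2), (2, Cap), (0, Box 2 3), (1, Cap)]) f"
    using f by (intro straighten[where i = 4 and p = 1]) (simp_all add: One_nat_def numeral_eq_Suc)
  also have "\<dots> = bend s (mul PA 2 s (juxtapose PA s (unit PA 1 s) (turn PA s c)) w)"
    unfolding c' w' unit_act[of _ _ f] using f by (simp add: turn_act juxtapose_act mul_act bend_act)
  finally show ?thesis ..
qed

section \<open>Algebraic laws of the box operations\<close>

lemma box_ops_closed:
  shows fourier_closed: "x \<in> boxes PA 2 s \<Longrightarrow> fourier PA s x \<in> boxes PA 2 (flip s)"
    and turn_closed: "y \<in> boxes PA 1 s \<Longrightarrow> turn PA s y \<in> boxes PA 1 (flip s)"
    and unit_closed: "unit PA n s \<in> boxes PA n s"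
    and mul_closed: "a \<in> boxes PA n s \<Longrightarrow> b \<in> boxes PA n s \<Longrightarrow> mul PA n s a b \<in> boxes PA n s"
    and juxtapose_closed: "y \<in> boxes PA 1 s \<Longrightarrow> t \<in> boxes PA 1 (flip s) \<Longrightarrow> juxtapose PA s y t \<in> boxes PA 2 s"
    and convolve1_closed: "y \<in> boxes PA 1 s \<Longrightarrow> u \<in> boxes PA 2 (flip s) \<Longrightarrow> convolve1 PA s y u \<in> boxes PA 1 s"
    and convolve_closed: "u \<in> boxes PA 2 s \<Longrightarrow> v \<in> boxes PA 2 s \<Longrightarrow> convolve PA s u v \<in> boxes PA 2 s"
  unfolding fourier_def turn_def unit_def mul_def juxtapose_def convolve1_def convolve_def
  by (rule act_closed[THEN subst[where P = "\<lambda>A. _ \<in> A", rotated]];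
      simp add: valid_def admissible_def numeral_eq_Suc)+

lemma mul_assoc:
  assumes "a \<in> boxes PA n s" "b \<in> boxes PA n s" "c \<in> boxes PA n s"
  shows "mul PA n s (mul PA n s a b) c = mul PA n s a (mul PA n s b c)"
proof -
  define f :: "nat \<Rightarrow> 'a" where "f = (\<lambda>l. if l = 2 then a else if l = 3 then b else c)"
  have f: "f 2 \<in> boxes PA n s" "f 3 \<in> boxes PA n s" "f 4 \<in> boxes PA n s" using assms by (auto simp: f_def)
  have abc: "a = act PA (Tangle s n [(0, Box n 2)]) f" "b = act PA (Tangle s n [(0, Box n 3)]) f"
      "c = act PA (Tangle s n [(0, Box n 4)]) f"
    using f act_box[of f 2 n s] act_box[of f 3 n s] act_box[of f 4 n s] by (auto simp: f_def)
  show ?thesis unfolding abc using f by (simp add: mul_act valid_def admissible_def)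
qed

lemma juxtapose_mul_unit:
  assumes a: "a \<in> boxes PA 1 s" and b: "b \<in> boxes PA 1 s"
  shows "mul PA 2 s (juxtapose PA s a (unit PA 1 (flip s))) (juxtapose PA s b (unit PA 1 (flip s))) =
    juxtapose PA s (mul PA 1 s a b) (unit PA 1 (flip s))"
proof -
  define f :: "nat \<Rightarrow> 'a" where "f = (\<lambda>l. if l = 2 then a else b)"
  have f: "f 2 \<in> boxes PA 1 s" "f 3 \<in> boxes PA 1 s" using a b by (auto simp: f_def)
  have a': "a = act PA (Tangle s 1 [(0, Box 1 2)]) f" and b': "b = act PA (Tangle s 1 [(0, Box 1 3)]) f"
    using f act_box[of f 2 1 s] act_box[of f 3 1 s] by (auto simp: f_def)
  note [simp] = valid_def admissible_def and [simp del] = One_nat_def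
  show ?thesis unfolding a' b' unit_act[of _ _ f] using f by (simp add: juxtapose_act mul_act)
qed

lemma juxtapose_commute:
  assumes a: "a \<in> boxes PA 1 s" and t: "t \<in> boxes PA 1 (flip s)"
  shows "mul PA 2 s (juxtapose PA s a (unit PA 1 (flip s))) (juxtapose PA s (unit PA 1 s) t) =
    mul PA 2 s (juxtapose PA s (unit PA 1 s) t) (juxtapose PA s a (unit PA 1 (flip s)))"
proof -
  define f :: "nat \<Rightarrow> 'a" where "f = (\<lambda>l. if l = 2 then a else t)"
  have f: "f 2 \<in> boxes PA 1 s" "f 3 \<in> boxes PA 1 (flip s)" using a t by (auto simp: f_def)
  have a': "a = act PA (Tangle s 1 [(0, Box 1 2)]) f"
    and t': "t = act PA (Tangle (flip s) 1 [(0, Box 1 3)]) f"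
    using f act_box[of f 2 1 s] act_box[of f 3 1 "flip s"] by (auto simp: f_def)
  note [simp] = valid_def admissible_def and [simp del] = One_nat_def
  have "mul PA 2 s (juxtapose PA s a (unit PA 1 (flip s))) (juxtapose PA s (unit PA 1 s) t) =
      act PA (Tangle s 2 [(0, Box 1 2), (1, Box 1 3)]) f"
    unfolding a' t' unit_act[of _ _ f] using f by (simp add: juxtapose_act mul_act)
  also have "\<dots> = act PA (Tangle s 2 [(1, Box 1 3), (0, Box 1 2)]) f"
    using f by (intro exchange_right[where i = 0]) (simp_all add: One_nat_def numeral_eq_Suc)
  also have "\<dots> = mul PA 2 s (juxtapose PA s (unit PA 1 s) t) (juxtapose PA s a (unit PA 1 (flip s)))"
    unfolding a' t' unit_act[of _ _ f] using f by (simp add: juxtapose_act mul_act)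
  finally show ?thesis .
qed

text \<open>This turns convolution powers into iterates of one linear map. The two pictures differ
  only in heights; in particular, of two successive maxima at the left, the upper one may be drawn
  first, to the right of the other.\<close>

lemma convolve1_assoc:
  assumes y: "y \<in> boxes PA 1 s" and u: "u \<in> boxes PA 2 (flip s)" and v: "v \<in> boxes PA 2 (flip s)"
  shows "convolve1 PA s (convolve1 PA s y u) v = convolve1 PA s y (convolve PA (flip s) u v)"
proof -
  define f :: "nat \<Rightarrow> 'a" where "f = (\<lambda>l. if l = 2 then y else if l = 3 then u else v)"
  have f: "f 2 \<in> boxes PA 1 s" "f 3 \<in> boxes PA 2 (flip s)" "f 4 \<in> boxes PA 2 (flip s)"
    using y u v by (auto simp: f_def)
  have y': "y = act PA (Tangle s 1 [(0, Box 1 2)]) f"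
    and u': "u = act PA (Tangle (flip s) 2 [(0, Box 2 3)]) f"
    and v': "v = act PA (Tangle (flip s) 2 [(0, Box 2 4)]) f"
    using f act_box[of f 2 1 s] act_box[of f 3 2 "flip s"] act_box[of f 4 2 "flip s"] by (auto simp: f_def)
  note [simp] = valid_def admissible_def and [simp del] = One_nat_def
  have "convolve1 PA s (convolve1 PA s y u) v =
      act PA (Tangle s 1 [(0, Cup), (0, Cup), (0, Box 1 2), (1, Box 2 3), (0, Cap), (1, Box 2 4), (0, Cap)]) f"
    unfolding y' u' v' using f by (simp add: convolve1_act)
  also have "\<dots> = act PA (Tangle s 1 [(0, Cup), (2, Cup), (0, Box 1 2), (1, Box 2 3), (0, Cap), (1, Box 2 4), (0, Cap)]) f"
    using f by (intro exchange_right[where i = 0, symmetric]) (simp_all add: One_nat_def numeral_eq_Suc)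
  also have "\<dots> = act PA (Tangle s 1 [(0, Cup), (0, Box 1 2), (2, Cup), (1, Box 2 3), (0, Cap), (1, Box 2 4), (0, Cap)]) f"
    using f by (intro exchange_left[where i = 1]) (simp_all add: One_nat_def numeral_eq_Suc)
  also have "\<dots> = act PA (Tangle s 1 [(0, Cup), (0, Box 1 2), (2, Cup), (1, Box 2 3), (3, Box 2 4), (0, Cap), (0, Cap)]) f"
    using f by (intro exchange_right[where i = 4]) (simp_all add: One_nat_def numeral_eq_Suc)
  also have "\<dots> = act PA (Tangle s 1 [(0, Cup), (0, Box 1 2), (2, Cup), (1, Box 2 3), (3, Box 2 4), (2, Cap), (0, Cap)]) f"
    using f by (intro exchange_right[where i = 5]) (simp_all add: One_nat_def numeral_eq_Suc)
  also have "\<dots> = convolve1 PA s y (convolve PA (flip s) u v)"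
    unfolding y' u' v' using f by (simp add: convolve_act convolve1_act)
  finally show ?thesis .
qed

lemma convolve1_add:
  assumes "y \<in> boxes PA 1 s" "z \<in> boxes PA 1 s" "u \<in> boxes PA 2 (flip s)"
  shows "convolve1 PA s (y + z) u = convolve1 PA s y u + convolve1 PA s z u"
proof -
  let ?T = "Tangle s 1 [(0, Cup), (0, Box 1 0), (1, Box 2 1), (0, Cap)]"
  have "\<forall>T f l n s a b. valid T \<and> admissible PA T f \<and> (l, n, s) \<in> inputs T
          \<and> a \<in> boxes PA n s \<and> b \<in> boxes PA n s
        \<longrightarrow> act PA T (f(l := a + b)) = act PA T (f(l := a)) + act PA T (f(l := b))"
    using planar_algebra unfolding planar_algebra_def by (elim conjE) assumption
  moreover have "valid ?T" "admissible PA ?T (\<lambda>l. if l = 0 then y else u)" "(0, 1, s) \<in> inputs ?T"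
    using assms by (simp_all add: valid_def admissible_def numeral_eq_Suc)
  ultimately have "act PA ?T ((\<lambda>l. if l = 0 then y else u)(0 := y + z)) =
      act PA ?T ((\<lambda>l. if l = 0 then y else u)(0 := y)) + act PA ?T ((\<lambda>l. if l = 0 then y else u)(0 := z))"
    using assms(1,2) by blast
  moreover have "(\<lambda>l. if l = 0 then y else u)(0 := a) = (\<lambda>l::nat. if l = 0 then a else u)" for a
    by auto
  ultimately show ?thesis by (simp add: convolve1_def)
qed

lemma convolve1_scale:
  assumes "y \<in> boxes PA 1 s" "u \<in> boxes PA 2 (flip s)"
  shows "convolve1 PA s (scl PA c y) u = scl PA c (convolve1 PA s y u)"
proof -
  let ?T = "Tangle s 1 [(0, Cup), (0, Box 1 0), (1, Box 2 1), (0, Cap)]"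
  have "\<forall>T f l n s a c. valid T \<and> admissible PA T f \<and> (l, n, s) \<in> inputs T \<and> a \<in> boxes PA n s
        \<longrightarrow> act PA T (f(l := scl PA c a)) = scl PA c (act PA T (f(l := a)))"
    using planar_algebra unfolding planar_algebra_def by (elim conjE) assumption
  moreover have "valid ?T" "admissible PA ?T (\<lambda>l. if l = 0 then y else u)" "(0, 1, s) \<in> inputs ?T"
    using assms by (simp_all add: valid_def admissible_def numeral_eq_Suc)
  ultimately have "act PA ?T ((\<lambda>l. if l = 0 then y else u)(0 := scl PA c y)) =
      scl PA c (act PA ?T ((\<lambda>l. if l = 0 then y else u)(0 := y)))"
    using assms(1) by blast
  moreover have "(\<lambda>l. if l = 0 then y else u)(0 := a) = (\<lambda>l::nat. if l = 0 then a else u)" for a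
    by auto
  ultimately show ?thesis by (simp add: convolve1_def)
qed

lemma conv_power_closed: "u \<in> boxes PA 2 s \<Longrightarrow> conv_power PA s u j \<in> boxes PA 2 s"
  by (induction j) (simp_all add: convolve_closed)

text \<open>\<open>conv_power\<close> with index \<open>i\<close> already has \<open>i + 1\<close>
  factors, so the inner induction starts with one application of the map.\<close>

lemma convolve1_power_eq_funpow:
  assumes y: "y \<in> boxes PA 1 s" and u: "u \<in> boxes PA 2 (flip s)"
  shows "convolve1_power PA s y u j = ((\<lambda>y. convolve1 PA s y u) ^^ j) y"
proof (cases j)
  case (Suc i)
  have "convolve1 PA s y (conv_power PA (flip s) u i) = ((\<lambda>y. convolve1 PA s y u) ^^ Suc i) y"
  proof (induction i)
    case (Suc i)
    have "convolve1 PA s y (conv_power PA (flip s) u (Suc i)) =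
        convolve1 PA s (convolve1 PA s y (conv_power PA (flip s) u i)) u"
      using convolve1_assoc[OF y conv_power_closed[OF u] u] by simp
    then show ?case using Suc.IH by simp
  qed simp
  then show ?thesis using Suc by simp
qed simp

text \<open>\<open>c\<close> enters above \<open>x\<close> on the left, the second commutation in
  \<open>C_algebra\<close> moves it below \<open>x\<close>, and there it joins \<open>y\<close>:
  \<open>(y \<otimes> 1) x (c \<otimes> 1) = (y c \<otimes> 1) x\<close>.\<close>

lemma convolve1_mul_right:
  assumes x: "x \<in> boxes PA 2 s" and y: "y \<in> boxes PA 1 s" and c: "c \<in> C_algebra PA s x"
  shows "mul PA 1 s (convolve1 PA s y (fourier PA s x)) c = convolve1 PA s (mul PA 1 s y c) (fourier PA s x)"
proof -
  let ?L = "\<lambda>a. juxtapose PA s a (unit PA 1 (flip s))"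
  have cA: "c \<in> boxes PA 1 s" and comm: "mul PA 2 s x (?L c) = mul PA 2 s (?L c) x"
    using c by (auto simp: C_algebra_def)
  have L: "?L a \<in> boxes PA 2 s" if "a \<in> boxes PA 1 s" for a
    using that by (intro juxtapose_closed unit_closed)
  have "mul PA 1 s (convolve1 PA s y (fourier PA s x)) c = bend s (mul PA 2 s (mul PA 2 s (?L y) x) (?L c))"
    using x y cA L by (simp del: One_nat_def add: convolve1_fourier bend_mul_right mul_closed)
  also have "mul PA 2 s (mul PA 2 s (?L y) x) (?L c) = mul PA 2 s (?L (mul PA 1 s y c)) x"
    using x y cA L by (simp del: One_nat_def add: mul_assoc comm flip: juxtapose_mul_unit)
  finally show ?thesis using x y cA by (simp del: One_nat_def add: convolve1_fourier mul_closed)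
qed

text \<open>Now the first commutation in \<open>C_algebra\<close> is used. The rotated
  \<open>c\<close> enters above \<open>x\<close> on the right, moves down past \<open>x\<close> and
  past \<open>y\<close>, which sits on the other string, and crosses the minimum by
  \<open>bend_slide\<close>. It arrives below \<open>y\<close>, which makes it the left
  factor.\<close>

lemma convolve1_mul_left:
  assumes x: "x \<in> boxes PA 2 s" and y: "y \<in> boxes PA 1 s" and c: "c \<in> C_algebra PA s x"
  shows "mul PA 1 s c (convolve1 PA s y (fourier PA s x)) = convolve1 PA s (mul PA 1 s c y) (fourier PA s x)"
proof -
  let ?L = "\<lambda>a. juxtapose PA s a (unit PA 1 (flip s))"
  let ?R = "juxtapose PA s (unit PA 1 s) (turn PA s c)"
  have cA: "c \<in> boxes PA 1 s" and comm: "mul PA 2 s x ?R = mul PA 2 s ?R x"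
    using c by (auto simp: C_algebra_def)
  have L: "?L a \<in> boxes PA 2 s" if "a \<in> boxes PA 1 s" for a
    using that by (intro juxtapose_closed unit_closed)
  have R: "?R \<in> boxes PA 2 s" using cA by (intro juxtapose_closed unit_closed turn_closed)
  have "mul PA 1 s c (convolve1 PA s y (fourier PA s x)) = bend s (mul PA 2 s (mul PA 2 s (?L y) x) ?R)"
    using x y cA L by (simp del: One_nat_def add: convolve1_fourier bend_mul_left mul_closed)
  also have "mul PA 2 s (mul PA 2 s (?L y) x) ?R = mul PA 2 s (mul PA 2 s (?L y) ?R) x"
    using x y L R by (simp del: One_nat_def add: mul_assoc comm)
  also have "\<dots> = mul PA 2 s ?R (mul PA 2 s (?L y) x)"
    using x y L R cA by (simp del: One_nat_def add: mul_assoc juxtapose_commute turn_closed)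
  also have "bend s \<dots> = bend s (mul PA 2 s (?L c) (mul PA 2 s (?L y) x))"
    using x y L cA by (simp del: One_nat_def add: bend_slide mul_closed)
  also have "mul PA 2 s (?L c) (mul PA 2 s (?L y) x) = mul PA 2 s (?L (mul PA 1 s c y)) x"
    using x y cA L by (simp del: One_nat_def add: mul_assoc flip: juxtapose_mul_unit)
  finally show ?thesis using x y cA by (simp del: One_nat_def add: convolve1_fourier mul_closed)
qed

text \<open>Reflection draws \<open>u\<close> below \<open>y\<close>; as the two lie side by side,
  one exchange of heights restores the convolution tangle.\<close>

lemma convolve1_adj:
  assumes star: "\<And>T f g. valid T \<Longrightarrow> admissible PA T f \<Longrightarrow> (\<forall>(l, n, s) \<in> inputs T. g l = adj PA n s (f l)) \<Longrightarrow>
      act PA (reflect T) g = adj PA (width T) (shade T) (act PA T f)"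
    and y: "y \<in> boxes PA 1 s" "adj PA 1 s y \<in> boxes PA 1 s"
    and u: "u \<in> boxes PA 2 (flip s)" "adj PA 2 (flip s) u \<in> boxes PA 2 (flip s)"
  shows "adj PA 1 s (convolve1 PA s y u) = convolve1 PA s (adj PA 1 s y) (adj PA 2 (flip s) u)"
proof -
  let ?T = "Tangle s 1 [(0, Cup), (0, Box 1 0), (1, Box 2 1), (0, Cap)]"
  let ?f = "\<lambda>l::nat. if l = 0 then y else u"
  let ?g = "\<lambda>l::nat. if l = 0 then adj PA 1 s y else adj PA 2 (flip s) u"
  note [simp] = valid_def admissible_def and [simp del] = One_nat_def
  have "adj PA 1 s (act PA ?T ?f) = act PA (reflect ?T) ?g"
    using star[of ?T ?f ?g] y u by simp
  also have "\<dots> = act PA (Tangle s 1 [(0, Cup), (1, Box 2 1), (0, Box 1 0), (0, Cap)]) ?g"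
    by (simp add: reflect_def)
  also have "\<dots> = act PA ?T ?g"
    using y u by (intro exchange_left[where i = 1]) (simp_all add: One_nat_def numeral_eq_Suc)
  finally show ?thesis by (simp add: convolve1_def)
qed

end

section \<open>Perron-Frobenius eigenvectors\<close>

context tracial_cstar_algebra
begin

definition is_range :: "'a \<Rightarrow> 'a \<Rightarrow> bool" where
  "is_range a q \<longleftrightarrow> is_proj q \<and> q \<odot> a = a \<and> (\<forall>q'. is_proj q' \<and> q' \<odot> a = a \<longrightarrow> pos (q' - q))"

text \<open>Since \<open>q\<close> has the form \<open>a \<odot> b\<close>, every projection that
  fixes \<open>a\<close> from the left also fixes \<open>q\<close>; this is the minimality.\<close>

lemma is_range_exists:
  assumes a: "a \<in> A"
  obtains q where "is_range a q" "\<exists>b\<in>A. q = a \<odot> b"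
proof -
  obtain q b where q: "is_proj q" "b \<in> A" "q = a \<odot> b" "q \<odot> a = a" using range_projection[OF a] .
  have "pos (q' - q)" if q': "is_proj q'" "q' \<odot> a = a" for q'
  proof -
    have "q' \<odot> q = q" using q q' a by (simp add: is_projD flip: mult_assoc)
    then have "star (q' \<odot> q) = q" using q(1) by (simp add: is_projD)
    then have "q \<odot> q' = q" using q(1) q'(1) by (simp add: star_mult is_projD)
    then show ?thesis using proj_le_iff[OF q'(1) q(1)] by simp
  qed
  then show ?thesis using that q by (auto simp: is_range_def)
qed

text \<open>For \<open>z = c\<^sup>* y c\<close> one has \<open>\<R>(z) \<le> p\<close>, so \<open>z (e - p) = 0\<close>; as \<open>y = b\<^sup>* b\<close>, this
  gives \<open>b c (e - p) = 0\<close>.\<close>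

lemma max_support_corner:
  assumes E: "y \<in> E" "pos y" "is_range y p"
    and max: "\<And>y q. y \<in> E \<Longrightarrow> pos y \<Longrightarrow> is_range y q \<Longrightarrow> pos (p - q)"
    and c: "c \<in> A" "star c \<odot> (y \<odot> c) \<in> E"
  shows "p \<odot> c = p \<odot> (c \<odot> p)"
proof -
  have p: "is_proj p" using E(3) by (auto simp: is_range_def)
  note [simp] = is_projD[OF p] c(1)
  obtain b where b [simp]: "b \<in> A" and yb: "y = star b \<odot> b" using E(2) by (auto simp: pos_def)
  let ?z = "star c \<odot> (y \<odot> c)" and ?d = "e - p"
  have zb: "?z = star (b \<odot> c) \<odot> (b \<odot> c)" by (simp add: yb star_mult mult_assoc)
  then have "pos ?z" by (auto simp: pos_def)
  obtain q where q: "is_range ?z q" using is_range_exists[of ?z] by (auto simp: yb)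
  have qp: "is_proj q" and qz: "q \<odot> ?z = ?z" using q by (auto simp: is_range_def)
  note [simp] = is_projD[OF qp]
  have "q \<odot> p = q"
    using proj_le_iff[OF p qp] max[OF c(2) \<open>pos ?z\<close> q] by simp
  have "star ?z = ?z" using pos_selfadjoint[OF \<open>pos ?z\<close>] by simp
  moreover have "star (q \<odot> ?z) = ?z \<odot> q" using \<open>star ?z = ?z\<close> by (simp add: star_mult yb)
  ultimately have zq: "?z \<odot> q = ?z" using qz by simp
  have zA: "?z \<in> A" by (simp add: yb)
  have "?z \<odot> p = ?z \<odot> q \<odot> p" using zq by simp
  also have "\<dots> = ?z \<odot> (q \<odot> p)" using zA by (intro mult_assoc) simp_all
  finally have "?z \<odot> p = ?z" using \<open>q \<odot> p = q\<close> zq by simp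
  then have zd: "?z \<odot> ?d = 0" by (simp add: mult_diff yb)
  have "star (b \<odot> c \<odot> ?d) \<odot> (b \<odot> c \<odot> ?d) = ?d \<odot> (?z \<odot> ?d)"
    unfolding zb by (simp add: star_mult star_diff mult_assoc)
  then have "b \<odot> c \<odot> ?d = 0" using zd star_mult_eq_0[of "b \<odot> c \<odot> ?d"] by simp
  then have yk: "y \<odot> (c \<odot> ?d) = 0" by (simp add: yb mult_assoc)
  \<comment> \<open>\<open>y\<close> annihilates \<open>c \<odot> ?d\<close>, hence also its range
    projection \<open>g\<close>, thanks to the factor \<open>a\<close>. So the projection
    \<open>e - g\<close> fixes \<open>y\<close>, and minimality of \<open>p\<close> puts
    \<open>p\<close> below \<open>e - g\<close>. As \<open>g\<close> fixes
    \<open>c \<odot> ?d\<close>, this kills \<open>p \<odot> (c \<odot> ?d)\<close>.\<close>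
  obtain g a where g: "is_proj g" "a \<in> A" "g = c \<odot> ?d \<odot> a" "g \<odot> (c \<odot> ?d) = c \<odot> ?d"
    using range_projection[of "c \<odot> ?d"] by auto
  note [simp] = is_projD[OF g(1)]
  have yA: "y \<in> A" by (simp add: yb)
  have "y \<odot> g = (y \<odot> (c \<odot> ?d)) \<odot> a" using g(2) yA by (subst g(3)) (simp add: mult_assoc)
  then have "y \<odot> g = 0" using yk g(2) by simp
  then have "star (y \<odot> g) = 0" by simp
  then have "g \<odot> y = 0" using yA pos_selfadjoint[OF E(2)] by (simp add: star_mult)
  then have "(e - g) \<odot> y = y" using yA by (simp add: mult_diff)
  then have "pos ((e - g) - p)" using E(3) is_proj_complement[OF g(1)] by (auto simp: is_range_def)
  then have "p \<odot> (e - g) = p" using proj_le_iff[OF is_proj_complement[OF g(1)] p] by simp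
  then have "p \<odot> g = 0" by (simp add: mult_diff)
  then have "p \<odot> (g \<odot> (c \<odot> ?d)) = 0" by (simp flip: mult_assoc)
  then have "p \<odot> (c \<odot> ?d) = 0" using g(4) by simp
  then show ?thesis by (simp add: mult_diff)
qed

text \<open>The adjoint of the second relation reads
  \<open>c \<odot> p = p \<odot> (c \<odot> p)\<close>, with the same right side as the
  first.\<close>

lemma commute_from_corners:
  assumes p: "is_proj p" and c: "c \<in> A" and "p \<odot> c = p \<odot> (c \<odot> p)" "p \<odot> star c = p \<odot> (star c \<odot> p)"
  shows "p \<odot> c = c \<odot> p"
proof -
  note [simp] = is_projD[OF p] c
  have "c \<odot> p = star (p \<odot> star c)" by (simp add: star_mult)
  also have "\<dots> = star (p \<odot> (star c \<odot> p))" using assms(4) by simp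
  also have "\<dots> = p \<odot> (c \<odot> p)" by (simp add: star_mult mult_assoc)
  finally show ?thesis using assms(3) by simp
qed

lemma norm_lim_compose: "norm_lim f v F \<Longrightarrow> filterlim g F G \<Longrightarrow> norm_lim (\<lambda>x. f (g x)) v G"
  unfolding norm_lim_def by (auto intro: filterlim_compose[of "\<lambda>x. N (f x - v)"])

end

text \<open>\<open>\<phi>\<close> stands for convolution with the Fourier transform of
  \<open>x\<close>. The analytic part uses planar diagrams only through these laws and the bimodule
  property.\<close>

locale star_linear_map = tracial_cstar_algebra +
  fixes \<phi> :: "'a \<Rightarrow> 'a"
  assumes phi_closed: "v \<in> A \<Longrightarrow> \<phi> v \<in> A"
    and phi_add: "v \<in> A \<Longrightarrow> w \<in> A \<Longrightarrow> \<phi> (v + w) = \<phi> v + \<phi> w"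
    and phi_scale: "v \<in> A \<Longrightarrow> \<phi> (z *s v) = z *s \<phi> v"
    and phi_star: "v \<in> A \<Longrightarrow> star (\<phi> v) = \<phi> (star v)"

locale resolvent_limit = star_linear_map +
  fixes r :: real and p \<zeta> :: 'a and S :: "real \<Rightarrow> 'a"
  assumes p: "p \<in> A"
    and S: "\<And>z. z > r \<Longrightarrow> norm_lim (\<lambda>n. \<Sum>j<n. complex_of_real (1 / z ^ (j + 1)) *s (\<phi> ^^ j) p) (S z) sequentially"
    and zeta: "\<zeta> \<in> A" "((\<lambda>z. N (complex_of_real (z - r) *s S z - \<zeta>)) \<longlongrightarrow> 0) (at_right r)"
begin

lemma funpow_closed: "(\<phi> ^^ j) p \<in> A"
  by (induction j) (auto simp: p phi_closed)

text \<open>\<open>S z\<close> is controlled only for \<open>z > r\<close>. The value 0 elsewhere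
  keeps all values in \<open>A\<close>, as \<open>norm_lim\<close> demands, and does not affect the
  limit from the right.\<close>

definition resolvent :: "real \<Rightarrow> 'a" where
  "resolvent z = (if z > r then complex_of_real (z - r) *s S z else 0)"

lemma resolvent_lim: "norm_lim resolvent \<zeta> (at_right r)"
proof -
  have "\<forall>\<^sub>F z in at_right r. N (complex_of_real (z - r) *s S z - \<zeta>) = N (resolvent z - \<zeta>)"
    using eventually_at_right_less[of r] by eventually_elim (simp add: resolvent_def)
  then have "((\<lambda>z. N (resolvent z - \<zeta>)) \<longlongrightarrow> 0) (at_right r)"
    using zeta(2) by (rule Lim_transform_eventually[rotated])
  moreover have "resolvent z \<in> A" for z using norm_limD(1)[OF S] by (auto simp: resolvent_def)
  ultimately show ?thesis using zeta(1) by (simp add: norm_lim_def)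
qed

text \<open>Two limits lead to \<open>\<zeta>\<close>: that of the partial sums and that of
  \<open>z\<close> decreasing to \<open>r\<close>. All coefficients are real, and closure under real
  scalars is what the set of self-adjoint elements offers.\<close>

lemma limit_in_closed:
  assumes W: "norm_closed W" "0 \<in> W" "\<And>v w. v \<in> W \<Longrightarrow> w \<in> W \<Longrightarrow> v + w \<in> W"
      "\<And>t v. v \<in> W \<Longrightarrow> complex_of_real t *s v \<in> W"
    and iter: "\<And>j. (\<phi> ^^ j) p \<in> W"
  shows "\<zeta> \<in> W"
proof -
  have "(\<Sum>j<n. complex_of_real (1 / z ^ (j + 1)) *s (\<phi> ^^ j) p) \<in> W" for n :: nat and z
  proof (induction n)
    case (Suc n)
    show ?case unfolding sum.lessThan_Suc by (rule W(3)[OF Suc.IH W(4)[OF iter]])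
  qed (simp add: W(2))
  then have "S z \<in> W" if "z > r" for z
    by (rule norm_closedD[OF W(1) _ S[OF that]])
  then have RW: "resolvent z \<in> W" for z unfolding resolvent_def using W(2,4) by (simp del: of_real_diff)
  \<comment> \<open>\<open>norm_closed\<close> speaks of sequences, so \<open>r\<close> is
    approached along the points \<open>r + 1 / (n + 1)\<close>.\<close>
  have "norm_lim (\<lambda>n. resolvent (r + inverse (real (Suc n)))) \<zeta> sequentially"
  proof (rule norm_lim_compose[OF resolvent_lim])
    show "filterlim (\<lambda>n. r + inverse (real (Suc n))) (at_right r) sequentially"
    proof -
      have "(\<lambda>n. r + inverse (real (Suc n))) \<longlonglongrightarrow> r + 0"
        by (intro tendsto_add tendsto_const LIMSEQ_inverse_real_of_nat)
      then show ?thesis by (simp add: filterlim_at)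
    qed
  qed
  then show ?thesis by (rule norm_closedD[OF W(1) RW])
qed

text \<open>The resolvent identity: \<open>\<phi>\<close> shifts the index, so its value on the sum
  of \<open>n\<close> terms is \<open>z\<close> times the sum of \<open>n + 1\<close> terms, minus
  \<open>p\<close>. Both sides converge, and \<open>\<phi>\<close> is continuous.\<close>

lemma phi_resolvent:
  assumes "z > r" "z \<noteq> 0"
  shows "\<phi> (S z) = complex_of_real z *s S z - p"
proof -
  let ?T = "\<lambda>n. \<Sum>j<n. complex_of_real (1 / z ^ (j + 1)) *s (\<phi> ^^ j) p"
  have phi0: "\<phi> 0 = 0" using phi_scale[of 0 0] by simp
  have TA: "?T n \<in> A" for n by (intro sum_closed scale_closed funpow_closed)
  have shift: "\<phi> (?T n) = complex_of_real z *s ?T (Suc n) + (-1) *s p" for n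
  proof (induction n)
    case 0
    then show ?case using assms(2) phi0 by simp
  next
    case (Suc n)
    have "\<phi> (?T (Suc n)) = \<phi> (?T n) + complex_of_real (1 / z ^ (n + 1)) *s (\<phi> ^^ Suc n) p"
      using TA[of n] funpow_closed[of n] by (simp add: phi_add phi_scale)
    also have "complex_of_real (1 / z ^ (n + 1)) *s (\<phi> ^^ Suc n) p =
        complex_of_real z *s (complex_of_real (1 / z ^ (Suc n + 1)) *s (\<phi> ^^ Suc n) p)"
      using assms(2) by simp
    finally show ?case unfolding Suc.IH
      by (simp only: sum.lessThan_Suc[of _ "Suc n"] scale_right_distrib add_ac)
  qed
  have "norm_lim (\<lambda>n. ?T (Suc n)) (S z) sequentially"
    by (rule norm_lim_compose[OF S[OF assms(1)] filterlim_Suc])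
  then have "norm_lim (\<lambda>n. complex_of_real z *s ?T (Suc n) + (-1) *s p)
      (complex_of_real z *s S z + (-1) *s p) sequentially"
    by (intro norm_lim_add norm_lim_scale tendsto_const norm_lim_const p)
  moreover have "norm_lim (\<lambda>n. \<phi> (?T n)) (\<phi> (S z)) sequentially"
    by (rule norm_lim_linear[where L = \<phi>, OF phi_closed phi_add phi_scale S[OF assms(1)]])
  ultimately have "\<phi> (S z) = complex_of_real z *s S z + (-1) *s p"
    unfolding shift using norm_lim_unique by fastforce
  then show ?thesis by simp
qed

lemma phi_eigenvector: "\<phi> \<zeta> = complex_of_real r *s \<zeta>"
proof -
  \<comment> \<open>\<open>r\<close> is an arbitrary real number here; for \<open>r < 0\<close> the
    point 0 is avoided by staying between \<open>r\<close> and 0.\<close>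
  have ne: "\<forall>\<^sub>F z in at_right r. z \<noteq> 0"
  proof (cases "r < 0")
    case True
    then show ?thesis using eventually_at_right[of r 0] by (auto intro: exI[of _ "0::real"])
  next
    case False
    show ?thesis using eventually_at_right_less[of r] by eventually_elim (use False in auto)
  qed
  \<comment> \<open>Multiplying the resolvent identity by \<open>z - r\<close> leaves
    \<open>p\<close> with the coefficient \<open>r - z\<close>, which vanishes in the limit.\<close>
  have "norm_lim (\<lambda>z. complex_of_real z *s resolvent z + complex_of_real (r - z) *s p)
      (complex_of_real r *s \<zeta> + complex_of_real (r - r) *s p) (at_right r)"
    by (intro norm_lim_add norm_lim_scale resolvent_lim norm_lim_const p tendsto_intros)
  moreover have "\<forall>\<^sub>F z in at_right r. \<phi> (resolvent z) =
      complex_of_real z *s resolvent z + complex_of_real (r - z) *s p"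
    using eventually_at_right_less[of r] ne
  proof eventually_elim
    case (elim z)
    have "\<phi> (resolvent z) = complex_of_real (z - r) *s \<phi> (S z)"
      using elim norm_limD(1)[OF S[of z]] by (simp add: resolvent_def phi_scale del: of_real_diff)
    also have "\<dots> = complex_of_real z *s resolvent z + complex_of_real (r - z) *s p"
      using elim phi_resolvent[of z]
      by (simp add: resolvent_def scale_right_diff_distrib scale_left_diff_distrib right_diff_distrib mult.commute)
    finally show ?case .
  qed
  ultimately have "norm_lim (\<lambda>z. \<phi> (resolvent z)) (complex_of_real r *s \<zeta> + complex_of_real (r - r) *s p) (at_right r)"
    by (rule norm_lim_cong[OF _ phi_closed[OF norm_limD(2)[OF resolvent_lim]]])
  moreover have "norm_lim (\<lambda>z. \<phi> (resolvent z)) (\<phi> \<zeta>) (at_right r)"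
    by (rule norm_lim_linear[where L = \<phi>, OF phi_closed phi_add phi_scale resolvent_lim])
  ultimately have "\<phi> \<zeta> = complex_of_real r *s \<zeta> + complex_of_real (r - r) *s p"
    using norm_lim_unique trivial_limit_at_right_real by fastforce
  then show ?thesis by simp
qed

lemma eigenvector_commutes:
  assumes c: "c \<in> A" and comm: "\<And>j. c \<odot> (\<phi> ^^ j) p = (\<phi> ^^ j) p \<odot> c"
  shows "c \<odot> \<zeta> = \<zeta> \<odot> c"
proof -
  let ?W = "{v \<in> A. c \<odot> v = v \<odot> c}"
  have W: "subspace ?W" using c by (auto intro!: subspaceI simp: mult_add_left mult_add_right)
  obtain B where "finite B" "?W = span B" using subspace_finite_span[OF W] by auto
  then have "norm_closed ?W" using norm_closed_span[of B] by auto
  then have "\<zeta> \<in> ?W"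
    using W funpow_closed comm
    by (intro limit_in_closed) (auto simp: subspace_0 subspace_add subspace_scale mult_add_left mult_add_right c)
  then show ?thesis by simp
qed

lemma eigenvector_selfadjoint:
  assumes sa: "\<And>j. star ((\<phi> ^^ j) p) = (\<phi> ^^ j) p"
  shows "star \<zeta> = \<zeta>"
proof -
  let ?W = "{v \<in> A. star v = v}"
  have "norm_closed ?W" unfolding norm_closed_def
  proof (intro allI impI)
    fix f v assume *: "(\<forall>n::nat. f n \<in> ?W) \<and> norm_lim f v sequentially"
    then have "norm_lim (\<lambda>n. star (f n)) (star v) sequentially" by (intro norm_lim_star) simp
    then have "norm_lim f (star v) sequentially" using * by simp
    then have "star v = v" using * norm_lim_unique[of f _ sequentially] by auto
    then show "v \<in> ?W" using * norm_limD(1) by auto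
  qed
  then have "\<zeta> \<in> ?W"
    using funpow_closed sa by (intro limit_in_closed) (auto simp: star_add star_scale)
  then show ?thesis by simp
qed

end

section \<open>Bicommutants and corners\<close>

context tracial_cstar_algebra
begin

definition commutant :: "'a set \<Rightarrow> 'a set \<Rightarrow> 'a set" where
  "commutant B X = {b \<in> B. \<forall>a\<in>X. a \<odot> b = b \<odot> a}"

definition bicommutant :: "'a set \<Rightarrow> 'a \<Rightarrow> 'a set" where
  "bicommutant B a = commutant B (commutant B {a})"

definition generated :: "'a set \<Rightarrow> 'a \<Rightarrow> 'a set" where
  "generated A' a = \<Inter>{B. B \<subseteq> A' \<and> subspace B \<and> (\<forall>b\<in>B. \<forall>c\<in>B. b \<odot> c \<in> B) \<and> (\<forall>b\<in>B. star b \<in> B) \<and>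
      (\<exists>u\<in>B. \<forall>c\<in>A'. u \<odot> c = c \<and> c \<odot> u = c) \<and> a \<in> B}"

definition compression :: "'a \<Rightarrow> 'a set" where
  "compression p = {p \<odot> (a \<odot> p) |a. a \<in> A}"

text \<open>No unit is demanded, so that the summand \<open>D\<close> and compressions by
  \<open>p\<close>, whose units may differ from \<open>e\<close>, qualify.\<close>

definition star_subalgebra :: "'a set \<Rightarrow> bool" where
  "star_subalgebra B \<longleftrightarrow> B \<subseteq> A \<and> subspace B \<and> (\<forall>b\<in>B. \<forall>c\<in>B. b \<odot> c \<in> B) \<and> (\<forall>b\<in>B. star b \<in> B)"

lemma star_subalgebraD:
  assumes "star_subalgebra B"
  shows "b \<in> B \<Longrightarrow> b \<in> A" "subspace B" "b \<in> B \<Longrightarrow> c \<in> B \<Longrightarrow> b \<odot> c \<in> B" "b \<in> B \<Longrightarrow> star b \<in> B"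
    "0 \<in> B" "b \<in> B \<Longrightarrow> c \<in> B \<Longrightarrow> b + c \<in> B" "b \<in> B \<Longrightarrow> z *s b \<in> B"
  using assms by (auto simp: star_subalgebra_def subspace_0 subspace_add subspace_scale)

lemma mult_swap:
  "a \<odot> b = b \<odot> a \<Longrightarrow> a \<in> A \<Longrightarrow> b \<in> A \<Longrightarrow> c \<in> A \<Longrightarrow> a \<odot> (b \<odot> c) = b \<odot> (a \<odot> c)"
  by (simp flip: mult_assoc)

lemma star_subalgebra_commutant:
  assumes "X \<subseteq> A" "\<And>x. x \<in> X \<Longrightarrow> star x \<in> X"
  shows "star_subalgebra (commutant A X)"
  unfolding star_subalgebra_def
proof (intro conjI ballI)
  show "subspace (commutant A X)"
    using assms(1) by (auto intro!: subspaceI simp: commutant_def mult_add_left mult_add_right subsetD)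
next
  fix b c assume bc: "b \<in> commutant A X" "c \<in> commutant A X"
  then have [simp]: "b \<in> A" "c \<in> A" by (auto simp: commutant_def)
  have "a \<odot> (b \<odot> c) = b \<odot> c \<odot> a" if "a \<in> X" for a
  proof -
    have [simp]: "a \<in> A" using that assms(1) by auto
    have "a \<odot> (b \<odot> c) = b \<odot> (a \<odot> c)" using bc that by (intro mult_swap) (auto simp: commutant_def)
    also have "a \<odot> c = c \<odot> a" using bc that by (auto simp: commutant_def)
    finally show ?thesis by (simp add: mult_assoc)
  qed
  then show "b \<odot> c \<in> commutant A X" by (auto simp: commutant_def)
next
  fix b assume b: "b \<in> commutant A X"
  then have [simp]: "b \<in> A" by (auto simp: commutant_def)
  have "a \<odot> star b = star b \<odot> a" if "a \<in> X" for a
  proof -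
    have a: "a \<in> A" "star a \<in> X" using that assms by auto
    then have "star (star a \<odot> b) = star (b \<odot> star a)" using b by (auto simp: commutant_def)
    then show ?thesis using a by (simp add: star_mult)
  qed
  then show "star b \<in> commutant A X" by (auto simp: commutant_def)
qed (auto simp: commutant_def)

end

text \<open>In the application \<open>w\<close> is \<open>\<zeta>\<close> and \<open>p\<close> is
  the unit of the summand \<open>D\<close>.\<close>

locale commuting_projection = tracial_cstar_algebra +
  fixes w p :: 'a
  assumes w [simp]: "w \<in> A" "star w = w" and p: "is_proj p" and pw: "p \<odot> w = w \<odot> p"
begin

lemma p_simps [simp]: "p \<in> A" "p \<odot> p = p" "star p = p" "a \<in> A \<Longrightarrow> p \<odot> (p \<odot> a) = p \<odot> a"
  using is_projD[OF p] by (auto simp flip: mult_assoc)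

lemma mem_compression: "v \<in> compression p \<longleftrightarrow> v \<in> A \<and> p \<odot> v = v \<and> v \<odot> p = v"
  unfolding compression_def by (auto simp: mult_assoc intro!: exI[of _ v])

lemma subalgebra_commutant_w: "star_subalgebra (commutant A {w})"
  by (rule star_subalgebra_commutant) auto

lemma commutant_w: "n \<in> commutant A {w} \<longleftrightarrow> n \<in> A \<and> w \<odot> n = n \<odot> w"
  by (auto simp: commutant_def)

lemma p_commutant: "p \<in> commutant A {w}"
  using pw by (simp add: commutant_w)

lemma one_commutant: "e \<in> commutant A {w}"
  by (simp add: commutant_w)

text \<open>For \<open>n\<close> in the corner, multiplying by \<open>p \<odot> w\<close> on either
  side has the same effect as multiplying by \<open>w\<close>, so the two commutation conditions
  agree.\<close>

lemma commutant_compression: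
  "commutant (compression p) {p \<odot> w} = {p \<odot> (n \<odot> p) |n. n \<in> commutant A {w}}"
proof safe
  fix n assume "n \<in> commutant (compression p) {p \<odot> w}"
  then have n: "n \<in> A" "p \<odot> n = n" "n \<odot> p = n" "p \<odot> w \<odot> n = n \<odot> (p \<odot> w)"
    by (auto simp: commutant_def mem_compression)
  have "w \<odot> n = w \<odot> (p \<odot> n)" using n by simp
  also have "\<dots> = p \<odot> w \<odot> n" using n(1) by (simp only: pw mult_assoc w(1) p_simps(1))
  also have "\<dots> = n \<odot> (p \<odot> w)" by (rule n(4))
  also have "\<dots> = n \<odot> p \<odot> w" using n(1) by (simp add: mult_assoc)
  also have "\<dots> = n \<odot> w" using n by simp
  finally show "\<exists>n'. n = p \<odot> (n' \<odot> p) \<and> n' \<in> commutant A {w}"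
    using n by (auto simp: commutant_w intro!: exI[of _ n])
next
  fix n assume n: "n \<in> commutant A {w}"
  then have [simp]: "n \<in> A" by (simp add: commutant_w)
  have "p \<odot> (n \<odot> p) \<in> commutant A {w}"
    using star_subalgebraD(3)[OF subalgebra_commutant_w] n p_commutant by blast
  then have comm: "w \<odot> (p \<odot> (n \<odot> p)) = p \<odot> (n \<odot> p) \<odot> w" by (simp add: commutant_w)
  have "p \<odot> w \<odot> (p \<odot> (n \<odot> p)) = p \<odot> (p \<odot> (n \<odot> p) \<odot> w)" by (simp only: mult_assoc w p_simps mult_closed \<open>n \<in> A\<close> flip: comm)
  also have "\<dots> = p \<odot> (n \<odot> (p \<odot> (p \<odot> w)))" by (simp add: mult_assoc)
  also have "\<dots> = p \<odot> (n \<odot> p) \<odot> (p \<odot> w)" by (simp add: mult_assoc)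
  finally show "p \<odot> (n \<odot> p) \<in> commutant (compression p) {p \<odot> w}"
    by (simp add: commutant_def mem_compression mult_assoc)
qed

text \<open>If \<open>z\<close> is the unit of the ideal \<open>N p N\<close> of \<open>N = {w}'\<close> and \<open>z = \<Sum> n\<^sub>i p m\<^sub>i\<close>, then
  \<open>u = \<Sum> n\<^sub>i v m\<^sub>i\<close> satisfies \<open>u n p = n v\<close> for all \<open>n \<in> N\<close>, since \<open>v\<close> commutes with \<open>p N p\<close>.\<close>

lemma bicommutant_lift:
  assumes v: "v \<in> commutant (compression p) (commutant (compression p) {p \<odot> w})"
  obtains u where "u \<in> bicommutant A w" "p \<odot> u = v"
proof -
  let ?N = "commutant A {w}"
  note N = star_subalgebraD[OF subalgebra_commutant_w]
  note NA [simp] = N(1)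
  have "v \<in> compression p" and vc: "\<And>a. a \<in> commutant (compression p) {p \<odot> w} \<Longrightarrow> a \<odot> v = v \<odot> a"
    using v unfolding commutant_def[of "compression p" "commutant (compression p) {p \<odot> w}"] by blast+
  then have vA [simp]: "v \<in> A" "p \<odot> v = v" "v \<odot> p = v" by (simp_all add: mem_compression)
  have vp [simp]: "v \<odot> (p \<odot> a) = v \<odot> a" "p \<odot> (v \<odot> a) = v \<odot> a" if "a \<in> A" for a
    using that by (simp_all flip: mult_assoc)
  have vcomm: "p \<odot> (n \<odot> p) \<odot> v = v \<odot> (p \<odot> (n \<odot> p))" if "n \<in> ?N" for n
    by (rule vc) (use that in \<open>auto simp: commutant_compression\<close>)
  \<comment> \<open>As \<open>v\<close> lies in the corner, its commutation with
    \<open>p \<odot> (n \<odot> p)\<close> extends to this relation, in which each side keeps only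
    one \<open>p\<close> next to \<open>n\<close>.\<close>
  have vN: "p \<odot> (n \<odot> v) = v \<odot> (n \<odot> p)" if n: "n \<in> ?N" for n
  proof -
    have "p \<odot> (n \<odot> v) = p \<odot> (n \<odot> (p \<odot> v))" by simp
    also have "\<dots> = p \<odot> (n \<odot> p) \<odot> v" using n by (simp only: mult_assoc NA vA p_simps mult_closed)
    also have "\<dots> = v \<odot> (p \<odot> (n \<odot> p))" by (rule vcomm[OF n])
    finally show ?thesis using n by simp
  qed
  \<comment> \<open>The span \<open>J\<close> is the two-sided ideal that \<open>p\<close> generates
    in \<open>?N\<close>. Its unit \<open>z\<close> is central in \<open>?N\<close>.\<close>
  define G where "G = {n \<odot> (p \<odot> m) |n m. n \<in> ?N \<and> m \<in> ?N}"
  define J where "J = span G"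
  have GN: "G \<subseteq> ?N" unfolding G_def using N(3)[OF _ N(3)[OF p_commutant]] by blast
  have JN: "J \<subseteq> ?N" unfolding J_def by (rule span_minimal[OF GN N(2)])
  have J: "subspace J" by (simp add: J_def)
  have JA: "j \<in> A" if "j \<in> J" for j using JN that by auto
  have GA: "a \<odot> (p \<odot> b) \<in> J" if "a \<in> ?N" "b \<in> ?N" for a b
    unfolding J_def by (rule span_base) (use that in \<open>auto simp: G_def\<close>)
  have left_ideal: "n \<odot> j \<in> J" if n: "n \<in> ?N" and j: "j \<in> J" for n j
  proof -
    have "span G \<subseteq> {j \<in> A. n \<odot> j \<in> J}"
    proof (rule span_minimal)
      show "subspace {j \<in> A. n \<odot> j \<in> J}"
        using n J by (auto intro!: subspaceI simp: mult_add_right subspace_0 subspace_add subspace_scale)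
      show "G \<subseteq> {j \<in> A. n \<odot> j \<in> J}"
        using n GA[OF N(3)[OF n]] by (auto simp: G_def mult_assoc)
    qed
    then show ?thesis using j by (auto simp: J_def)
  qed
  have star_J: "star j \<in> J" if j: "j \<in> J" for j
  proof -
    have "span G \<subseteq> {j \<in> A. star j \<in> J}"
    proof (rule span_minimal)
      show "subspace {j \<in> A. star j \<in> J}"
        using J by (auto intro!: subspaceI simp: star_add star_scale subspace_0 subspace_add subspace_scale)
      show "G \<subseteq> {j \<in> A. star j \<in> J}"
        using GA[OF N(4) N(4)] by (auto simp: G_def star_mult mult_assoc)
    qed
    then show ?thesis using j by (auto simp: J_def)
  qed
  have right_ideal: "j \<odot> n \<in> J" if n: "n \<in> ?N" and j: "j \<in> J" for n j
  proof -
    have "star (star n \<odot> star j) \<in> J" using left_ideal[of "star n" "star j"] n j star_J N(4) by blast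
    then show ?thesis using n JA[OF j] by (simp add: star_mult)
  qed
  have "\<exists>z. z \<in> J \<and> is_proj z \<and> (\<forall>k\<in>J. z \<odot> k = k)"
  proof (rule unit_projection[OF J])
    show "J \<subseteq> A" using JA by auto
    show "k \<odot> star k \<in> J" if "k \<in> J" for k using that star_J JN by (intro right_ideal) auto
    show "k \<odot> (star k \<odot> j) \<in> J" if "k \<in> J" "j \<in> J" for k j
      using that star_J JN by (intro left_ideal) auto
  qed
  then obtain z where z: "z \<in> J" "is_proj z" "\<And>k. k \<in> J \<Longrightarrow> z \<odot> k = k" by auto
  note [simp] = is_projD[OF z(2)]
  have zr: "k \<odot> z = k" if k: "k \<in> J" for k
  proof -
    have "star (z \<odot> star k) = star (star k)" using z(3) star_J[OF k] by simp
    then show ?thesis using JA[OF k] by (simp add: star_mult)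
  qed
  have zc: "z \<odot> n = n \<odot> z" if n: "n \<in> ?N" for n
  proof -
    have "z \<odot> n = (z \<odot> n) \<odot> z" using zr[OF right_ideal[OF n z(1)]] by simp
    also have "\<dots> = z \<odot> (n \<odot> z)" using n by (simp add: mult_assoc)
    also have "\<dots> = n \<odot> z" using z(3)[OF left_ideal[OF n z(1)]] .
    finally show ?thesis .
  qed
  have np: "n \<odot> p \<in> J" and pn: "p \<odot> n \<in> J" if n: "n \<in> ?N" for n
  proof -
    have "n \<odot> (p \<odot> e) \<in> G" "e \<odot> (p \<odot> n) \<in> G" unfolding G_def using n one_commutant by blast+
    then show "n \<odot> p \<in> J" "p \<odot> n \<in> J" using n by (auto simp: J_def span_base)
  qed
  \<comment> \<open>It is not clear that
    \<open>n \<odot> (p \<odot> m) \<mapsto> n \<odot> (v \<odot> m)\<close> gives a well-defined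
    linear map on \<open>J\<close>. Therefore only the existence of some \<open>u\<close> with both
    identities is carried through the span; the identities are preserved by linear
    combinations.\<close>
  define P where "P j \<longleftrightarrow> j \<in> A \<and> (\<exists>u\<in>A. \<forall>n\<in>?N. u \<odot> (n \<odot> p) = j \<odot> (n \<odot> v) \<and> (p \<odot> n) \<odot> u = (v \<odot> n) \<odot> j)" for j
  have "P j" if "j \<in> J" for j
    using that unfolding J_def
  proof (induction rule: span_induct)
    case base
    show ?case
    proof (rule subspaceI)
      show "0 \<in> Collect P" by (auto simp: P_def intro!: bexI[of _ 0])
    next
      fix i j assume "i \<in> Collect P" "j \<in> Collect P"
      then obtain u u' where "i \<in> A" "j \<in> A" "u \<in> A" "u' \<in> A"
        "\<forall>n\<in>?N. u \<odot> (n \<odot> p) = i \<odot> (n \<odot> v) \<and> (p \<odot> n) \<odot> u = (v \<odot> n) \<odot> i"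
        "\<forall>n\<in>?N. u' \<odot> (n \<odot> p) = j \<odot> (n \<odot> v) \<and> (p \<odot> n) \<odot> u' = (v \<odot> n) \<odot> j" by (auto simp: P_def)
      then show "i + j \<in> Collect P"
        by (auto simp: P_def mult_add_left mult_add_right intro!: bexI[of _ "u + u'"])
    next
      fix c j assume "j \<in> Collect P"
      then obtain u where "j \<in> A" "u \<in> A"
        "\<forall>n\<in>?N. u \<odot> (n \<odot> p) = j \<odot> (n \<odot> v) \<and> (p \<odot> n) \<odot> u = (v \<odot> n) \<odot> j" by (auto simp: P_def)
      then show "c *s j \<in> Collect P" by (auto simp: P_def intro!: bexI[of _ "c *s u"])
    qed
  next
    case (step j)
    then obtain a b where j: "j = a \<odot> (p \<odot> b)" and ab: "a \<in> ?N" "b \<in> ?N" by (auto simp: G_def)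
    have "a \<odot> (v \<odot> b) \<odot> (n \<odot> p) = j \<odot> (n \<odot> v)" "(p \<odot> n) \<odot> (a \<odot> (v \<odot> b)) = (v \<odot> n) \<odot> j"
      if n: "n \<in> ?N" for n
    proof -
      have bn: "b \<odot> n \<in> ?N" and na: "n \<odot> a \<in> ?N" using N(3) ab n by auto
      have "a \<odot> (v \<odot> b) \<odot> (n \<odot> p) = a \<odot> (v \<odot> ((b \<odot> n) \<odot> p))" using ab n by (simp add: mult_assoc)
      also have "\<dots> = j \<odot> (n \<odot> v)" unfolding vN[OF bn, symmetric] j using ab n by (simp add: mult_assoc)
      finally show "a \<odot> (v \<odot> b) \<odot> (n \<odot> p) = j \<odot> (n \<odot> v)" .
      have "(p \<odot> n) \<odot> (a \<odot> (v \<odot> b)) = (p \<odot> ((n \<odot> a) \<odot> v)) \<odot> b" using ab n by (simp add: mult_assoc)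
      also have "\<dots> = (v \<odot> n) \<odot> j" unfolding vN[OF na] j using ab n by (simp add: mult_assoc)
      finally show "(p \<odot> n) \<odot> (a \<odot> (v \<odot> b)) = (v \<odot> n) \<odot> j" .
    qed
    then show ?case using ab unfolding mem_Collect_eq P_def j by (intro conjI bexI[of _ "a \<odot> (v \<odot> b)"]) auto
  qed
  from this[OF z(1)] obtain u0 where u0 [simp]: "u0 \<in> A"
    and u0l: "\<And>n. n \<in> ?N \<Longrightarrow> u0 \<odot> (n \<odot> p) = z \<odot> (n \<odot> v)"
    and u0r: "\<And>n. n \<in> ?N \<Longrightarrow> (p \<odot> n) \<odot> u0 = (v \<odot> n) \<odot> z" by (auto simp: P_def)
  \<comment> \<open>Cutting down by \<open>z\<close> gives
    \<open>z \<odot> u = u = u \<odot> z\<close>, on which the final commutation rests. The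
    identities persist because \<open>z\<close> fixes \<open>n \<odot> p\<close> and
    \<open>n \<odot> v\<close> from the left and \<open>p \<odot> n\<close> and
    \<open>v \<odot> n\<close> from the right.\<close>
  define u where "u = z \<odot> (u0 \<odot> z)"
  have uA [simp]: "u \<in> A" by (simp add: u_def)
  have znv: "z \<odot> (n \<odot> v) = n \<odot> v" "(v \<odot> n) \<odot> z = v \<odot> n" if n: "n \<in> ?N" for n
  proof -
    have "z \<odot> (n \<odot> v) = (z \<odot> (n \<odot> p)) \<odot> v" using n by (simp add: mult_assoc)
    also have "\<dots> = n \<odot> v" using z(3)[OF np[OF n]] n by (simp add: mult_assoc)
    finally show "z \<odot> (n \<odot> v) = n \<odot> v" .
    have "(v \<odot> n) \<odot> z = v \<odot> ((p \<odot> n) \<odot> z)" using n by (simp add: mult_assoc)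
    also have "\<dots> = v \<odot> n" using zr[OF pn[OF n]] n by simp
    finally show "(v \<odot> n) \<odot> z = v \<odot> n" .
  qed
  have ul: "u \<odot> (n \<odot> p) = n \<odot> v" if n: "n \<in> ?N" for n
  proof -
    have "u \<odot> (n \<odot> p) = z \<odot> (u0 \<odot> (z \<odot> (n \<odot> p)))" using n by (simp add: u_def mult_assoc)
    also have "\<dots> = z \<odot> (z \<odot> (n \<odot> v))" using z(3)[OF np[OF n]] u0l[OF n] by simp
    finally show ?thesis using znv[OF n] by simp
  qed
  have ur: "(p \<odot> n) \<odot> u = v \<odot> n" if n: "n \<in> ?N" for n
  proof -
    have "(p \<odot> n) \<odot> u = ((p \<odot> n) \<odot> z) \<odot> u0 \<odot> z" using n by (simp add: u_def mult_assoc)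
    also have "\<dots> = (v \<odot> n) \<odot> z \<odot> z" using zr[OF pn[OF n]] u0r[OF n] by simp
    finally show ?thesis using znv[OF n] by simp
  qed
  have uJ: "u \<odot> j = j \<odot> u" if "j \<in> J" for j
  proof -
    have "j \<in> {j \<in> A. u \<odot> j = j \<odot> u}"
      using that unfolding J_def
    proof (induction rule: span_induct)
      case base
      show ?case by (auto intro!: subspaceI simp: mult_add_left mult_add_right)
    next
      case (step j)
      then obtain a b where j: "j = a \<odot> (p \<odot> b)" and ab: "a \<in> ?N" "b \<in> ?N" by (auto simp: G_def)
      have "u \<odot> j = u \<odot> (a \<odot> p) \<odot> b" using ab by (simp add: j mult_assoc)
      also have "\<dots> = a \<odot> (v \<odot> b)" using ab by (simp add: ul mult_assoc)
      also have "\<dots> = a \<odot> ((p \<odot> b) \<odot> u)" using ab by (simp add: ur)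
      also have "\<dots> = j \<odot> u" using ab by (simp add: j mult_assoc)
      finally show ?case using ab by (simp add: j)
    qed
    then show ?thesis by simp
  qed
  have "u \<in> bicommutant A w"
    unfolding bicommutant_def commutant_def[of A ?N]
  proof (intro CollectI conjI ballI uA)
    fix n assume n: "n \<in> ?N"
    have uz: "u \<odot> z = u" by (simp add: u_def mult_assoc)
    have zu: "z \<odot> u = u" by (simp add: u_def flip: mult_assoc)
    \<comment> \<open>\<open>n \<odot> z\<close> lies in \<open>J\<close> and \<open>z\<close> is
      central in \<open>?N\<close>, so commutation with \<open>J\<close> yields commutation with
      \<open>?N\<close>.\<close>
    have "n \<odot> u = (n \<odot> z) \<odot> u" using n zu by (simp add: mult_assoc)
    also have "\<dots> = u \<odot> (n \<odot> z)" using uJ[OF left_ideal[OF n z(1)]] by simp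
    also have "\<dots> = (u \<odot> z) \<odot> n" using n by (simp add: mult_assoc flip: zc[OF n])
    finally show "n \<odot> u = u \<odot> n" using uz by simp
  qed
  moreover have "p \<odot> u = v" using ur[OF one_commutant] by simp
  ultimately show ?thesis using that by blast
qed

lemma bicommutant_props:
  shows "star_subalgebra (bicommutant A w)"
    and "b \<in> bicommutant A w \<Longrightarrow> c \<in> A \<Longrightarrow> w \<odot> c = c \<odot> w \<Longrightarrow> b \<odot> c = c \<odot> b"
    and "e \<in> bicommutant A w" "w \<in> bicommutant A w"
proof -
  note N = star_subalgebraD[OF subalgebra_commutant_w]
  show "star_subalgebra (bicommutant A w)"
    unfolding bicommutant_def by (rule star_subalgebra_commutant) (use N in auto)
  show "b \<in> bicommutant A w \<Longrightarrow> c \<in> A \<Longrightarrow> w \<odot> c = c \<odot> w \<Longrightarrow> b \<odot> c = c \<odot> b"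
    by (auto simp: bicommutant_def commutant_def)
  show "e \<in> bicommutant A w" "w \<in> bicommutant A w"
    by (auto simp: bicommutant_def commutant_def)
qed

text \<open>Lifting gives one inclusion. For the other, an element of the commutant in the corner
  also commutes with \<open>w\<close> in \<open>A\<close>, and therefore with
  \<open>b\<close>.\<close>

lemma bicommutant_compression:
  "bicommutant (compression p) (p \<odot> w) = (\<lambda>b. p \<odot> b) ` bicommutant A w"
proof safe
  fix v assume "v \<in> bicommutant (compression p) (p \<odot> w)"
  then obtain u where "u \<in> bicommutant A w" "p \<odot> u = v"
    using bicommutant_lift unfolding bicommutant_def by blast
  then show "v \<in> (\<lambda>b. p \<odot> b) ` bicommutant A w" by blast
next
  fix b assume b: "b \<in> bicommutant A w"
  have [simp]: "b \<in> A" using star_subalgebraD(1)[OF bicommutant_props(1)] b .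
  have pb: "b \<odot> p = p \<odot> b" using bicommutant_props(2)[OF b, of p] pw by simp
  show "p \<odot> b \<in> bicommutant (compression p) (p \<odot> w)"
    unfolding bicommutant_def commutant_def[of "compression p" "commutant (compression p) {p \<odot> w}"]
  proof (intro CollectI conjI ballI)
    show "p \<odot> b \<in> compression p" using pb by (simp add: mem_compression mult_assoc)
  next
    fix a assume "a \<in> commutant (compression p) {p \<odot> w}"
    then obtain n where a: "a = p \<odot> (n \<odot> p)" and n: "n \<in> commutant A {w}"
      unfolding commutant_compression by auto
    have [simp]: "n \<in> A" using n by (simp add: commutant_w)
    have aN: "a \<in> commutant A {w}"
      unfolding a using star_subalgebraD(3)[OF subalgebra_commutant_w] n p_commutant by blast
    have [simp]: "a \<in> A" "p \<odot> a = a" "a \<odot> p = a" by (simp_all add: a mult_assoc)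
    have ab: "b \<odot> a = a \<odot> b" using bicommutant_props(2)[OF b] aN by (auto simp: commutant_w)
    have "a \<odot> (p \<odot> b) = a \<odot> b" by (simp flip: mult_assoc)
    also have "\<dots> = (p \<odot> b) \<odot> a" by (simp add: mult_assoc ab) (simp flip: mult_assoc)
    finally show "a \<odot> (p \<odot> b) = p \<odot> b \<odot> a" .
  qed
qed

text \<open>The bicommutant is one of the algebras intersected; hence the generated algebra commutes
  with everything that commutes with \<open>w\<close>.\<close>

lemma generated_props:
  shows "star_subalgebra (generated A w)" "generated A w \<subseteq> bicommutant A w"
    and "e \<in> generated A w" "w \<in> generated A w"
proof -
  let ?F = "{B. B \<subseteq> A \<and> subspace B \<and> (\<forall>b\<in>B. \<forall>c\<in>B. b \<odot> c \<in> B) \<and> (\<forall>b\<in>B. star b \<in> B) \<and>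
      (\<exists>u\<in>B. \<forall>c\<in>A. u \<odot> c = c \<and> c \<odot> u = c) \<and> w \<in> B}"
  have bi: "bicommutant A w \<in> ?F"
    using bicommutant_props unfolding star_subalgebra_def by (auto intro!: bexI[of _ e])
  then show "generated A w \<subseteq> bicommutant A w" unfolding generated_def by blast
  have "e \<in> B" if B: "B \<in> ?F" for B
  proof -
    obtain u where u: "u \<in> B" "\<forall>c\<in>A. u \<odot> c = c \<and> c \<odot> u = c" using B by blast
    then have "u \<in> A" using B by blast
    then have "u = e" using u(2)[rule_format, of e] by simp
    then show ?thesis using u by simp
  qed
  then show "e \<in> generated A w" unfolding generated_def by blast
  show "w \<in> generated A w" unfolding generated_def by blast
  have "generated A w \<subseteq> A" using bi unfolding generated_def by blast
  moreover have "subspace (generated A w)" unfolding generated_def by (rule subspace_Inter) blast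
  ultimately show "star_subalgebra (generated A w)"
    unfolding star_subalgebra_def by (auto simp: generated_def)
qed

lemma star_subalgebra_compress:
  assumes B: "star_subalgebra B" and comm: "\<And>b. b \<in> B \<Longrightarrow> p \<odot> b = b \<odot> p"
  shows "star_subalgebra ((\<lambda>b. p \<odot> b) ` B)" "(\<lambda>b. p \<odot> b) ` B \<subseteq> compression p"
proof -
  note D = star_subalgebraD[OF B]
  note [simp] = D(1)
  show "(\<lambda>b. p \<odot> b) ` B \<subseteq> compression p"
    using comm by (auto simp: mem_compression mult_assoc simp flip: comm)
  show "star_subalgebra ((\<lambda>b. p \<odot> b) ` B)"
    unfolding star_subalgebra_def
  proof (intro conjI ballI)
    show "subspace ((\<lambda>b. p \<odot> b) ` B)"
    proof (rule subspaceI)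
      show "0 \<in> (\<lambda>b. p \<odot> b) ` B" using D(5) by (auto intro!: image_eqI[of _ _ 0])
      show "x + y \<in> (\<lambda>b. p \<odot> b) ` B" if "x \<in> (\<lambda>b. p \<odot> b) ` B" "y \<in> (\<lambda>b. p \<odot> b) ` B" for x y
        using that D(6) by (auto simp flip: mult_add_right)
      show "c *s x \<in> (\<lambda>b. p \<odot> b) ` B" if "x \<in> (\<lambda>b. p \<odot> b) ` B" for c x
        using that D(7) by (auto simp flip: mult_scale_right simp del: mult_scale_right)
    qed
  next
    fix x y assume "x \<in> (\<lambda>b. p \<odot> b) ` B" "y \<in> (\<lambda>b. p \<odot> b) ` B"
    then obtain a b where ab: "x = p \<odot> a" "y = p \<odot> b" "a \<in> B" "b \<in> B" by auto
    have "x \<odot> y = p \<odot> ((a \<odot> p) \<odot> b)" using ab by (simp add: mult_assoc)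
    also have "\<dots> = p \<odot> (a \<odot> b)" using ab by (simp add: mult_assoc flip: comm)
    finally show "x \<odot> y \<in> (\<lambda>b. p \<odot> b) ` B" using ab D(3) by auto
  next
    fix x assume "x \<in> (\<lambda>b. p \<odot> b) ` B"
    then obtain a where "x = p \<odot> a" "a \<in> B" by auto
    moreover from this have "star x = p \<odot> star a" using comm[of "star a"] D(4) by (simp add: star_mult)
    ultimately show "star x \<in> (\<lambda>b. p \<odot> b) ` B" using D(4) by auto
  qed auto
qed

lemma generated_compression:
  "generated (compression p) (p \<odot> w) = (\<lambda>b. p \<odot> b) ` generated A w"
proof
  note D = star_subalgebraD[OF generated_props(1)]
  have comm: "p \<odot> b = b \<odot> p" if "b \<in> generated A w" for b
    by (rule bicommutant_props(2)[OF subsetD[OF generated_props(2) that] p_simps(1) pw[symmetric], symmetric])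
  have "(\<lambda>b. p \<odot> b) ` generated A w \<in>
    {B. B \<subseteq> compression p \<and> subspace B \<and> (\<forall>b\<in>B. \<forall>c\<in>B. b \<odot> c \<in> B) \<and> (\<forall>b\<in>B. star b \<in> B) \<and>
      (\<exists>u\<in>B. \<forall>c\<in>compression p. u \<odot> c = c \<and> c \<odot> u = c) \<and> p \<odot> w \<in> B}"
  proof (intro CollectI conjI)
    show "\<exists>u\<in>(\<lambda>b. p \<odot> b) ` generated A w. \<forall>c\<in>compression p. u \<odot> c = c \<and> c \<odot> u = c"
    proof (rule bexI)
      show "\<forall>c\<in>compression p. p \<odot> c = c \<and> c \<odot> p = c" by (simp add: mem_compression)
      show "p \<in> (\<lambda>b. p \<odot> b) ` generated A w" using generated_props(3) by (rule rev_image_eqI) simp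
    qed
    show "p \<odot> w \<in> (\<lambda>b. p \<odot> b) ` generated A w" using generated_props(4) by (rule imageI)
    note sub = star_subalgebra_compress[OF generated_props(1) comm]
    show "(\<lambda>b. p \<odot> b) ` generated A w \<subseteq> compression p" by (rule sub(2))
    show "subspace ((\<lambda>b. p \<odot> b) ` generated A w)" by (rule star_subalgebraD(2)[OF sub(1)])
    show "\<forall>b\<in>(\<lambda>b. p \<odot> b) ` generated A w. \<forall>c\<in>(\<lambda>b. p \<odot> b) ` generated A w. b \<odot> c \<in> (\<lambda>b. p \<odot> b) ` generated A w"
      by (intro ballI star_subalgebraD(3)[OF sub(1)])
    show "\<forall>b\<in>(\<lambda>b. p \<odot> b) ` generated A w. star b \<in> (\<lambda>b. p \<odot> b) ` generated A w"
      by (intro ballI star_subalgebraD(4)[OF sub(1)])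
  qed
  then show "generated (compression p) (p \<odot> w) \<subseteq> (\<lambda>b. p \<odot> b) ` generated A w"
    unfolding generated_def by (rule Inter_lower)
  show "(\<lambda>b. p \<odot> b) ` generated A w \<subseteq> generated (compression p) (p \<odot> w)"
  proof safe
    fix b assume b: "b \<in> generated A w"
    show "p \<odot> b \<in> generated (compression p) (p \<odot> w)"
      unfolding generated_def
    proof
      fix B assume "B \<in> {B. B \<subseteq> compression p \<and> subspace B \<and> (\<forall>b\<in>B. \<forall>c\<in>B. b \<odot> c \<in> B) \<and> (\<forall>b\<in>B. star b \<in> B) \<and>
        (\<exists>u\<in>B. \<forall>c\<in>compression p. u \<odot> c = c \<and> c \<odot> u = c) \<and> p \<odot> w \<in> B}"
      then have B: "B \<subseteq> compression p" "subspace B" "\<forall>b\<in>B. \<forall>c\<in>B. b \<odot> c \<in> B" "\<forall>b\<in>B. star b \<in> B"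
        "\<exists>u\<in>B. \<forall>c\<in>compression p. u \<odot> c = c \<and> c \<odot> u = c" "p \<odot> w \<in> B" by simp_all
      have "p \<in> compression p" by (simp add: mem_compression)
      obtain u where u: "u \<in> B" "\<forall>c\<in>compression p. u \<odot> c = c \<and> c \<odot> u = c" using B(5) by blast
      have "u \<in> compression p" using u(1) B(1) by blast
      then have "u \<odot> p = u" by (simp add: mem_compression)
      moreover have "u \<odot> p = p" using u(2) \<open>p \<in> compression p\<close> by blast
      ultimately have pB: "p \<in> B" using u(1) by simp
      \<comment> \<open>\<open>H\<close> is the preimage of \<open>B\<close> under compression,
        taken among the elements that commute with \<open>p\<close>, where compression is
        multiplicative. It is one of the algebras whose intersection is
        \<open>generated A w\<close>.\<close>
      define H where "H = {h \<in> A. p \<odot> h = h \<odot> p \<and> p \<odot> h \<in> B}"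
      have "H \<in> {B. B \<subseteq> A \<and> subspace B \<and> (\<forall>b\<in>B. \<forall>c\<in>B. b \<odot> c \<in> B) \<and> (\<forall>b\<in>B. star b \<in> B) \<and>
        (\<exists>u\<in>B. \<forall>c\<in>A. u \<odot> c = c \<and> c \<odot> u = c) \<and> w \<in> B}"
      proof (intro CollectI conjI ballI)
        show "subspace H"
          using B(2) by (auto intro!: subspaceI simp: H_def mult_add_left mult_add_right subspace_0 subspace_add subspace_scale)
        show "\<exists>u\<in>H. \<forall>c\<in>A. u \<odot> c = c \<and> c \<odot> u = c" using pB by (intro bexI[of _ e]) (simp_all add: H_def)
        show "w \<in> H" using pw B(6) by (auto simp: H_def)
      next
        fix h k assume hk: "h \<in> H" "k \<in> H"
        then have [simp]: "h \<in> A" "k \<in> A" and hp: "p \<odot> h = h \<odot> p" and kp: "p \<odot> k = k \<odot> p" by (auto simp: H_def)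
        have "p \<odot> (h \<odot> k) = h \<odot> k \<odot> p"
          using mult_swap[OF hp, of k] kp by (simp add: mult_assoc)
        moreover have "(p \<odot> h) \<odot> (p \<odot> k) = p \<odot> (h \<odot> k)"
          using mult_swap[OF hp, of "p \<odot> k"] mult_swap[OF hp, of k] by (simp add: mult_assoc)
        moreover have "(p \<odot> h) \<odot> (p \<odot> k) \<in> B" using hk B(3) unfolding H_def by blast
        ultimately show "h \<odot> k \<in> H" unfolding H_def by simp
      next
        fix h assume h: "h \<in> H"
        then have [simp]: "h \<in> A" and hp: "p \<odot> h = h \<odot> p" by (auto simp: H_def)
        have 1: "star (p \<odot> h) = star h \<odot> p" by (simp add: star_mult)
        have 2: "star (p \<odot> h) = p \<odot> star h" by (simp add: hp star_mult)
        have "star (p \<odot> h) \<in> B" using h B(4) unfolding H_def by blast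
        then show "star h \<in> H" using 1 2 unfolding H_def by simp
      qed (auto simp: H_def)
      then have "generated A w \<subseteq> H" unfolding generated_def by (rule Inter_lower)
      then show "p \<odot> b \<in> B" using b by (auto simp: H_def)
    qed
  qed
qed

end

section \<open>Tensor products with matrix algebras\<close>

context tracial_cstar_algebra
begin

definition subalg :: "'a set \<Rightarrow> 'a star_algebra" where
  "subalg B = \<lparr>sa_carrier = B, sa_add = (+), sa_scale = scale, sa_mult = mult, sa_star = star\<rparr>"

lemma subalg_sel [simp]:
  "sa_carrier (subalg B) = B" "sa_add (subalg B) = (+)" "sa_scale (subalg B) = scale"
  "sa_mult (subalg B) = mult" "sa_star (subalg B) = star"
  by (simp_all add: subalg_def)

definition subalg_product :: "'a set \<Rightarrow> 'a set \<Rightarrow> 'a set" where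
  "subalg_product B D = span {a \<odot> b |a b. a \<in> B \<and> b \<in> D}"

end

definition unit_mat :: "nat \<Rightarrow> nat \<Rightarrow> nat \<Rightarrow> complex mat" where
  "unit_mat n i j = mat n n (\<lambda>(a, b). if a = i \<and> b = j then 1 else 0)"

lemma unit_mat_carrier [simp]: "unit_mat n i j \<in> carrier_mat n n"
  by (simp add: unit_mat_def)

lemma unit_mat_index: "a < n \<Longrightarrow> b < n \<Longrightarrow> unit_mat n i j $$ (a, b) = (if a = i \<and> b = j then 1 else 0)"
  by (simp add: unit_mat_def)

lemma unit_mat_mult:
  assumes M: "M \<in> carrier_mat n n" and "i < n" "j < n" "k < n" "l < n"
  shows "unit_mat n l i * M * unit_mat n j k = M $$ (i, j) \<cdot>\<^sub>m unit_mat n l k"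
proof (rule eq_matI)
  fix a b assume "a < dim_row (M $$ (i, j) \<cdot>\<^sub>m unit_mat n l k)" "b < dim_col (M $$ (i, j) \<cdot>\<^sub>m unit_mat n l k)"
  then have ab: "a < n" "b < n" by (simp_all add: unit_mat_def)
  have left: "(unit_mat n l i * M) $$ (a, c) = (if a = l then M $$ (i, c) else 0)" if c: "c < n" for c
  proof -
    have "(unit_mat n l i * M) $$ (a, c) = (\<Sum>t = 0..<n. unit_mat n l i $$ (a, t) * M $$ (t, c))"
      using M ab c by (simp add: scalar_prod_def unit_mat_def)
    also have "\<dots> = (\<Sum>t = 0..<n. if t = i then (if a = l then M $$ (i, c) else 0) else 0)"
      using ab by (intro sum.cong) (auto simp: unit_mat_def)
    finally show ?thesis using \<open>i < n\<close> by simp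
  qed
  have "(unit_mat n l i * M * unit_mat n j k) $$ (a, b) =
      (\<Sum>t = 0..<n. (unit_mat n l i * M) $$ (a, t) * unit_mat n j k $$ (t, b))"
    using M ab by (simp add: scalar_prod_def unit_mat_def)
  also have "\<dots> = (\<Sum>t = 0..<n. if t = j then (if a = l then M $$ (i, j) else 0) * (if b = k then 1 else 0) else 0)"
    using ab by (intro sum.cong) (auto simp: left unit_mat_index)
  also have "\<dots> = (M $$ (i, j) \<cdot>\<^sub>m unit_mat n l k) $$ (a, b)"
    using ab \<open>j < n\<close> by (simp add: unit_mat_def)
  finally show "(unit_mat n l i * M * unit_mat n j k) $$ (a, b) = (M $$ (i, j) \<cdot>\<^sub>m unit_mat n l k) $$ (a, b)" .
qed (use M in \<open>auto simp: unit_mat_def\<close>)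

locale matrix_subalgebra = tracial_cstar_algebra +
  fixes D :: "'a set" and n :: nat and h :: "'a \<Rightarrow> complex mat"
  assumes DA: "D \<subseteq> A" and D: "subspace D"
    and D_mult: "\<And>a b. a \<in> D \<Longrightarrow> b \<in> D \<Longrightarrow> a \<odot> b \<in> D"
    and D_star: "\<And>a. a \<in> D \<Longrightarrow> star a \<in> D"
    and h_bij: "bij_betw h D (carrier_mat n n)"
    and h_add: "\<And>a b. a \<in> D \<Longrightarrow> b \<in> D \<Longrightarrow> h (a + b) = h a + h b"
    and h_mult: "\<And>a b. a \<in> D \<Longrightarrow> b \<in> D \<Longrightarrow> h (a \<odot> b) = h a * h b"
    and h_scale: "\<And>a z. a \<in> D \<Longrightarrow> h (z *s a) = z \<cdot>\<^sub>m h a"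
    and h_star: "\<And>a. a \<in> D \<Longrightarrow> h (star a) = map_mat cnj (transpose_mat (h a))"
begin

lemma DA' [simp]: "d \<in> D \<Longrightarrow> d \<in> A"
  using DA by auto

lemma h_carrier [simp]: "d \<in> D \<Longrightarrow> h d \<in> carrier_mat n n"
  using h_bij by (auto simp: bij_betw_def)

lemma h_inj: "a \<in> D \<Longrightarrow> b \<in> D \<Longrightarrow> h a = h b \<Longrightarrow> a = b"
  using h_bij by (auto simp: bij_betw_def inj_on_def)

definition h_inv :: "complex mat \<Rightarrow> 'a" where "h_inv = inv_into D h"

lemma h_inv: "M \<in> carrier_mat n n \<Longrightarrow> h_inv M \<in> D" "M \<in> carrier_mat n n \<Longrightarrow> h (h_inv M) = M"
  using h_bij unfolding h_inv_def bij_betw_def by (auto intro: inv_into_into f_inv_into_f)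

definition mu :: "nat \<Rightarrow> nat \<Rightarrow> 'a" where "mu i j = h_inv (unit_mat n i j)"

lemma mu_closed [simp]: "mu i j \<in> D"
  by (simp add: mu_def h_inv)

lemma h_mu [simp]: "h (mu i j) = unit_mat n i j"
  by (simp add: mu_def h_inv)

lemma mu_mult:
  assumes "d \<in> D" "i < n" "j < n" "k < n" "l < n"
  shows "mu l i \<odot> d \<odot> mu j k = (h d $$ (i, j)) *s mu l k"
proof (rule h_inj)
  show "h (mu l i \<odot> d \<odot> mu j k) = h ((h d $$ (i, j)) *s mu l k)"
    using assms unit_mat_mult[of "h d" n i j k l] by (simp add: h_mult h_scale D_mult)
qed (use assms subspace_scale[OF D] in \<open>auto intro!: D_mult\<close>)

definition unit_D :: 'a where "unit_D = h_inv (1\<^sub>m n)"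

lemma unit_D: "unit_D \<in> D" "d \<in> D \<Longrightarrow> unit_D \<odot> d = d" "d \<in> D \<Longrightarrow> d \<odot> unit_D = d" "is_proj unit_D"
proof -
  show U: "unit_D \<in> D" by (simp add: unit_D_def h_inv)
  have hU: "h unit_D = 1\<^sub>m n" by (simp add: unit_D_def h_inv)
  show l: "unit_D \<odot> d = d" if d: "d \<in> D" for d
    by (rule h_inj)
      (use d U left_mult_one_mat[OF h_carrier[OF d]] right_mult_one_mat[OF h_carrier[OF d]]
        in \<open>auto simp: h_mult hU D_mult\<close>)
  show "d \<odot> unit_D = d" if d: "d \<in> D" for d
    by (rule h_inj)
      (use d U left_mult_one_mat[OF h_carrier[OF d]] right_mult_one_mat[OF h_carrier[OF d]]
        in \<open>auto simp: h_mult hU D_mult\<close>)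
  have "star unit_D = unit_D"
  proof (rule h_inj)
    show "h (star unit_D) = h unit_D"
      unfolding h_star[OF U] hU by (rule eq_matI) (auto simp: one_mat_def)
  qed (use U D_star in auto)
  then show "is_proj unit_D" using U l[OF U] by (simp add: is_proj_def)
qed

text \<open>Under \<open>h\<close>, the sum of the first \<open>k\<close> diagonal matrix units is
  the diagonal matrix with \<open>k\<close> leading ones.\<close>

lemma unit_D_sum: "unit_D = (\<Sum>i<n. mu i i)"
proof -
  have "(\<Sum>i<k. mu i i) \<in> D \<and> h (\<Sum>i<k. mu i i) = mat n n (\<lambda>(a, b). if a = b \<and> a < k then 1 else 0)" for k
  proof (induction k)
    case 0
    have "h 0 = 0 \<cdot>\<^sub>m h 0" using h_scale[of 0 0] subspace_0[OF D] by simp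
    also have "\<dots> = mat n n (\<lambda>(a, b). if a = b \<and> a < 0 then 1 else 0)"
      using h_carrier[OF subspace_0[OF D]] by (intro eq_matI) auto
    finally show ?case using subspace_0[OF D] by (simp add: case_prod_unfold)
  next
    case (Suc k)
    then have "h (\<Sum>i<Suc k. mu i i) = mat n n (\<lambda>(a, b). if a = b \<and> a < k then 1 else 0) + unit_mat n k k"
      by (simp add: h_add)
    also have "\<dots> = mat n n (\<lambda>(a, b). if a = b \<and> a < Suc k then 1 else 0)"
      by (rule eq_matI) (auto simp: unit_mat_def)
    finally show ?case using Suc subspace_add[OF D] by simp
  qed
  from this[of n] have S: "(\<Sum>i<n. mu i i) \<in> D"
    and hS: "h (\<Sum>i<n. mu i i) = mat n n (\<lambda>(a, b). if a = b \<and> a < n then 1 else 0)" by auto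
  have "mat n n (\<lambda>(a, b). if a = b \<and> a < n then 1 else 0) = (1\<^sub>m n :: complex mat)"
    by (rule eq_matI) auto
  then show ?thesis using S hS unit_D(1) by (intro h_inj) (simp_all add: unit_D_def h_inv)
qed

lemma expand: assumes d: "d \<in> D" shows "d = (\<Sum>i<n. \<Sum>j<n. (h d $$ (i, j)) *s mu i j)"
proof -
  have "d = unit_D \<odot> d \<odot> unit_D" using unit_D d by simp
  also have "\<dots> = (\<Sum>i<n. \<Sum>j<n. mu i i \<odot> d \<odot> mu j j)"
    unfolding unit_D_sum using d by (simp add: mult_sum_left mult_sum_right sum_closed) (rule sum.swap)
  also have "\<dots> = (\<Sum>i<n. \<Sum>j<n. (h d $$ (i, j)) *s mu i j)"
    using d by (intro sum.cong refl) (simp_all add: mu_mult)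
  finally show ?thesis .
qed

end

locale commuting_subalgebras = matrix_subalgebra +
  fixes B :: "'a set"
  assumes BA: "B \<subseteq> A" and B: "subspace B"
    and B_mult: "\<And>a b. a \<in> B \<Longrightarrow> b \<in> B \<Longrightarrow> a \<odot> b \<in> B"
    and B_star: "\<And>a. a \<in> B \<Longrightarrow> star a \<in> B"
    and BD: "\<And>b d. b \<in> B \<Longrightarrow> d \<in> D \<Longrightarrow> b \<odot> d = d \<odot> b"
    and B_unit: "\<And>b. b \<in> B \<Longrightarrow> unit_D \<odot> b = b"
begin

lemma BA' [simp]: "b \<in> B \<Longrightarrow> b \<in> A"
  using BA by auto

lemma B_ops: "0 \<in> B" "a \<in> B \<Longrightarrow> b \<in> B \<Longrightarrow> a + b \<in> B" "a \<in> B \<Longrightarrow> z *s a \<in> B"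
  and D_ops: "0 \<in> D" "c \<in> D \<Longrightarrow> d \<in> D \<Longrightarrow> c + d \<in> D" "c \<in> D \<Longrightarrow> z *s c \<in> D"
  using B D by (auto intro: subspace_0 subspace_add subspace_scale)

abbreviation L :: "('a \<times> 'a) list set" where "L \<equiv> lists (B \<times> D)"

abbreviation teq :: "('a \<times> 'a) list \<Rightarrow> ('a \<times> 'a) list \<Rightarrow> bool" (infix "\<approx>" 50) where
  "t \<approx> u \<equiv> tensor_eq (subalg B) (subalg D) t u"

text \<open>The multiplication map on formal sums, whose fibres will turn out to be the
  tensors.\<close>

definition ev :: "('a \<times> 'a) list \<Rightarrow> 'a" where
  "ev t = sum_list (map (\<lambda>(a, d). a \<odot> d) t)"

lemma ev_simps [simp]: "ev [] = 0" "ev ((a, d) # t) = a \<odot> d + ev t" "ev (t @ u) = ev t + ev u"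
  by (simp_all add: ev_def)

lemma ev_closed [simp]: "t \<in> L \<Longrightarrow> ev t \<in> A"
  by (induction t) auto

lemma tensor_eq_sound: "t \<approx> u \<Longrightarrow> t \<in> L \<and> u \<in> L \<and> ev t = ev u"
proof (induction rule: tensor_eq.induct)
  case (comm t u)
  then show ?case by (simp add: add.commute)
qed (auto simp: mult_add_left mult_add_right B_ops D_ops)

lemma teq_refl: "t \<in> L \<Longrightarrow> t \<approx> t"
  by (rule tensor_eq.refl) simp

lemma teq_trans [trans]: "t \<approx> u \<Longrightarrow> u \<approx> v \<Longrightarrow> t \<approx> v"
  by (rule tensor_eq.trans)

lemma teq_Cons: "[x] \<approx> u \<Longrightarrow> t \<approx> v \<Longrightarrow> x # t \<approx> u @ v"
  using tensor_eq.cong[of "subalg B" "subalg D" "[x]" u t v] by simp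

lemma teq_swap: "t \<in> L \<Longrightarrow> u \<in> L \<Longrightarrow> t @ u \<approx> u @ t"
  by (rule tensor_eq.comm) auto

lemma teq_zero: "d \<in> D \<Longrightarrow> [(0, d)] \<approx> []"
  using tensor_eq.zero[of 0 "subalg B" d "subalg D"] B_ops by simp

text \<open>Normal forms are added coefficientwise; in the induction step commutativity of formal
  sums moves the second new term past the first list.\<close>

lemma teq_map_add:
  assumes "\<And>q. q \<in> set qs \<Longrightarrow> f q \<in> B" "\<And>q. q \<in> set qs \<Longrightarrow> f' q \<in> B" "\<And>q. q \<in> set qs \<Longrightarrow> k q \<in> D"
  shows "map (\<lambda>q. (f q + f' q, k q)) qs \<approx> map (\<lambda>q. (f q, k q)) qs @ map (\<lambda>q. (f' q, k q)) qs"
  using assms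
proof (induction qs)
  case Nil
  then show ?case by (simp add: teq_refl)
next
  case (Cons q qs)
  let ?X = "map (\<lambda>q. (f q, k q)) qs" and ?Y = "map (\<lambda>q. (f' q, k q)) qs"
  have X: "?X \<in> L" and Y: "?Y \<in> L" using Cons.prems by auto
  have q: "f q \<in> B" "f' q \<in> B" "k q \<in> D" using Cons.prems by auto
  have "[(f q + f' q, k q)] \<approx> [(f q, k q), (f' q, k q)]"
    using tensor_eq.add_left[of "f q" "subalg B" "f' q" "k q" "subalg D"] q by simp
  then have "map (\<lambda>q. (f q + f' q, k q)) (q # qs) \<approx> [(f q, k q), (f' q, k q)] @ (?X @ ?Y)"
    unfolding list.map by (rule teq_Cons) (use Cons in auto)
  also have "[(f q, k q), (f' q, k q)] @ (?X @ ?Y) = (f q, k q) # ([(f' q, k q)] @ ?X) @ ?Y" by simp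
  also have "\<dots> \<approx> [(f q, k q)] @ ((?X @ [(f' q, k q)]) @ ?Y)"
  proof (rule teq_Cons)
    show "[(f q, k q)] \<approx> [(f q, k q)]" using q by (intro teq_refl) auto
    have "[(f' q, k q)] @ ?X \<approx> ?X @ [(f' q, k q)]" using X q by (intro teq_swap) auto
    then show "([(f' q, k q)] @ ?X) @ ?Y \<approx> (?X @ [(f' q, k q)]) @ ?Y"
      using teq_refl[OF Y] by (rule tensor_eq.cong)
  qed
  finally show ?case by simp
qed

lemma teq_sum_right:
  assumes "a \<in> B" "\<And>q. q \<in> set qs \<Longrightarrow> k q \<in> D"
  shows "[(a, sum_list (map k qs))] \<approx> map (\<lambda>q. (a, k q)) qs"
  using assms(2)
proof (induction qs)
  case Nil
  \<comment> \<open>The scalar 0 moves from the second factor to the first, where the rule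
    \<open>zero\<close> applies.\<close>
  have "[(a, 0)] \<approx> [(0, 0)]"
    using tensor_eq.sym[OF tensor_eq.scale[of a "subalg B" 0 "subalg D" 0]] assms(1) D_ops by simp
  also have "\<dots> \<approx> []" by (rule teq_zero) (rule D_ops)
  finally show ?case by simp
next
  case (Cons q qs)
  have kq: "k q \<in> D" and rest: "sum_list (map k qs) \<in> D"
    using Cons.prems by (auto intro: D_ops) (induction qs, auto intro: D_ops)
  have "[(a, k q + sum_list (map k qs))] \<approx> [(a, k q), (a, sum_list (map k qs))]"
    using tensor_eq.add_right[of a "subalg B" "k q" "subalg D" "sum_list (map k qs)"] assms(1) kq rest by simp
  also have "\<dots> \<approx> [(a, k q)] @ map (\<lambda>q. (a, k q)) qs"
    by (rule teq_Cons) (use assms(1) kq Cons in \<open>auto intro: teq_refl\<close>)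
  finally show ?case by simp
qed

definition idx :: "(nat \<times> nat) list" where "idx = List.product [0..<n] [0..<n]"

lemma idx_iff: "(i, j) \<in> set idx \<longleftrightarrow> i < n \<and> j < n"
  by (auto simp: idx_def)

lemma sum_idx: "sum_list (map (\<lambda>(i, j). f i j) idx) = (\<Sum>i<n. \<Sum>j<n. f i j)" for f :: "nat \<Rightarrow> nat \<Rightarrow> 'a"
proof -
  have "distinct idx" by (simp add: idx_def distinct_product)
  then have "sum_list (map (\<lambda>(i, j). f i j) idx) = (\<Sum>(i, j)\<in>set idx. f i j)"
    by (rule sum_list_distinct_conv_sum_set)
  also have "set idx = {..<n} \<times> {..<n}" by (auto simp: idx_def)
  finally show ?thesis by (simp add: sum.cartesian_product)
qed

text \<open>The coefficient in \<open>B\<close> of the matrix unit \<open>mu i j\<close>, once all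
  second components are expanded in matrix units.\<close>

primrec coeff :: "('a \<times> 'a) list \<Rightarrow> nat \<Rightarrow> nat \<Rightarrow> 'a" where
  "coeff [] i j = 0"
| "coeff (x # t) i j = (h (snd x) $$ (i, j)) *s fst x + coeff t i j"

lemma coeff_closed: "t \<in> L \<Longrightarrow> coeff t i j \<in> B"
  by (induction t) (auto intro!: B_ops)

text \<open>On \<open>a \<odot> d\<close> the right side is \<open>h d $$ (i, j)\<close> times
  \<open>unit_D \<odot> a\<close>, because \<open>B\<close> commutes with \<open>D\<close>, and
  \<open>unit_D\<close> fixes \<open>a\<close>. So the coefficients depend on \<open>t\<close> only
  through \<open>ev t\<close>, which is the injectivity of multiplication.\<close>

lemma coeff_ev:
  assumes "t \<in> L" "i < n" "j < n"
  shows "coeff t i j = (\<Sum>l<n. mu l i \<odot> ev t \<odot> mu j l)"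
  using assms(1)
proof (induction t)
  case Nil
  then show ?case by simp
next
  case (Cons x t)
  then obtain a d where x: "x = (a, d)" "a \<in> B" "d \<in> D" and t: "t \<in> L" by auto
  have "mu l i \<odot> (a \<odot> d) \<odot> mu j l = (h d $$ (i, j)) *s (mu l l \<odot> a)" if "l < n" for l
  proof -
    have "mu l i \<odot> (a \<odot> d) \<odot> mu j l = (mu l i \<odot> a) \<odot> (d \<odot> mu j l)" using x by (simp add: mult_assoc)
    also have "mu l i \<odot> a = a \<odot> mu l i" using BD[OF x(2)] by simp
    also have "a \<odot> mu l i \<odot> (d \<odot> mu j l) = a \<odot> (mu l i \<odot> d \<odot> mu j l)" using x by (simp add: mult_assoc)
    also have "\<dots> = (h d $$ (i, j)) *s (a \<odot> mu l l)" using x assms that by (simp add: mu_mult)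
    finally show ?thesis using BD[OF x(2)] by simp
  qed
  then have "(\<Sum>l<n. mu l i \<odot> (a \<odot> d) \<odot> mu j l) = (\<Sum>l<n. (h d $$ (i, j)) *s (mu l l \<odot> a))" by simp
  also have "\<dots> = (h d $$ (i, j)) *s (unit_D \<odot> a)"
    unfolding unit_D_sum using x by (simp add: mult_sum_left scale_sum_right)
  finally have "(\<Sum>l<n. mu l i \<odot> (a \<odot> d) \<odot> mu j l) = (h d $$ (i, j)) *s a" using B_unit x by simp
  then show ?case
    using x t Cons.IH by (simp add: mult_add_left mult_add_right sum.distrib)
qed

text \<open>Second components are expanded in matrix units, the scalars move to the first
  components, and terms with the same matrix unit are collected.\<close>

lemma teq_normal_form:
  "t \<in> L \<Longrightarrow> t \<approx> map (\<lambda>(i, j). (coeff t i j, mu i j)) idx"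
proof (induction t)
  case Nil
  have "[] \<approx> map (\<lambda>(i, j). (0, mu i j)) qs" for qs
  proof (induction qs)
    case (Cons q qs)
    have "[(0, mu (fst q) (snd q))] \<approx> []" by (rule teq_zero) simp
    from tensor_eq.sym[OF teq_Cons[OF this tensor_eq.sym[OF Cons.IH]]] show ?case
      by (simp add: case_prod_unfold)
  qed (simp add: teq_refl)
  then show ?case by simp
next
  case (Cons x t)
  then obtain a d where x: "x = (a, d)" "a \<in> B" "d \<in> D" and t: "t \<in> L" by auto
  let ?c = "\<lambda>q. h d $$ q"
  let ?m = "\<lambda>q. mu (fst q) (snd q)"
  have scale: "map (\<lambda>q. (a, ?c q *s ?m q)) qs \<approx> map (\<lambda>q. (?c q *s a, ?m q)) qs" for qs
  proof (induction qs)
    case (Cons q qs)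
    have "[(a, ?c q *s ?m q)] \<approx> [(?c q *s a, ?m q)]"
      using tensor_eq.sym[OF tensor_eq.scale[of a "subalg B" "?m q" "subalg D" "?c q"]] x by simp
    from teq_Cons[OF this Cons.IH] show ?case by simp
  qed (simp add: teq_refl)
  have "d = sum_list (map (\<lambda>q. ?c q *s ?m q) idx)"
    using expand[OF x(3)] sum_idx[of "\<lambda>i j. ?c (i, j) *s mu i j"] by (simp add: case_prod_unfold)
  then have "[x] \<approx> map (\<lambda>q. (a, ?c q *s ?m q)) idx"
    using teq_sum_right[of a idx "\<lambda>q. ?c q *s ?m q"] x by (simp add: D_ops)
  also have "\<dots> \<approx> map (\<lambda>q. (?c q *s a, ?m q)) idx" by (rule scale)
  finally have "x # t \<approx> map (\<lambda>q. (?c q *s a, ?m q)) idx @ map (\<lambda>q. (coeff t (fst q) (snd q), ?m q)) idx"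
    using Cons.IH[OF t] by (intro teq_Cons) (simp_all add: case_prod_unfold)
  also have "\<dots> \<approx> map (\<lambda>q. (?c q *s a + coeff t (fst q) (snd q), ?m q)) idx"
    by (rule tensor_eq.sym[OF teq_map_add]) (use x t in \<open>auto intro: B_ops coeff_closed\<close>)
  finally show ?case using x by (simp add: case_prod_unfold)
qed

text \<open>Lists of equal value have equal coefficients and thus the same normal form.\<close>

lemma teq_iff: assumes "t \<in> L" shows "t \<approx> u \<longleftrightarrow> u \<in> L \<and> ev t = ev u"
proof
  assume "u \<in> L \<and> ev t = ev u"
  then have u: "u \<in> L" and eq: "ev t = ev u" by auto
  have "t \<approx> map (\<lambda>(i, j). (coeff t i j, mu i j)) idx" by (rule teq_normal_form[OF assms])
  also have "map (\<lambda>(i, j). (coeff t i j, mu i j)) idx = map (\<lambda>(i, j). (coeff u i j, mu i j)) idx"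
    using coeff_ev[OF assms] coeff_ev[OF u] eq by (auto simp: idx_iff)
  also have "\<dots> \<approx> u" by (rule tensor_eq.sym[OF teq_normal_form[OF u]])
  finally show "t \<approx> u" .
qed (use tensor_eq_sound in blast)

text \<open>For values of lists these are exactly the congruence classes, so \<open>fibre\<close> is
  the isomorphism onto the tensor product.\<close>

definition fibre :: "'a \<Rightarrow> ('a \<times> 'a) list set" where "fibre v = {u \<in> L. ev u = v}"

lemma class_eq_fibre: "t \<in> L \<Longrightarrow> tensor_class (subalg B) (subalg D) t = fibre (ev t)"
  by (auto simp: tensor_class_def teq_iff fibre_def)

lemma L_scale: "t \<in> L \<Longrightarrow> map (\<lambda>(a, b). (z *s a, b)) t \<in> L"
  by (induction t) (auto intro: B_ops)

lemma L_star: "t \<in> L \<Longrightarrow> map (\<lambda>(a, b). (star a, star b)) t \<in> L"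
  by (induction t) (auto intro: B_star D_star)

lemma L_mult1: "u \<in> L \<Longrightarrow> a \<in> B \<Longrightarrow> d \<in> D \<Longrightarrow> map (\<lambda>(a', b'). (a \<odot> a', d \<odot> b')) u \<in> L"
  by (induction u) (auto intro: B_mult D_mult)

lemma L_mult:
  "t \<in> L \<Longrightarrow> u \<in> L \<Longrightarrow> concat (map (\<lambda>(a, b). map (\<lambda>(a', b'). (a \<odot> a', b \<odot> b')) u) t) \<in> L"
proof (induction t)
  case (Cons x t)
  then obtain a d where x: "x = (a, d)" "a \<in> B" "d \<in> D" and t: "t \<in> L" by auto
  show ?case using Cons.IH[OF t Cons.prems(2)] L_mult1[OF Cons.prems(2) x(2,3)] x(1) by simp
qed simp

lemma ev_scale: "t \<in> L \<Longrightarrow> ev (map (\<lambda>(a, b). (z *s a, b)) t) = z *s ev t"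
  by (induction t) (auto simp: scale_right_distrib)

lemma ev_star: "t \<in> L \<Longrightarrow> ev (map (\<lambda>(a, b). (star a, star b)) t) = star (ev t)"
proof (induction t)
  case (Cons x t)
  then obtain a d where x: "x = (a, d)" "a \<in> B" "d \<in> D" and t: "t \<in> L" by auto
  have "star (a \<odot> d) = star d \<odot> star a" using x by (simp add: star_mult)
  also have "\<dots> = star a \<odot> star d" using BD[OF B_star[OF x(2)] D_star[OF x(3)]] by simp
  finally show ?case using Cons.IH[OF t] x t by (simp add: star_add)
qed simp

lemma ev_mult1: "u \<in> L \<Longrightarrow> a \<in> B \<Longrightarrow> d \<in> D \<Longrightarrow> ev (map (\<lambda>(a', b'). (a \<odot> a', d \<odot> b')) u) = a \<odot> d \<odot> ev u"
proof (induction u)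
  case (Cons x u)
  then obtain a' d' where x: "x = (a', d')" "a' \<in> B" "d' \<in> D" and u: "u \<in> L" by auto
  have "a \<odot> d \<odot> (a' \<odot> d') = a \<odot> ((d \<odot> a') \<odot> d')" using x Cons.prems by (simp add: mult_assoc)
  also have "d \<odot> a' = a' \<odot> d" using BD[OF x(2) Cons.prems(3)] by simp
  also have "a \<odot> ((a' \<odot> d) \<odot> d') = (a \<odot> a') \<odot> (d \<odot> d')" using x Cons.prems by (simp add: mult_assoc)
  finally show ?case using Cons x u by (simp add: mult_add_right)
qed simp

lemma ev_mult:
  "t \<in> L \<Longrightarrow> u \<in> L \<Longrightarrow>
    ev (concat (map (\<lambda>(a, b). map (\<lambda>(a', b'). (a \<odot> a', b \<odot> b')) u) t)) = ev t \<odot> ev u"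
proof (induction t)
  case (Cons x t)
  then obtain a d where x: "x = (a, d)" "a \<in> B" "d \<in> D" and t: "t \<in> L" by auto
  then show ?case using Cons by (simp add: ev_mult1 mult_add_left)
qed simp

lemma subalg_product_eq: "subalg_product B D = ev ` L"
proof
  show "subalg_product B D \<subseteq> ev ` L"
    unfolding subalg_product_def
  proof (rule span_minimal)
    show "{a \<odot> b |a b. a \<in> B \<and> b \<in> D} \<subseteq> ev ` L"
    proof safe
      fix a b assume "a \<in> B" "b \<in> D"
      then show "a \<odot> b \<in> ev ` L" by (intro image_eqI[of _ _ "[(a, b)]"]) auto
    qed
    show "subspace (ev ` L)"
    proof (rule subspaceI)
      show "0 \<in> ev ` L" by (rule image_eqI[of _ _ "[]"]) auto
      show "x + y \<in> ev ` L" if xy: "x \<in> ev ` L" "y \<in> ev ` L" for x y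
      proof -
        obtain t u where "t \<in> L" "u \<in> L" "x = ev t" "y = ev u" using xy by auto
        then show ?thesis by (intro image_eqI[of _ _ "t @ u"]) auto
      qed
      show "c *s x \<in> ev ` L" if x: "x \<in> ev ` L" for c x
      proof -
        obtain t where "t \<in> L" "x = ev t" using x by auto
        then show ?thesis
          by (intro image_eqI[of _ _ "map (\<lambda>(a, b). (c *s a, b)) t"]) (simp_all add: ev_scale L_scale)
      qed
    qed
  qed
  have "t \<in> L \<Longrightarrow> ev t \<in> subalg_product B D" for t
  proof (induction t)
    case Nil
    then show ?case by (simp add: subalg_product_def span_zero)
  next
    case (Cons x t)
    then obtain a d where x: "x = (a, d)" "a \<in> B" "d \<in> D" and t: "t \<in> L" by auto
    have "a \<odot> d \<in> subalg_product B D"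
      unfolding subalg_product_def by (rule span_base) (use x in blast)
    then show ?case using span_add Cons.IH[OF t] by (simp add: x(1) subalg_product_def)
  qed
  then show "ev ` L \<subseteq> subalg_product B D" by blast
qed

lemma tensor_isomorphic:
  "star_isomorphic (subalg (subalg_product B D)) (tensor_product (subalg B) (subalg D))"
proof -
  \<comment> \<open>The operations of \<open>tensor_product\<close> are unions over all
    representatives. Every representative yields the same fibre, and there is at least one, so the
    union is that fibre.\<close>
  have cls: "(\<Union>t\<in>fibre v. tensor_class (subalg B) (subalg D) (F t)) = fibre v'"
    if "v \<in> ev ` L" "\<And>t. t \<in> fibre v \<Longrightarrow> F t \<in> L \<and> ev (F t) = v'" for v v' F
  proof -
    have "(\<Union>t\<in>fibre v. tensor_class (subalg B) (subalg D) (F t)) = (\<Union>t\<in>fibre v. fibre v')"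
      using that(2) by (intro SUP_cong) (auto simp: class_eq_fibre)
    moreover have "fibre v \<noteq> {}" using that(1) by (auto simp: fibre_def)
    ultimately show ?thesis by simp
  qed
  have cls2: "(\<Union>t\<in>fibre v. \<Union>u\<in>fibre w. tensor_class (subalg B) (subalg D) (F t u)) = fibre v'"
    if "v \<in> ev ` L" "w \<in> ev ` L" "\<And>t u. t \<in> fibre v \<Longrightarrow> u \<in> fibre w \<Longrightarrow> F t u \<in> L \<and> ev (F t u) = v'" for v w v' F
  proof -
    have "(\<Union>t\<in>fibre v. \<Union>u\<in>fibre w. tensor_class (subalg B) (subalg D) (F t u)) = (\<Union>t\<in>fibre v. fibre v')"
      by (rule SUP_cong[OF HOL.refl], rule cls) (use that in auto)
    moreover have "fibre v \<noteq> {}" using that(1) by (auto simp: fibre_def)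
    ultimately show ?thesis by simp
  qed
  have inj: "inj_on fibre (ev ` L)"
    by (rule inj_onI) (auto simp: fibre_def set_eq_iff)
  have "bij_betw fibre (ev ` L) (tensor_class (subalg B) (subalg D) ` L)"
    unfolding bij_betw_def using inj by (auto simp: class_eq_fibre image_image)
  moreover have "fibre (a + b) = (\<Union>t\<in>fibre a. \<Union>u\<in>fibre b. tensor_class (subalg B) (subalg D) (t @ u))"
    if "a \<in> ev ` L" "b \<in> ev ` L" for a b
    by (rule cls2[OF that, symmetric]) (auto simp: fibre_def)
  moreover have "fibre (a \<odot> b) = (\<Union>t\<in>fibre a. \<Union>u\<in>fibre b. tensor_class (subalg B) (subalg D)
      (concat (map (\<lambda>(a, b). map (\<lambda>(a', b'). (a \<odot> a', b \<odot> b')) u) t)))"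
    if "a \<in> ev ` L" "b \<in> ev ` L" for a b
    by (rule cls2[OF that, symmetric]) (simp add: fibre_def ev_mult L_mult)
  moreover have "fibre (z *s a) = (\<Union>t\<in>fibre a. tensor_class (subalg B) (subalg D) (map (\<lambda>(a, b). (z *s a, b)) t))"
    if "a \<in> ev ` L" for a z
    by (rule cls[OF that, symmetric]) (simp add: fibre_def ev_scale L_scale)
  moreover have "fibre (star a) = (\<Union>t\<in>fibre a. tensor_class (subalg B) (subalg D) (map (\<lambda>(a, b). (star a, star b)) t))"
    if "a \<in> ev ` L" for a
    by (rule cls[OF that, symmetric]) (simp add: fibre_def ev_star L_star)
  ultimately show ?thesis
    unfolding star_isomorphic_def subalg_product_eq tensor_product_def by (intro exI[of _ fibre]) simp
qed

end

section \<open>Direct summands and bimodule maps\<close>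

context tracial_cstar_algebra
begin

text \<open>Both readings of the generated von Neumann algebra share three properties: a star
  subalgebra, inside the bicommutant, and compressing to its counterpart in the corner. The argument
  uses these three.\<close>

lemma summand_product:
  assumes D: "star_subalgebra D" and iso: "star_isomorphic (subalg D) (matrix_star_algebra n)"
    and w: "w \<in> A" "star w = w" "\<And>d. d \<in> D \<Longrightarrow> w \<odot> d = d \<odot> w"
  obtains p where "p \<in> D" "is_proj p" "\<And>d. d \<in> D \<Longrightarrow> p \<odot> d = d"
    and "\<And>vN. vN \<in> {bicommutant, generated} \<Longrightarrow>
      subalg_product (vN A w) D = subalg_product (vN (compression p) (p \<odot> w)) D \<and>
      star_isomorphic (subalg (subalg_product (vN (compression p) (p \<odot> w)) D))
        (tensor_product (subalg (vN (compression p) (p \<odot> w))) (subalg D))"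
proof -
  note DD = star_subalgebraD[OF D]
  have DA: "D \<subseteq> A" using DD(1) by auto
  obtain h where h: "bij_betw h D (carrier_mat n n)"
      "\<And>a b. a \<in> D \<Longrightarrow> b \<in> D \<Longrightarrow> h (a + b) = h a + h b"
      "\<And>a b. a \<in> D \<Longrightarrow> b \<in> D \<Longrightarrow> h (a \<odot> b) = h a * h b"
      "\<And>a z. a \<in> D \<Longrightarrow> h (z *s a) = z \<cdot>\<^sub>m h a"
      "\<And>a. a \<in> D \<Longrightarrow> h (star a) = map_mat cnj (transpose_mat (h a))"
    using iso unfolding star_isomorphic_def matrix_star_algebra_def subalg_def by auto
  interpret M: matrix_subalgebra scale A mult star e tr N D n h
    by unfold_locales (fact DA DD(2,3,4) h)+
  define p where "p = M.unit_D"
  note unitD = M.unit_D[folded p_def]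
  have p: "p \<in> D" "is_proj p" and pd: "\<And>d. d \<in> D \<Longrightarrow> p \<odot> d = d" using unitD by auto
  have pw: "p \<odot> w = w \<odot> p" using w(3)[OF p(1)] by simp
  interpret W: commuting_projection scale A mult star e tr N w p
    by unfold_locales (fact w(1,2) p(2) pw)+
  show thesis
  proof (rule that[OF p pd])
    fix vN assume "vN \<in> {bicommutant, generated}"
    then consider "vN = bicommutant" | "vN = generated" by auto
    then have "star_subalgebra (vN A w) \<and> vN A w \<subseteq> bicommutant A w \<and>
        vN (compression p) (p \<odot> w) = (\<lambda>b. p \<odot> b) ` vN A w"
    proof cases
      case 1
      then show ?thesis using W.bicommutant_props(1) W.bicommutant_compression by simp
    next
      case 2
      then show ?thesis using W.generated_props(1,2) W.generated_compression by simp
    qed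
    then have G: "star_subalgebra (vN A w)" "vN A w \<subseteq> bicommutant A w"
        "vN (compression p) (p \<odot> w) = (\<lambda>b. p \<odot> b) ` vN A w" by blast+
    have comm: "b \<odot> c = c \<odot> b" if "b \<in> vN A w" "c \<in> A" "w \<odot> c = c \<odot> w" for b c
      using W.bicommutant_props(2)[OF subsetD[OF G(2)]] that by blast
    have pb: "p \<odot> b = b \<odot> p" if "b \<in> vN A w" for b
      using comm[OF that DD(1)[OF p(1)]] pw by simp
    have GA [simp]: "b \<in> A" if "b \<in> vN A w" for b using star_subalgebraD(1)[OF G(1) that] .
    have [simp]: "p \<in> A" "d \<in> D \<Longrightarrow> d \<in> A" for d using DD(1) p(1) by auto
    \<comment> \<open>\<open>p\<close> commutes with \<open>b\<close> and fixes \<open>d\<close>, so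
      compressing the first factor changes no product; this makes the two product algebras
      equal.\<close>
    have bd: "p \<odot> b \<odot> d = b \<odot> d" if "b \<in> vN A w" "d \<in> D" for b d
      using that pd[OF that(2)] by (simp add: pb mult_assoc)
    define B where "B = (\<lambda>b. p \<odot> b) ` vN A w"
    have "{a \<odot> b |a b. a \<in> vN A w \<and> b \<in> D} = {a \<odot> b |a b. a \<in> B \<and> b \<in> D}"
      unfolding B_def using bd by (auto; metis imageI)
    then have 1: "subalg_product (vN A w) D = subalg_product B D"
      by (simp add: subalg_product_def)
    have sub: "star_subalgebra B"
      unfolding B_def by (rule W.star_subalgebra_compress[OF G(1)]) (rule pb)
    note BB = star_subalgebraD[OF sub]
    have BD: "b \<odot> d = d \<odot> b" if b: "b \<in> B" and d: "d \<in> D" for b d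
    proof -
      obtain a where a: "a \<in> vN A w" "b = p \<odot> a" using b by (auto simp: B_def)
      have "d \<odot> b = (d \<odot> p) \<odot> a" using a d by (simp add: mult_assoc)
      also have "\<dots> = d \<odot> a" using unitD(3)[OF d] by simp
      also have "\<dots> = a \<odot> d" using comm[OF a(1)] w(3) d by simp
      finally show ?thesis using bd[OF a(1) d] a by simp
    qed
    have pB: "M.unit_D \<odot> b = b" if "b \<in> B" for b
      using that p(2) by (auto simp: B_def p_def[symmetric] is_projD simp flip: mult_assoc)
    interpret C: commuting_subalgebras scale A mult star e tr N D n h B
    proof
      show "B \<subseteq> A" using BB(1) by blast
    qed (fact BB(2-4) BD pB)+
    have "star_isomorphic (subalg (subalg_product B D)) (tensor_product (subalg B) (subalg D))"
      by (rule C.tensor_isomorphic)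
    then show "subalg_product (vN A w) D = subalg_product (vN (compression p) (p \<odot> w)) D \<and>
      star_isomorphic (subalg (subalg_product (vN (compression p) (p \<odot> w)) D))
        (tensor_product (subalg (vN (compression p) (p \<odot> w))) (subalg D))"
      unfolding G(3) B_def[symmetric] using 1 by simp
  qed
qed

end

context star_linear_map
begin

definition bimodule_elements :: "'a set" where
  "bimodule_elements = {c \<in> A. \<forall>v\<in>A. \<phi> (c \<odot> v) = c \<odot> \<phi> v \<and> \<phi> (v \<odot> c) = \<phi> v \<odot> c}"

lemma bimodule_elementsD:
  assumes "c \<in> bimodule_elements"
  shows "c \<in> A" "v \<in> A \<Longrightarrow> \<phi> (c \<odot> v) = c \<odot> \<phi> v" "v \<in> A \<Longrightarrow> \<phi> (v \<odot> c) = \<phi> v \<odot> c"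
  using assms unfolding bimodule_elements_def by blast+

text \<open>Conjugation by \<open>star\<close> exchanges the two module laws: the left law for
  \<open>star c\<close> comes from the right law for \<open>c\<close>, and vice versa.\<close>

lemma bimodule_star:
  assumes c: "c \<in> bimodule_elements" shows "star c \<in> bimodule_elements"
  unfolding bimodule_elements_def
proof (intro CollectI conjI ballI)
  have cA: "c \<in> A" by (rule bimodule_elementsD[OF c])
  then show "star c \<in> A" by simp
  fix v assume v: "v \<in> A"
  have phi: "\<phi> v = star (\<phi> (star v))" using v by (simp add: phi_star)
  have "\<phi> (star c \<odot> v) = star (\<phi> (star v \<odot> c))" using v cA by (simp add: phi_star star_mult)
  also have "\<phi> (star v \<odot> c) = \<phi> (star v) \<odot> c" by (rule bimodule_elementsD(3)[OF c]) (use v in simp)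
  also have "star \<dots> = star c \<odot> \<phi> v" unfolding phi using v cA by (intro star_mult phi_closed) simp_all
  finally show "\<phi> (star c \<odot> v) = star c \<odot> \<phi> v" .
  have "\<phi> (v \<odot> star c) = star (\<phi> (c \<odot> star v))" using v cA by (simp add: phi_star star_mult)
  also have "\<phi> (c \<odot> star v) = c \<odot> \<phi> (star v)" by (rule bimodule_elementsD(2)[OF c]) (use v in simp)
  also have "star \<dots> = \<phi> v \<odot> star c" unfolding phi using v cA by (intro star_mult phi_closed) simp_all
  finally show "\<phi> (v \<odot> star c) = \<phi> v \<odot> star c" .
qed

lemma max_support_commutes:
  assumes c: "c \<in> bimodule_elements"
    and y: "y \<in> A" "\<phi> y = z *s y" "pos y" "is_range y p"
    and max: "\<And>y q. y \<in> A \<Longrightarrow> \<phi> y = z *s y \<Longrightarrow> pos y \<Longrightarrow> is_range y q \<Longrightarrow> pos (p - q)"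
  shows "p \<odot> c = c \<odot> p"
proof (rule commute_from_corners)
  show "is_proj p" using y(4) by (simp add: is_range_def)
  let ?E = "{y \<in> A. \<phi> y = z *s y}"
  have corner: "p \<odot> k = p \<odot> (k \<odot> p)" if k: "k \<in> bimodule_elements" for k
  proof (rule max_support_corner[of y ?E])
    have ks: "star k \<in> bimodule_elements" using k by (rule bimodule_star)
    show kA: "k \<in> A" by (rule bimodule_elementsD[OF k])
    have "\<phi> (star k \<odot> (y \<odot> k)) = star k \<odot> \<phi> (y \<odot> k)" using kA y(1) by (intro bimodule_elementsD(2)[OF ks]) simp
    also have "\<phi> (y \<odot> k) = \<phi> y \<odot> k" by (rule bimodule_elementsD(3)[OF k y(1)])
    finally show "star k \<odot> (y \<odot> k) \<in> ?E" using kA y by simp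
    show "y \<in> ?E" using y by simp
    show "pos y" "is_range y p" by (rule y)+
    show "pos (p - q)" if "y \<in> ?E" "pos y" "is_range y q" for y q
      by (rule max[OF _ _ that(2,3)]) (use that(1) in auto)
  qed
  show "c \<in> A" by (rule bimodule_elementsD[OF c])
  show "p \<odot> c = p \<odot> (c \<odot> p)" using c by (rule corner)
  show "p \<odot> star c = p \<odot> (star c \<odot> p)" using bimodule_star[OF c] by (rule corner)
qed

lemma funpow_commutes:
  assumes c: "c \<in> bimodule_elements" and p: "p \<in> A" "p \<odot> c = c \<odot> p"
  shows "c \<odot> (\<phi> ^^ j) p = (\<phi> ^^ j) p \<odot> c"
proof -
  have pj: "(\<phi> ^^ j) p \<in> A" for j by (induction j) (auto simp: p phi_closed)
  show ?thesis
  proof (induction j)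
    case (Suc j)
    have "c \<odot> (\<phi> ^^ Suc j) p = \<phi> (c \<odot> (\<phi> ^^ j) p)" using bimodule_elementsD(2)[OF c pj[of j]] by simp
    also have "\<dots> = (\<phi> ^^ Suc j) p \<odot> c" unfolding Suc.IH using bimodule_elementsD(3)[OF c pj[of j]] by simp
    finally show ?case .
  qed (simp add: p)
qed

lemma funpow_selfadjoint:
  assumes "p \<in> A" "star p = p" shows "star ((\<phi> ^^ j) p) = (\<phi> ^^ j) p"
proof -
  have "(\<phi> ^^ j) p \<in> A \<and> star ((\<phi> ^^ j) p) = (\<phi> ^^ j) p"
    by (induction j) (auto simp: assms phi_closed phi_star)
  then show ?thesis by simp
qed

end

lemma (in resolvent_limit) limit_commutes:
  assumes "c \<in> bimodule_elements" "p \<odot> c = c \<odot> p"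
  shows "\<zeta> \<odot> c = c \<odot> \<zeta>"
  using eigenvector_commutes[OF bimodule_elementsD(1)[OF assms(1)] funpow_commutes[OF assms(1) p assms(2)]]
  by simp

lemma (in resolvent_limit) limit_selfadjoint: "star p = p \<Longrightarrow> star \<zeta> = \<zeta>"
  by (rule eigenvector_selfadjoint[OF funpow_selfadjoint[OF p]])

section \<open>The theorem for planar algebras\<close>

lemma tracial_cstar_algebra_boxes:
  assumes "vector_space (scl PA)" "module.subspace (scl PA) (boxes PA n s)" and fd: "fd_cstar_algebra PA n s"
    and tr: "\<And>a b. a \<in> boxes PA n s \<Longrightarrow> b \<in> boxes PA n s \<Longrightarrow> tr (a + b) = tr a + tr b"
      "\<And>a z. a \<in> boxes PA n s \<Longrightarrow> tr (scl PA z a) = z * tr a"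
      "\<And>a. a \<in> boxes PA n s \<Longrightarrow> tr (mul PA n s (adj PA n s a) a) \<in> \<real>"
      "\<And>a. a \<in> boxes PA n s \<Longrightarrow> 0 \<le> Re (tr (mul PA n s (adj PA n s a) a))"
      "\<And>a. a \<in> boxes PA n s \<Longrightarrow> tr (mul PA n s (adj PA n s a) a) = 0 \<Longrightarrow> a = 0"
  shows "tracial_cstar_algebra (scl PA) (boxes PA n s) (mul PA n s) (adj PA n s) (unit PA n s) tr (nrm PA n s)"
  by (intro tracial_cstar_algebra.intro tracial_cstar_algebra_axioms.intro assms(1,2) tr)
    (use fd in \<open>simp_all add: fd_cstar_algebra_def Let_def\<close>)

context tracial_cstar_algebra
begin

lemma proj_le_antisym:
  assumes "is_proj p" "is_proj q" "pos (p - q)" "pos (q - p)"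
  shows "p = q"
proof -
  have qp: "q \<odot> p = q" and pq: "p \<odot> q = p" using assms proj_le_iff by blast+
  have "star (q \<odot> p) = p \<odot> q" using assms(1,2) by (simp add: star_mult is_projD)
  then show ?thesis using qp pq assms(2) by (simp add: is_projD)
qed

end

text \<open>For fixed \<open>s\<close> the notions on 1-boxes coincide with the abstract ones; the
  equations below transfer the abstract results.\<close>

locale cstar_planar_boxes = planar PA + tracial_cstar_algebra "scl PA" "boxes PA 1 s" "mul PA 1 s" "adj PA 1 s" "unit PA 1 s" tr "nrm PA 1 s"
  for PA :: "('a::ab_group_add) planar_data" and s :: shading and tr :: "'a \<Rightarrow> complex"
begin

lemma positive_iff: "positive PA 1 s a \<longleftrightarrow> pos a"
  by (simp only: positive_def pos_def)

lemma projections_iff: "q \<in> projections PA 1 s \<longleftrightarrow> is_proj q"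
  by (simp only: projections_def is_proj_def mem_Collect_eq)

lemma below_iff: "below PA 1 s a b \<longleftrightarrow> pos (b - a)"
  by (simp only: below_def positive_iff)

lemma is_range_projection_iff: "is_range_projection PA 1 s a q \<longleftrightarrow> is_range a q"
  unfolding is_range_projection_def is_range_def projections_iff Ball_def below_iff by blast

lemma bicommutant_in_eq: "bicommutant_in PA s = bicommutant"
  by (intro ext) (simp only: bicommutant_in_def bicommutant_def commutant_in_def commutant_def)

lemma generated_vN_eq: "generated_vN PA s = generated"
  by (intro ext) (simp only: generated_vN_def generated_def)

lemma corner_eq: "corner PA s = compression"
  by (intro ext) (simp only: corner_def compression_def)

lemma algebra_product_eq: "algebra_product PA s = subalg_product"
  by (intro ext) (simp only: algebra_product_def subalg_product_def)

lemma box_subalgebra_eq: "box_subalgebra PA s = subalg"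
  by (intro ext) (simp only: box_subalgebra_def subalg_def)

text \<open>\<open>D\<close> contains its own unit \<open>p\<close>, so the supremum is attained in
  \<open>D\<close>, although it is formed among all projections of the box algebra.\<close>

lemma projection_sup_eq:
  assumes p: "p \<in> D" "is_proj p" and D: "\<And>d. d \<in> D \<Longrightarrow> mul PA 1 s p d = d"
  shows "projection_sup PA 1 s D = p"
  unfolding projection_sup_def
proof (rule the_equality)
  have up: "below PA 1 s q p" if q: "q \<in> projections PA 1 s \<inter> D" for q
  proof -
    have qp: "is_proj q" using q projections_iff by blast
    have "mul PA 1 s p q = q" using D q by blast
    then have "adj PA 1 s (mul PA 1 s p q) = q" using is_projD(3)[OF qp] by simp
    then have "mul PA 1 s q p = q" using star_mult[OF is_projD(1)[OF p(2)] is_projD(1)[OF qp]] is_projD(3)[OF qp] is_projD(3)[OF p(2)] by simp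
    then show ?thesis unfolding below_iff using proj_le_iff[OF p(2) qp] by blast
  qed
  show "p \<in> projections PA 1 s \<and> (\<forall>q\<in>projections PA 1 s \<inter> D. below PA 1 s q p) \<and>
    (\<forall>p'\<in>projections PA 1 s. (\<forall>q\<in>projections PA 1 s \<inter> D. below PA 1 s q p') \<longrightarrow> below PA 1 s p p')"
    using up p projections_iff by blast
  fix p' assume p': "p' \<in> projections PA 1 s \<and> (\<forall>q\<in>projections PA 1 s \<inter> D. below PA 1 s q p') \<and>
    (\<forall>p''\<in>projections PA 1 s. (\<forall>q\<in>projections PA 1 s \<inter> D. below PA 1 s q p'') \<longrightarrow> below PA 1 s p' p'')"
  have "below PA 1 s p p'" using p' p projections_iff by blast
  moreover have "below PA 1 s p' p" using p' up p projections_iff by blast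
  moreover have "is_proj p'" using p' projections_iff by blast
  ultimately show "p' = p" unfolding below_iff using proj_le_antisym p(2) by blast
qed

end

theorem theorem5p4:
  fixes PA :: "('a::ab_group_add) planar_data"
    and s :: shading and x p_max \<zeta> :: 'a and r :: real
  assumes "cstar_planar_algebra PA"
    and "x \<in> boxes PA 2 s"
    and "f_positive PA s x"
    and "r = spectral_radius PA 2 s x"
    and "is_max_support PA s x r p_max"
    and "is_PF_eigenvector PA s x r p_max \<zeta>"
  shows "(\<forall>y \<in> C_algebra PA s x. mul PA 1 s p_max y = mul PA 1 s y p_max) \<and>
         (\<forall>y \<in> C_algebra PA s x. mul PA 1 s \<zeta> y = mul PA 1 s y \<zeta>) \<and>
         (\<forall>y \<in> C_algebra PA s x. mul PA 1 s \<zeta> y \<in> PF_space PA s x r) \<and>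
         (\<forall>D n p.
            direct_summand PA s (C_algebra PA s x) D \<and>
            0 < n \<and> star_isomorphic (box_subalgebra PA s D) (matrix_star_algebra n) \<and>
            p = projection_sup PA 1 s D \<longrightarrow>
            (\<forall>vN \<in> {bicommutant_in PA s, generated_vN PA s}.
               algebra_product PA s (vN (boxes PA 1 s) \<zeta>) D =
                 algebra_product PA s (vN (corner PA s p) (mul PA 1 s p \<zeta>)) D \<and>
               star_isomorphic
                 (box_subalgebra PA s
                    (algebra_product PA s (vN (corner PA s p) (mul PA 1 s p \<zeta>)) D))
                 (tensor_product
                    (box_subalgebra PA s (vN (corner PA s p) (mul PA 1 s p \<zeta>)))
                    (box_subalgebra PA s D))))"
proof -
  note [simp del] = One_nat_def
  have pa: "planar_algebra PA" and fd: "\<And>n s. fd_cstar_algebra PA n s"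
    using assms(1) unfolding cstar_planar_algebra_def by blast+
  have vs: "vector_space (scl PA)"
    using pa unfolding planar_algebra_def by (elim conjE) assumption
  have "\<forall>n s. module.subspace (scl PA) (boxes PA n s)"
    using pa unfolding planar_algebra_def by (elim conjE) assumption
  then have sub: "module.subspace (scl PA) (boxes PA n s)" for n s by simp
  have reflect: "act PA (reflect T) g = adj PA (width T) (shade T) (act PA T f)"
    if "valid T" "admissible PA T f" "\<forall>(l, n, s) \<in> inputs T. g l = adj PA n s (f l)" for T f g
  proof -
    have "\<forall>T f g. valid T \<and> admissible PA T f \<and> (\<forall>(l, n, s) \<in> inputs T. g l = adj PA n s (f l))
        \<longrightarrow> act PA (reflect T) g = adj PA (width T) (shade T) (act PA T f)"
      using assms(1) unfolding cstar_planar_algebra_def by (elim conjE) assumption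
    then show ?thesis using that by blast
  qed
  obtain tr :: "nat \<Rightarrow> shading \<Rightarrow> 'a \<Rightarrow> complex" where tr: "\<forall>n s.
        (\<forall>a\<in>boxes PA n s. \<forall>b\<in>boxes PA n s. tr n s (a + b) = tr n s a + tr n s b) \<and>
        (\<forall>a\<in>boxes PA n s. \<forall>z. tr n s (scl PA z a) = z * tr n s a) \<and>
        (\<forall>a\<in>boxes PA n s. \<forall>b\<in>boxes PA n s. tr n s (mul PA n s a b) = tr n s (mul PA n s b a)) \<and>
        (\<forall>a\<in>boxes PA n s. tr n s (mul PA n s (adj PA n s a) a) \<in> \<real>
            \<and> 0 \<le> Re (tr n s (mul PA n s (adj PA n s a) a))) \<and>
        (\<forall>a\<in>boxes PA n s. tr n s (mul PA n s (adj PA n s a) a) = 0 \<longrightarrow> a = 0) \<and>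
        (\<forall>a\<in>boxes PA n s. tr n s a = tr 0 s (close_up PA n s a))"
    using assms(1) unfolding cstar_planar_algebra_def by (elim conjE exE) (rule that)
  have tracial: "tracial_cstar_algebra (scl PA) (boxes PA n s) (mul PA n s) (adj PA n s) (unit PA n s) (tr n s) (nrm PA n s)" for n s
    by (rule tracial_cstar_algebra_boxes[OF vs sub fd]) (use tr in blast)+
  interpret planar PA by unfold_locales (rule pa)
  interpret cstar_planar_boxes PA s "tr 1 s"
    by (intro cstar_planar_boxes.intro planar_axioms tracial)
  \<comment> \<open>The Fourier transform of \<open>x\<close> lives here. Its positivity makes it
    self-adjoint, from which \<open>\<phi>\<close> obtains the law \<open>phi_star\<close>.\<close>
  interpret two: tracial_cstar_algebra "scl PA" "boxes PA 2 (flip s)" "mul PA 2 (flip s)" "adj PA 2 (flip s)"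
    "unit PA 2 (flip s)" "tr 2 (flip s)" "nrm PA 2 (flip s)" by (rule tracial)
  let ?C = "C_algebra PA s x"
  define X where "X = fourier PA s x"
  define \<phi> where "\<phi> = (\<lambda>y. convolve1 PA s y X)"
  have X: "X \<in> boxes PA 2 (flip s)" unfolding X_def by (rule fourier_closed[OF assms(2)])
  have "two.pos X" using assms(3) unfolding f_positive_def positive_def two.pos_def X_def .
  then have X_star: "adj PA 2 (flip s) X = X" using two.pos_selfadjoint by blast
  interpret star_linear_map "scl PA" "boxes PA 1 s" "mul PA 1 s" "adj PA 1 s" "unit PA 1 s" "tr 1 s" "nrm PA 1 s" \<phi>
  proof
    fix v assume v: "v \<in> boxes PA 1 s"
    show "\<phi> v \<in> boxes PA 1 s" unfolding \<phi>_def using v X by (rule convolve1_closed)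
    show "\<phi> (scl PA z v) = scl PA z (\<phi> v)" for z unfolding \<phi>_def using v X by (rule convolve1_scale)
    show "adj PA 1 s (\<phi> v) = \<phi> (adj PA 1 s v)"
      unfolding \<phi>_def using convolve1_adj[OF reflect v star_closed[OF v] X] X X_star by simp
    fix w assume w: "w \<in> boxes PA 1 s"
    show "\<phi> (v + w) = \<phi> v + \<phi> w" unfolding \<phi>_def using v w X by (rule convolve1_add)
  qed
  have C: "c \<in> bimodule_elements" if c: "c \<in> ?C" for c
  proof -
    have "\<phi> (mul PA 1 s c v) = mul PA 1 s c (\<phi> v)" "\<phi> (mul PA 1 s v c) = mul PA 1 s (\<phi> v) c"
      if "v \<in> boxes PA 1 s" for v
      unfolding \<phi>_def X_def
      by (rule convolve1_mul_left[OF assms(2) that c, symmetric] convolve1_mul_right[OF assms(2) that c, symmetric])+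
    moreover have "c \<in> boxes PA 1 s" using c unfolding C_algebra_def by blast
    ultimately show ?thesis by (simp add: bimodule_elements_def)
  qed
  have PF: "PF_space PA s x r = {y \<in> boxes PA 1 s. \<phi> y = scl PA (complex_of_real r) y}"
    by (simp add: PF_space_def \<phi>_def X_def)
  obtain y where y: "y \<in> boxes PA 1 s" "\<phi> y = scl PA (complex_of_real r) y" "pos y" "is_range y p_max"
    using assms(5) unfolding is_max_support_def PF_supports_def positive_iff is_range_projection_iff PF by blast
  have max: "pos (p_max - q)"
    if "y \<in> boxes PA 1 s" "\<phi> y = scl PA (complex_of_real r) y" "pos y" "is_range y q" for y q
    using that assms(5)
    unfolding is_max_support_def PF_supports_def positive_iff is_range_projection_iff PF below_iff by blast
  have p_max: "is_proj p_max" using y(4) unfolding is_range_def by blast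
  have p_comm: "mul PA 1 s p_max c = mul PA 1 s c p_max" if "c \<in> ?C" for c
    using max_support_commutes[OF C[OF that] y max] .
  obtain S where \<zeta>: "\<zeta> \<in> boxes PA 1 s"
    and S: "\<And>z. z > r \<Longrightarrow> series_sum PA 1 s (\<lambda>j. scl PA (complex_of_real (1 / z ^ (j + 1)))
                  (convolve1_power PA s p_max (fourier PA s x) j)) (S z)"
    and lim: "((\<lambda>z. nrm PA 1 s (scl PA (complex_of_real (z - r)) (S z) - \<zeta>)) \<longlongrightarrow> 0) (at_right r)"
    using assms(6) unfolding is_PF_eigenvector_def by blast
  have power: "convolve1_power PA s p_max (fourier PA s x) j = (\<phi> ^^ j) p_max" for j
    unfolding \<phi>_def X_def[symmetric] by (rule convolve1_power_eq_funpow[OF is_projD(1)[OF p_max] X])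
  have powA: "(\<phi> ^^ j) p_max \<in> boxes PA 1 s" for j
    by (induction j) (simp_all add: is_projD(1)[OF p_max] phi_closed)
  interpret resolvent_limit "scl PA" "boxes PA 1 s" "mul PA 1 s" "adj PA 1 s" "unit PA 1 s" "tr 1 s" "nrm PA 1 s" \<phi> r p_max \<zeta> S
  proof
    show "norm_lim (\<lambda>n. \<Sum>j<n. scl PA (complex_of_real (1 / z ^ (j + 1))) ((\<phi> ^^ j) p_max)) (S z) sequentially"
      if "z > r" for z
      unfolding norm_lim_def
      using S[OF that] unfolding series_sum_def power
      by (intro conjI allI sum_closed scale_closed powA) blast+
  qed (fact is_projD(1)[OF p_max] \<zeta> lim)+
  have \<zeta>_comm: "mul PA 1 s \<zeta> c = mul PA 1 s c \<zeta>" if "c \<in> ?C" for c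
    using limit_commutes[OF C[OF that] p_comm[OF that]] .
  have \<zeta>_star: "adj PA 1 s \<zeta> = \<zeta>" by (rule limit_selfadjoint[OF is_projD(3)[OF p_max]])
  \<comment> \<open>By the right module law, applying \<open>\<phi>\<close> to the product gives the
    product of \<open>\<phi> \<zeta>\<close> and \<open>c\<close>.\<close>
  have "mul PA 1 s \<zeta> c \<in> PF_space PA s x r" if c: "c \<in> ?C" for c
    unfolding PF using bimodule_elementsD[OF C[OF c]] \<zeta> phi_eigenvector by simp
  moreover have "algebra_product PA s (vN (boxes PA 1 s) \<zeta>) D =
        algebra_product PA s (vN (corner PA s p) (mul PA 1 s p \<zeta>)) D \<and>
      star_isomorphic (box_subalgebra PA s (algebra_product PA s (vN (corner PA s p) (mul PA 1 s p \<zeta>)) D))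
        (tensor_product (box_subalgebra PA s (vN (corner PA s p) (mul PA 1 s p \<zeta>))) (box_subalgebra PA s D))"
    if D: "direct_summand PA s ?C D"
      and iso: "star_isomorphic (box_subalgebra PA s D) (matrix_star_algebra n)"
      and p: "p = projection_sup PA 1 s D" and vN: "vN \<in> {bicommutant_in PA s, generated_vN PA s}"
    for D n p vN
  proof -
    have ideal: "star_ideal PA s ?C D" using D unfolding direct_summand_def by blast
    then have DC: "D \<subseteq> ?C" unfolding star_ideal_def by blast
    have "star_subalgebra D"
      unfolding star_subalgebra_def
    proof (intro conjI ballI)
      show "D \<subseteq> boxes PA 1 s" using DC unfolding C_algebra_def by blast
    qed (use ideal DC in \<open>unfold star_ideal_def, blast+\<close>)
    then obtain q where q: "q \<in> D" "is_proj q" "\<And>d. d \<in> D \<Longrightarrow> mul PA 1 s q d = d"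
      and prod: "\<And>vN. vN \<in> {bicommutant, generated} \<Longrightarrow>
        subalg_product (vN (boxes PA 1 s) \<zeta>) D = subalg_product (vN (compression q) (mul PA 1 s q \<zeta>)) D \<and>
        star_isomorphic (subalg (subalg_product (vN (compression q) (mul PA 1 s q \<zeta>)) D))
          (tensor_product (subalg (vN (compression q) (mul PA 1 s q \<zeta>))) (subalg D))"
      using summand_product[OF _ iso[unfolded box_subalgebra_eq] \<zeta> \<zeta>_star \<zeta>_comm] DC by blast
    have "p = q" unfolding p by (rule projection_sup_eq[OF q])
    then show ?thesis
      using prod[of vN] vN
      unfolding bicommutant_in_eq generated_vN_eq corner_eq algebra_product_eq box_subalgebra_eq by blast
  qed
  ultimately show ?thesis using p_comm \<zeta>_comm by blast
qed

end
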